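(* For each dimension $d\ge1$, each nonnegative integer $D$, and each $\eta>0$ there exist a constant $C<\infty$ and a function $\delta\mapsto\varepsilon(\delta)$ satisfying $\lim_{\delta\to0}\varepsilon(\delta)=0$, both depending only on $d,D,\eta$, with the following property. Let $\mathbb B\subset\mathbb R^d$ be any ball of positive, finite radius, and let $\tilde{\mathbb B}\subset\mathbb R^d$ be a ball of positive, finite radius centered at the origin. Suppose that $|\tilde{\mathbb B}|\ge\eta|\mathbb B|$, $0<\delta\le1$, and $A\in[0,\infty)$. Let $\varphi:\mathbb B+\tilde{\mathbb B}\to\mathbb C$ be Lebesgue measurable. Suppose that there exists a function $\mathbb B\times\tilde{\mathbb B}\ni(x,h)\mapsto P_h(x)\in\mathbb C$ such that $$\big|\varphi(x+h)-\varphi(x)-P_h(x)\big|\le A$$ for all $(x,h)\in\mathbb B\times\tilde{\mathbb B}$ with the exception of a set of measure $\le\delta|\mathbb B|\cdot|\tilde{\mathbb B}|$, and that $$P_h(x)=\sum_{|\alpha|\le D}a_\alpha(h)x^\alpha$$ is a polynomial function of $x$ of degree $\le D$ whose coefficients $a_\alpha$ are Lebesgue measurable functions of $h$. Then there exists a polynomial $Q$ of degree at most $D+1$ such that $$|\varphi(x)-Q(x)|\le CA$$ for all $x\in\mathbb B$ outside a set of measure $\le\varepsilon(\delta)|\mathbb B|$.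
   Context: $|E|$ denotes the Lebesgue measure of $E$. Polynomials have complex coefficients. $\alpha$ ranges over multi-indices in $\mathbb N_0^d$. *)

theory Defs
  imports "HOL-Analysis.Analysis" "HOL-Library.Set_Algebras"
begin

(* Multi-indices in N_0^d are functions 'n => nat on the finite index type 'n, with d = CARD('n). *)

definition mi_degree :: "('n::finite \<Rightarrow> nat) \<Rightarrow> nat" where
  "mi_degree \<alpha> = (\<Sum>i\<in>UNIV. \<alpha> i)"

definition mi_power :: "real ^ 'n \<Rightarrow> ('n::finite \<Rightarrow> nat) \<Rightarrow> real" where
  "mi_power x \<alpha> = (\<Prod>i\<in>UNIV. (x $ i) ^ \<alpha> i)"

definition poly_eval :: "nat \<Rightarrow> (('n::finite \<Rightarrow> nat) \<Rightarrow> complex) \<Rightarrow> real ^ 'n \<Rightarrow> complex" where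
  "poly_eval D a x = (\<Sum>\<alpha> | mi_degree \<alpha> \<le> D. a \<alpha> * complex_of_real (mi_power x \<alpha>))"

(* The sum in poly_eval is a genuine finite sum, not the value 0 of a sum over an infinite set. *)
lemma finite_mi_degree_le: "finite {\<alpha> :: 'n::finite \<Rightarrow> nat. mi_degree \<alpha> \<le> D}"
proof (rule finite_subset)
  show "{\<alpha> :: 'n \<Rightarrow> nat. mi_degree \<alpha> \<le> D} \<subseteq> PiE UNIV (\<lambda>_. {..D})"
  proof
    fix \<alpha> :: "'n \<Rightarrow> nat"
    assume "\<alpha> \<in> {\<alpha>. mi_degree \<alpha> \<le> D}"
    then have "\<alpha> i \<le> D" for i
      using member_le_sum[of i UNIV \<alpha>] by (simp add: mi_degree_def)
    then show "\<alpha> \<in> PiE UNIV (\<lambda>_. {..D})" by (simp add: PiE_UNIV_domain)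
  qed
  show "finite (PiE (UNIV :: 'n set) (\<lambda>_. {..D}))"
    by (intro finite_PiE) auto
qed

definition polynomial_of_degree_le :: "nat \<Rightarrow> (real ^ 'n::finite \<Rightarrow> complex) \<Rightarrow> bool" where
  "polynomial_of_degree_le D Q \<longleftrightarrow> (\<exists>a. \<forall>x. Q x = poly_eval D a x)"

(* Balls of positive finite radius; both the open and the closed ball are admitted. *)
definition is_ball :: "'a::metric_space \<Rightarrow> 'a set \<Rightarrow> bool" where
  "is_ball c B \<longleftrightarrow> (\<exists>r>0. B = ball c r \<or> B = cball c r)"

end

theory Submission
  imports Defs "HOL-Complex_Analysis.Great_Picard"
begin

text \<open>
  Rescale \<open>B\<close> to the unit ball \<open>U\<close>, put \<open>m = D + 2\<close>, and write \<open>k\<close> for a small multiple of \<open>b - x\<close>.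
  Comparing the hypothesis at \<open>(x, h + k)\<close> and \<open>(x + k, h)\<close> for one well chosen \<open>h\<close>, the value of
  \<open>\<phi>\<close> at \<open>x + h + k\<close> cancels, and \<open>\<phi> (x + k) - \<phi> x\<close> is a difference of two polynomials in \<open>x\<close>, up to \<open>2 A\<close>.
  Hence the \<open>m\<close>-th difference of \<open>\<phi>\<close> along the segment from \<open>x\<close> towards \<open>b\<close> is \<open>O(A)\<close> for most pairs \<open>(x, b)\<close>.

  The difference equation expresses \<open>\<phi> x\<close> through averages of \<open>\<phi>\<close> over \<open>b\<close>, a compact operation. So if
  normalized functions violated the conclusion with \<open>A \<longrightarrow> 0\<close> and \<open>\<delta> \<longrightarrow> 0\<close>, a subsequence would converge
  uniformly off small sets to a continuous function all of whose \<open>m\<close>-th differences vanish, and subtracting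
  that function contradicts the normalization. Continuous functions with vanishing \<open>m\<close>-th differences are
  polynomials of degree less than \<open>m\<close> by a theorem of Frechet.
\<close>

section \<open>Binomial differences and interpolation\<close>

text \<open>Steps from \<open>x\<close> are aimed at a second point \<open>b\<close> of
  \<open>U\<close>. Convexity then keeps every node in \<open>U\<close>, so nothing is lost near the
  boundary, and for \<open>j \<ge> 1\<close> the node is affine in \<open>b\<close> with ratio at
  least \<open>\<tau>\<close>, so a small set is hit from few directions. There is no a priori bound
  on \<open>\<phi>\<close>. Size is measured instead by the distance to the solutions of the
  difference equation, off a set of fixed measure \<open>e0\<close>; this can be normalized for any
  measurable function. A bound off such a set, which need not shrink with \<delta>, is transported
  along a single good direction to every point that has few bad directions, at the cost of a factor
  \<open>2 ^ m\<close>. This device makes the normalized functions bounded where averaging needs it,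
  and afterwards it improves the outcome of the compactness argument. Accordingly compactness yields
  only the constant \<open>C\<close> and a threshold for \<delta>, neither of them explicit. The
  exceptional set is explicit: it consists, up to a null set, of the points with too many bad
  directions, and Markov's inequality gives it a measure proportional to the square root of
  \<delta>.\<close>

definition fdiff :: "nat \<Rightarrow> (nat \<Rightarrow> complex) \<Rightarrow> complex" where
  "fdiff n f = (\<Sum>i\<le>n. (-1) ^ i * of_nat (n choose i) * f i)"

lemma fdiff_0 [simp]: "fdiff 0 f = f 0"
  by (simp add: fdiff_def)

text \<open>With this sign convention \<open>fdiff n\<close> is the n-th power of identity minus
  shift, so the value at 0 has coefficient 1 and can be solved for.\<close>

lemma fdiff_Suc: "fdiff (Suc n) f = fdiff n f - fdiff n (\<lambda>i. f (Suc i))"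
proof -
  have "fdiff (Suc n) f = f 0 + (\<Sum>i\<le>n. (-1) ^ Suc i * of_nat (Suc n choose Suc i) * f (Suc i))"
    unfolding fdiff_def by (subst sum.atMost_Suc_shift) simp
  also have "(\<Sum>i\<le>n. (-1) ^ Suc i * of_nat (Suc n choose Suc i) * f (Suc i))
      = (\<Sum>i\<le>n. (-1) ^ Suc i * of_nat (n choose Suc i) * f (Suc i)) - fdiff n (\<lambda>i. f (Suc i))"
    unfolding fdiff_def by (subst sum_subtractf [symmetric], intro sum.cong) (simp_all add: algebra_simps)
  also have "f 0 + ((\<Sum>i\<le>n. (-1) ^ Suc i * of_nat (n choose Suc i) * f (Suc i)) - fdiff n (\<lambda>i. f (Suc i)))
     = (\<Sum>i\<le>Suc n. (-1) ^ i * of_nat (n choose i) * f i) - fdiff n (\<lambda>i. f (Suc i))"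
    by (subst sum.atMost_Suc_shift) simp
  also have "(\<Sum>i\<le>Suc n. (-1) ^ i * of_nat (n choose i) * f i) = fdiff n f"
    unfolding fdiff_def by simp
  finally show ?thesis .
qed

lemma fdiff_cong: "(\<And>i. i \<le> n \<Longrightarrow> f i = g i) \<Longrightarrow> fdiff n f = fdiff n g"
  unfolding fdiff_def by (intro sum.cong) auto

lemma fdiff_add: "fdiff n (\<lambda>i. f i + g i) = fdiff n f + fdiff n g"
  by (simp add: fdiff_def algebra_simps sum.distrib)

lemma fdiff_diff: "fdiff n (\<lambda>i. f i - g i) = fdiff n f - fdiff n g"
  by (simp add: fdiff_def algebra_simps sum_subtractf)

lemma fdiff_divide: "fdiff n (\<lambda>i. f i / c) = fdiff n f / c"
  by (simp add: fdiff_def sum_divide_distrib)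

lemma fdiff_cmult: "fdiff n (\<lambda>i. c * f i) = c * fdiff n f"
  by (simp add: fdiff_def sum_distrib_left mult_ac)

lemma fdiff_shift: "fdiff n f = f 0 + (\<Sum>i=1..n. (-1) ^ i * of_nat (n choose i) * f i)"
proof -
  have "{..n} = insert 0 {1..n}" by auto
  then show ?thesis unfolding fdiff_def by simp
qed

lemma sum_choose_Icc: "(\<Sum>i=1..n. real (n choose i)) \<le> 2 ^ n"
proof -
  have "(\<Sum>i=1..n. real (n choose i)) \<le> (\<Sum>i\<le>n. real (n choose i))"
    by (intro sum_mono2) auto
  also have "\<dots> = 2 ^ n"
    using arg_cong[OF choose_row_sum[of n], of real] by simp
  finally show ?thesis .
qed

lemma norm_fdiff_le:
  assumes "\<And>i. i \<le> n \<Longrightarrow> norm (f i) \<le> c"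
  shows "norm (fdiff n f) \<le> 2 ^ n * c"
proof -
  have "norm (fdiff n f) \<le> (\<Sum>i\<le>n. real (n choose i) * c)"
    unfolding fdiff_def using assms
    by (intro sum_norm_le) (auto simp: norm_mult norm_power intro!: mult_left_mono)
  also have "\<dots> = 2 ^ n * c"
    using arg_cong[OF choose_row_sum[of n], of real] by (simp add: sum_distrib_right[symmetric])
  finally show ?thesis .
qed

text \<open>The base value has coefficient 1, so it is controlled by the difference and the
  remaining values. Both the bootstrap and the outward extension in Frechet's theorem rest on
  this.\<close>

lemma norm_0_le_fdiff:
  assumes "\<And>i. 1 \<le> i \<Longrightarrow> i \<le> n \<Longrightarrow> norm (f i) \<le> c" "0 \<le> c"
  shows "norm (f 0) \<le> norm (fdiff n f) + 2 ^ n * c"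
proof -
  have "norm (\<Sum>i=1..n. (-1) ^ i * of_nat (n choose i) * f i) \<le> (\<Sum>i=1..n. real (n choose i) * c)"
    using assms by (intro sum_norm_le) (auto simp: norm_mult norm_power intro!: mult_left_mono)
  also have "\<dots> = (\<Sum>i=1..n. real (n choose i)) * c"
    by (simp add: sum_distrib_right[symmetric])
  also have "\<dots> \<le> 2 ^ n * c"
    by (intro mult_right_mono sum_choose_Icc assms)
  finally have *: "norm (\<Sum>i=1..n. (-1) ^ i * of_nat (n choose i) * f i) \<le> 2 ^ n * c" .
  have "f 0 = fdiff n f - (\<Sum>i=1..n. (-1) ^ i * of_nat (n choose i) * f i)"
    by (simp add: fdiff_shift)
  then have "norm (f 0) \<le> norm (fdiff n f) + norm (\<Sum>i=1..n. (-1) ^ i * of_nat (n choose i) * f i)"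
    by (metis norm_triangle_ineq4)
  with * show ?thesis by linarith
qed

section \<open>Differences annihilate polynomials\<close>

lemma degree_pcompose_linear_less:
  assumes "degree p < n"
  shows "degree (pcompose p [:a, b:]) < n"
proof -
  have "degree (pcompose p [:a, b:]) \<le> degree p * degree [:a, b:]" by (rule degree_pcompose_le)
  also have "\<dots> \<le> degree p * 1" by (intro mult_left_mono) auto
  finally show ?thesis using assms by simp
qed

text \<open>One difference lowers the degree, because \<open>p\<close> and its translate by 1 share
  the leading coefficient. Constants have no degree to lose and are treated apart.\<close>

lemma fdiff_poly:
  fixes p :: "complex poly"
  assumes "degree p < n"
  shows "fdiff n (\<lambda>i. poly p (of_nat i)) = 0"
  using assms
proof (induction n arbitrary: p)
  case (Suc n)
  define q where "q = p - pcompose p [:1, 1:]"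
  have eq: "fdiff (Suc n) (\<lambda>i. poly p (of_nat i)) = fdiff n (\<lambda>i. poly q (of_nat i))"
    by (simp add: fdiff_Suc fdiff_diff [symmetric] q_def poly_pcompose add.commute)
  show ?case
  proof (cases "degree p = 0")
    case True
    then obtain c where "p = [:c:]" by (rule degree_eq_zeroE)
    then have "q = 0" by (simp add: q_def)
    then show ?thesis unfolding eq by (simp add: fdiff_def)
  next
    case False
    have d: "degree (pcompose p [:1, 1:]) = degree p" by (simp add: degree_pcompose)
    have "lead_coeff (pcompose p [:1, 1:]) = lead_coeff p"
      by (subst lead_coeff_comp) auto
    then have "coeff q (degree p) = 0" by (simp add: q_def d)
    moreover have "degree q \<le> degree p" unfolding q_def by (intro degree_diff_le) (auto simp: d)
    ultimately have "degree q < degree p"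
      by (metis False degree_0 leading_coeff_0_iff le_neq_implies_less neq0_conv)
    then have "degree q < n" using Suc.prems by simp
    then show ?thesis unfolding eq by (rule Suc.IH)
  qed
qed auto

lemma fdiff_poly_affine:
  fixes p :: "complex poly"
  assumes "degree p < n"
  shows "fdiff n (\<lambda>i. poly p (a + of_nat i * b)) = 0"
proof -
  have "degree (pcompose p [:a, b:]) < n"
    using assms by (rule degree_pcompose_linear_less)
  from fdiff_poly[OF this] show ?thesis by (simp add: poly_pcompose)
qed

section \<open>Interpolation and continuous functions of one variable\<close>

lemma exists_interpolating_poly:
  fixes y :: "nat \<Rightarrow> complex"
  assumes "inj_on x {..<n}" "0 < n"
  shows "\<exists>p. degree p < n \<and> (\<forall>i<n. poly p (x i) = y i)"
  using assms
proof (induction n)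
  case (Suc n)
  show ?case
  proof (cases "n = 0")
    case True
    then show ?thesis by (intro exI[of _ "[:y 0:]"]) auto
  next
    case False
    with Suc obtain p where p: "degree p < n" "\<And>i. i < n \<Longrightarrow> poly p (x i) = y i"
      by (metis inj_on_subset lessThan_subset_iff le_SucI order_refl neq0_conv)
    define w where "w = (\<Prod>i<n. [:- x i, 1:])"
    have w0: "poly w (x i) = 0" if "i < n" for i
      using that by (auto simp: w_def poly_prod)
    have wn: "poly w (x n) \<noteq> 0"
      using Suc.prems(1) by (fastforce simp: w_def poly_prod inj_on_def)
    have dw: "degree w \<le> n"
      unfolding w_def using degree_prod_sum_le[of "{..<n}" "\<lambda>i. [:- x i, 1:]"] by (simp add: o_def)
    \<comment> \<open>Newton's correction: \<open>w\<close> vanishes at the earlier nodes, so the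
      values already attained are kept.\<close>
    define q where "q = p + smult ((y n - poly p (x n)) / poly w (x n)) w"
    have "degree q < Suc n"
      unfolding q_def using p(1) dw
      by (intro le_imp_less_Suc degree_add_le order.trans[OF degree_smult_le]) auto
    moreover have "poly q (x i) = y i" if "i < Suc n" for i
      using that p w0 wn by (cases "i = n") (auto simp: q_def)
    ultimately show ?thesis by blast
  qed
qed auto

text \<open>Vanishing differences are a recurrence whose last term has coefficient 1 or -1. The
  sequence is therefore determined by its first \<open>m\<close> values, and an interpolating
  polynomial obeys the same recurrence.\<close>

lemma fdiff_zero_imp_poly:
  fixes a :: "nat \<Rightarrow> complex"
  assumes "0 < m" and "\<And>i. i + m \<le> L \<Longrightarrow> fdiff m (\<lambda>j. a (i + j)) = 0"
  shows "\<exists>p. degree p < m \<and> (\<forall>i\<le>L. poly p (of_nat i) = a i)"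
proof -
  have "inj_on (of_nat :: nat \<Rightarrow> complex) {..<m}" by (auto simp: inj_on_def)
  from exists_interpolating_poly[OF this assms(1)]
  obtain p where p: "degree p < m" "\<And>i. i < m \<Longrightarrow> poly p (of_nat i) = a i" by blast
  have "poly p (of_nat i) = a i" if "i \<le> L" for i
    using that
  proof (induction i rule: less_induct)
    case (less i)
    show ?case
    proof (cases "i < m")
      case False
      define k where "k = i - m"
      have i: "i = k + m" using False by (simp add: k_def)
      define d where "d j = a (k + j) - poly p (of_nat (k + j))" for j
      have d0: "d j = 0" if "j < m" for j
        using less.IH[of "k + j"] less.prems that unfolding d_def i by simp
      have "fdiff m d = 0"
        using assms(2)[of k] less.prems fdiff_poly_affine[OF p(1), of "of_nat k" 1]
        by (simp add: d_def [abs_def] fdiff_diff i)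
      moreover have "fdiff m d = (-1) ^ m * d m"
      proof -
        have "fdiff m d = (\<Sum>i\<in>{m}. (-1) ^ i * of_nat (m choose i) * d i)"
          unfolding fdiff_def by (rule sum.mono_neutral_right) (auto simp: d0)
        then show ?thesis by simp
      qed
      ultimately show ?thesis by (simp add: d_def i)
    qed (simp add: p)
  qed
  with p show ?thesis by blast
qed

text \<open>On every uniform grid the function agrees with a polynomial of degree less than
  \<open>m\<close>. Refined grids share enough points to force one common polynomial, and continuity
  passes from grid points to the whole interval.\<close>

lemma continuous_imp_poly:
  fixes f :: "real \<Rightarrow> complex"
  assumes "0 < m" and cont: "continuous_on {0..1} f"
    and fd: "\<And>t s. 0 \<le> t \<Longrightarrow> 0 \<le> s \<Longrightarrow> t + real m * s \<le> 1 \<Longrightarrow> fdiff m (\<lambda>j. f (t + real j * s)) = 0"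
  shows "\<exists>p. degree p < m \<and> (\<forall>t\<in>{0..1}. f t = poly p (of_real t))"
proof -
  have ex: "\<exists>p. degree p < m \<and> (\<forall>i\<le>N. poly p (of_nat i / of_nat N) = f (real i / real N))"
    if "N > 0" for N
  proof -
    have "fdiff m (\<lambda>j. f (real (i + j) / real N)) = 0" if "i + m \<le> N" for i
    proof -
      have "real i + real m \<le> real N" using that by linarith
      then have "real i / real N + real m * (1 / real N) \<le> 1" using \<open>N > 0\<close>
        by (simp add: field_simps)
      from fd[OF _ _ this] show ?thesis by (simp add: add_divide_distrib)
    qed
    from fdiff_zero_imp_poly[OF assms(1) this]
    obtain p where p: "degree p < m" "\<And>i. i \<le> N \<Longrightarrow> poly p (of_nat i) = f (real i / real N)" by blast
    have "degree (pcompose p [:0, of_nat N:]) < m"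
      using p(1) by (rule degree_pcompose_linear_less)
    moreover have "poly (pcompose p [:0, of_nat N:]) (of_nat i / of_nat N) = f (real i / real N)"
      if "i \<le> N" for i
      using p(2)[OF that] \<open>N > 0\<close> by (simp add: poly_pcompose)
    ultimately show ?thesis by blast
  qed
  define P where "P N = (SOME p. degree p < m \<and> (\<forall>i\<le>N. poly p (of_nat i / of_nat N) = f (real i / real N)))" for N
  have P: "degree (P N) < m" "\<And>i. i \<le> N \<Longrightarrow> poly (P N) (of_nat i / of_nat N) = f (real i / real N)" if "N > 0" for N
    using someI_ex[OF ex[OF that]] by (auto simp: P_def)
  \<comment> \<open>Denominators are multiples of \<open>m\<close> so that all grids share the
    \<open>m + 1\<close> points \<open>i / m\<close>, which determine a polynomial of degree less
    than \<open>m\<close>.\<close>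
  have PM: "P (m * N) = P m" if "N > 0" for N
  proof (rule poly_eqI_degree)
    let ?A = "(\<lambda>i. of_nat i / of_nat m :: complex) ` {..m}"
    have "inj_on (\<lambda>i. of_nat i / of_nat m :: complex) {..m}" using assms(1) by (auto simp: inj_on_def)
    then have card: "card ?A = Suc m" by (simp add: card_image)
    show "degree (P (m * N)) < card ?A" "degree (P m) < card ?A"
      using P(1)[of "m * N"] P(1)[of m] assms(1) that unfolding card by auto
    fix x assume "x \<in> ?A"
    then obtain i where i: "i \<le> m" "x = of_nat i / of_nat m" by auto
    have "poly (P (m * N)) (of_nat (i * N) / of_nat (m * N)) = f (real (i * N) / real (m * N))"
      using assms(1) that i by (intro P(2)) auto
    then show "poly (P (m * N)) x = poly (P m) x"
      using P(2)[of m i] i assms(1) that by simp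
  qed
  define p where "p = P m"
  define D where "D = {t. \<exists>N i. N > 0 \<and> i \<le> m * N \<and> t = real i / real (m * N)}"
  have agree: "f t = poly p (of_real t)" if "t \<in> D" for t
  proof -
    from that obtain N i where "N > 0" "i \<le> m * N" "t = real i / real (m * N)" by (auto simp: D_def)
    then show ?thesis using P(2)[of "m * N" i] PM[of N] assms(1) by (simp add: p_def)
  qed
  have "f t = poly p (of_real t)" if t: "t \<in> {0..1}" for t
  proof -
    \<comment> \<open>Rounding down to the grid with denominator \<open>m * Suc N\<close>; the error
      is at most the mesh.\<close>
    define s where "s N = real (nat \<lfloor>t * real (m * Suc N)\<rfloor>) / real (m * Suc N)" for N
    have sD: "s N \<in> D" for N
    proof -
      have "t * real (m * Suc N) \<le> real (m * Suc N)" using t by (intro mult_left_le_one_le) auto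
      then have "nat \<lfloor>t * real (m * Suc N)\<rfloor> \<le> m * Suc N" by linarith
      then show ?thesis unfolding D_def s_def by blast
    qed
    have D01: "D \<subseteq> {0..1}"
    proof
      fix x assume "x \<in> D"
      then obtain N i where "N > 0" "i \<le> m * N" "x = real i / real (m * N)" by (auto simp: D_def)
      moreover from this have "real i \<le> real (m * N)" by (simp only: of_nat_le_iff)
      ultimately show "x \<in> {0..1}" by (auto simp del: of_nat_mult simp: divide_le_eq_1)
    qed
    have lim: "s \<longlonglongrightarrow> t"
    proof (rule LIMSEQ_I)
      fix e :: real assume "e > 0"
      then obtain n0 where n0: "inverse (real (Suc n0)) < e" using reals_Archimedean by blast
      show "\<exists>no. \<forall>n\<ge>no. norm (s n - t) < e"
      proof (intro exI[of _ n0] allI impI)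
        fix n assume n: "n0 \<le> n"
        let ?M = "real (m * Suc n)"
        have "1 * Suc n \<le> m * Suc n" using assms(1) by (intro mult_right_mono) auto
        moreover have "Suc n0 \<le> 1 * Suc n" using n by simp
        ultimately have "Suc n0 \<le> m * Suc n" by (rule order.trans [rotated])
        then have M1: "?M \<ge> real (Suc n0)" by (simp only: of_nat_le_iff)
        then have M: "?M \<ge> real (Suc n0)" "?M > 0" by linarith+
        have "t * ?M \<ge> 0" using t by simp
        then have *: "\<bar>real (nat \<lfloor>t * ?M\<rfloor>) - t * ?M\<bar> \<le> 1" by linarith
        have "s n - t = (real (nat \<lfloor>t * ?M\<rfloor>) - t * ?M) / ?M"
          using M(2) unfolding s_def diff_divide_distrib by (simp del: of_nat_mult of_nat_Suc)
        then have "\<bar>s n - t\<bar> = \<bar>real (nat \<lfloor>t * ?M\<rfloor>) - t * ?M\<bar> / ?M"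
          using M(2) by (simp only: abs_divide abs_of_pos)
        then have "\<bar>s n - t\<bar> \<le> 1 / ?M"
          using M(2) * by (simp only: divide_right_mono less_imp_le)
        also have "\<dots> \<le> inverse (real (Suc n0))" using M by (simp add: divide_simps)
        finally show "norm (s n - t) < e" using n0 by simp
      qed
    qed
    have "(\<lambda>N. f (s N)) \<longlonglongrightarrow> f t"
      using sD D01 by (intro continuous_on_tendsto_compose[OF cont lim t] always_eventually) blast
    moreover have "(\<lambda>N. poly p (of_real (s N))) \<longlonglongrightarrow> poly p (of_real t)"
      by (intro tendsto_intros lim)
    ultimately show ?thesis using agree[OF sD] LIMSEQ_unique by simp
  qed
  then show ?thesis using P(1)[of m] assms(1) unfolding p_def by blast
qed

section \<open>Multivariate polynomials\<close>

lemma polynomial_of_degree_leI: "(\<And>x. Q x = poly_eval D a x) \<Longrightarrow> polynomial_of_degree_le D Q"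
  unfolding polynomial_of_degree_le_def by blast

lemma polynomial_of_degree_le_mono:
  fixes Q :: "real ^ 'n \<Rightarrow> complex"
  assumes "polynomial_of_degree_le D Q" "D \<le> E"
  shows "polynomial_of_degree_le E Q"
proof -
  obtain a where a: "\<And>x. Q x = poly_eval D a x"
    using assms(1) by (auto simp: polynomial_of_degree_le_def)
  show ?thesis
  proof (rule polynomial_of_degree_leI)
    fix x
    have "(\<Sum>\<alpha> | mi_degree \<alpha> \<le> D. a \<alpha> * complex_of_real (mi_power x \<alpha>)) =
        (\<Sum>\<alpha> | mi_degree \<alpha> \<le> E. (if mi_degree \<alpha> \<le> D then a \<alpha> else 0) * complex_of_real (mi_power x \<alpha>))"
      using assms(2) by (intro sum.mono_neutral_cong_left finite_mi_degree_le) auto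
    then show "Q x = poly_eval E (\<lambda>\<alpha>. if mi_degree \<alpha> \<le> D then a \<alpha> else 0) x"
      unfolding a poly_eval_def .
  qed
qed

lemma polynomial_of_degree_le_monomial:
  "polynomial_of_degree_le (mi_degree \<alpha>) (\<lambda>x. c * complex_of_real (mi_power x \<alpha>))"
proof (rule polynomial_of_degree_leI)
  fix x :: "real ^ 'a"
  have "(\<Sum>\<beta> | mi_degree \<beta> \<le> mi_degree \<alpha>. (if \<beta> = \<alpha> then c else 0) * complex_of_real (mi_power x \<beta>))
      = (\<Sum>\<beta>\<in>{\<alpha>}. (if \<beta> = \<alpha> then c else 0) * complex_of_real (mi_power x \<beta>))"
    by (intro sum.mono_neutral_right finite_mi_degree_le) auto
  then show "c * complex_of_real (mi_power x \<alpha>) =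
      poly_eval (mi_degree \<alpha>) (\<lambda>\<beta>. if \<beta> = \<alpha> then c else 0) x"
    by (simp add: poly_eval_def)
qed

lemma polynomial_of_degree_le_add:
  assumes "polynomial_of_degree_le D Q" "polynomial_of_degree_le D R"
  shows "polynomial_of_degree_le D (\<lambda>x. Q x + R x)"
proof -
  obtain a b where "\<And>x. Q x = poly_eval D a x" "\<And>x. R x = poly_eval D b x"
    using assms by (auto simp: polynomial_of_degree_le_def)
  then show ?thesis
    by (intro polynomial_of_degree_leI[of _ D "\<lambda>\<alpha>. a \<alpha> + b \<alpha>"])
      (simp add: poly_eval_def sum.distrib algebra_simps)
qed

lemma polynomial_of_degree_le_0: "polynomial_of_degree_le D (\<lambda>x. 0)"
  by (rule polynomial_of_degree_leI[of _ D "\<lambda>_. 0"]) (simp add: poly_eval_def)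

lemma polynomial_of_degree_le_sum:
  assumes "\<And>i. i \<in> I \<Longrightarrow> polynomial_of_degree_le D (Q i)"
  shows "polynomial_of_degree_le D (\<lambda>x. \<Sum>i\<in>I. Q i x)"
  using assms
  by (induction I rule: infinite_finite_induct)
    (auto intro: polynomial_of_degree_le_add polynomial_of_degree_le_0)

lemma mi_degree_add: "mi_degree (\<lambda>i. \<alpha> i + \<beta> i) = mi_degree \<alpha> + mi_degree \<beta>"
  by (simp add: mi_degree_def sum.distrib)

lemma mi_power_add: "mi_power x (\<lambda>i. \<alpha> i + \<beta> i) = mi_power x \<alpha> * mi_power x \<beta>"
  by (simp add: mi_power_def power_add prod.distrib)

lemma polynomial_of_degree_le_mult:
  assumes "polynomial_of_degree_le D Q" "polynomial_of_degree_le E R"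
  shows "polynomial_of_degree_le (D + E) (\<lambda>x. Q x * R x)"
proof -
  obtain a b where ab: "\<And>x. Q x = poly_eval D a x" "\<And>x. R x = poly_eval E b x"
    using assms by (auto simp: polynomial_of_degree_le_def)
  have "(\<lambda>x. Q x * R x) = (\<lambda>x. \<Sum>\<alpha> | mi_degree \<alpha> \<le> D. \<Sum>\<beta> | mi_degree \<beta> \<le> E.
      (a \<alpha> * b \<beta>) * complex_of_real (mi_power x (\<lambda>i. \<alpha> i + \<beta> i)))"
    by (simp add: ab poly_eval_def sum_product mi_power_add mult_ac)
  moreover have "polynomial_of_degree_le (D + E) \<dots>"
    by (intro polynomial_of_degree_le_sum polynomial_of_degree_le_mono[OF polynomial_of_degree_le_monomial])
      (auto simp: mi_degree_add)
  ultimately show ?thesis by simp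
qed

lemma polynomial_of_degree_le_const: "polynomial_of_degree_le D (\<lambda>x :: real ^ 'n. c)"
proof -
  have "polynomial_of_degree_le 0 (\<lambda>x :: real ^ 'n. c)"
    using polynomial_of_degree_le_monomial[of "\<lambda>_ :: 'n. 0" c] by (simp add: mi_degree_def mi_power_def)
  then show ?thesis by (rule polynomial_of_degree_le_mono) simp
qed

lemma polynomial_of_degree_le_coord:
  "polynomial_of_degree_le 1 (\<lambda>x :: real ^ 'n. complex_of_real (x $ i))"
proof -
  let ?e = "\<lambda>k :: 'n. if k = i then 1 else 0 :: nat"
  have "mi_power x ?e = x $ i" for x
  proof -
    have "mi_power x ?e = (\<Prod>k\<in>UNIV. if k = i then x $ i else 1)"
      unfolding mi_power_def by (intro prod.cong) auto
    then show ?thesis by simp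
  qed
  moreover have "mi_degree ?e = 1" by (simp add: mi_degree_def)
  ultimately show ?thesis using polynomial_of_degree_le_monomial[of ?e 1] by simp
qed

lemma polynomial_of_degree_le_power:
  assumes "polynomial_of_degree_le D Q"
  shows "polynomial_of_degree_le (n * D) (\<lambda>x. Q x ^ n)"
proof (induction n)
  case 0 then show ?case by (simp add: polynomial_of_degree_le_const)
next
  case (Suc n)
  from polynomial_of_degree_le_mult[OF assms Suc] show ?case by simp
qed

lemma polynomial_of_degree_le_prod:
  assumes "\<And>i. i \<in> I \<Longrightarrow> polynomial_of_degree_le (D i) (Q i)" "finite I"
  shows "polynomial_of_degree_le (\<Sum>i\<in>I. D i) (\<lambda>x. \<Prod>i\<in>I. Q i x)"
  using assms(2,1)
  by (induction I) (auto intro: polynomial_of_degree_le_mult polynomial_of_degree_le_const)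

text \<open>Serves to undo the rescaling of the ball. The degree does not rise, because every
  coordinate is replaced by a polynomial of degree at most 1.\<close>

lemma polynomial_of_degree_le_affine:
  fixes Q :: "real ^ 'n \<Rightarrow> complex"
  assumes "polynomial_of_degree_le D Q"
  shows "polynomial_of_degree_le D (\<lambda>x. Q (r *\<^sub>R (x - c)))"
proof -
  obtain a where a: "\<And>x. Q x = poly_eval D a x"
    using assms(1) by (auto simp: polynomial_of_degree_le_def)
  have lin: "polynomial_of_degree_le 1 (\<lambda>x :: real ^ 'n. complex_of_real r * complex_of_real (x $ i) + complex_of_real (- r * c $ i))" for i
    using polynomial_of_degree_le_mult[OF polynomial_of_degree_le_const[of 0 "complex_of_real r"] polynomial_of_degree_le_coord[of i]]
    by (intro polynomial_of_degree_le_add polynomial_of_degree_le_const) simp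
  have "polynomial_of_degree_le (mi_degree \<alpha>) (\<lambda>x. complex_of_real (mi_power (r *\<^sub>R (x - c)) \<alpha>))" for \<alpha>
  proof -
    have "(\<lambda>x. complex_of_real (mi_power (r *\<^sub>R (x - c)) \<alpha>)) =
       (\<lambda>x. \<Prod>i\<in>UNIV. (complex_of_real r * complex_of_real (x $ i) + complex_of_real (- r * c $ i)) ^ \<alpha> i)"
      by (simp add: mi_power_def algebra_simps)
    moreover have "polynomial_of_degree_le (\<Sum>i\<in>UNIV. \<alpha> i * 1)
       (\<lambda>x. \<Prod>i\<in>UNIV. (complex_of_real r * complex_of_real (x $ i) + complex_of_real (- r * c $ i)) ^ \<alpha> i)"
      by (rule polynomial_of_degree_le_prod[OF polynomial_of_degree_le_power[OF lin]]) simp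
    ultimately show ?thesis by (simp only: mi_degree_def mult_1_right)
  qed
  then have mono: "polynomial_of_degree_le (0 + mi_degree \<alpha>) (\<lambda>x. a \<alpha> * complex_of_real (mi_power (r *\<^sub>R (x - c)) \<alpha>))" for \<alpha>
    by (rule polynomial_of_degree_le_mult[OF polynomial_of_degree_le_const])
  have "polynomial_of_degree_le D (\<lambda>x. a \<alpha> * complex_of_real (mi_power (r *\<^sub>R (x - c)) \<alpha>))"
    if "mi_degree \<alpha> \<le> D" for \<alpha>
    using that by (intro polynomial_of_degree_le_mono[OF mono]) simp
  then show ?thesis unfolding a poly_eval_def by (intro polynomial_of_degree_le_sum) auto
qed

section \<open>Restriction to lines\<close>

lemma poly_eval_line:
  fixes x h :: "real ^ 'n"
  shows "\<exists>p. degree p \<le> D \<and> (\<forall>t. poly_eval D a (x + t *\<^sub>R h) = poly p (of_real t))"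
proof -
  define q where "q \<alpha> = (\<Prod>i\<in>UNIV. [:complex_of_real (x $ i), complex_of_real (h $ i):] ^ \<alpha> i)" for \<alpha> :: "'n \<Rightarrow> nat"
  have "degree (q \<alpha>) \<le> mi_degree \<alpha>" for \<alpha>
  proof -
    have "degree (q \<alpha>) \<le> sum (degree \<circ> (\<lambda>i. [:complex_of_real (x $ i), complex_of_real (h $ i):] ^ \<alpha> i)) UNIV"
      unfolding q_def by (rule degree_prod_sum_le) simp
    also have "\<dots> \<le> (\<Sum>i\<in>UNIV. \<alpha> i)"
      by (intro sum_mono) (auto intro!: order.trans[OF degree_power_le])
    finally show ?thesis by (simp add: mi_degree_def)
  qed
  then have "degree (\<Sum>\<alpha> | mi_degree \<alpha> \<le> D. smult (a \<alpha>) (q \<alpha>)) \<le> D"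
    by (intro degree_sum_le finite_mi_degree_le order.trans[OF degree_smult_le]) (auto intro: order.trans)
  moreover have "poly_eval D a (x + t *\<^sub>R h) = poly (\<Sum>\<alpha> | mi_degree \<alpha> \<le> D. smult (a \<alpha>) (q \<alpha>)) (of_real t)" for t
    by (simp add: poly_eval_def poly_sum q_def poly_prod mi_power_def mult_ac)
  ultimately show ?thesis by blast
qed

lemma fdiff_poly_eval_line:
  assumes "D < m"
  shows "fdiff m (\<lambda>j. poly_eval D a (x + real j *\<^sub>R h)) = 0"
proof -
  obtain p where p: "degree p \<le> D" "\<And>t. poly_eval D a (x + t *\<^sub>R h) = poly p (of_real t)"
    using poly_eval_line by blast
  have "degree p < m" using p(1) assms by simp
  from fdiff_poly[OF this] show ?thesis by (simp add: p(2))
qed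

text \<open>Along the ray through \<open>x\<close> the homogeneous parts become the coefficients of
  a polynomial in \<open>t\<close>, so a degree below \<open>m\<close> makes each part of degree
  \<open>m\<close> or more vanish at \<open>x\<close>. The truncated coefficients do not depend on
  \<open>x\<close>, so applying this at many points yields one and the same polynomial.\<close>

lemma poly_eval_truncate:
  fixes x :: "real ^ 'n" and m :: nat
  assumes p: "degree p < m" "\<And>t. t \<in> {0..1} \<Longrightarrow> poly_eval D a (t *\<^sub>R x) = poly p (of_real t)"
  shows "poly_eval D a x = poly_eval (m - 1) (\<lambda>\<alpha>. if mi_degree \<alpha> \<le> D then a \<alpha> else 0) x"
proof -
  have finS: "finite {\<alpha> :: 'n \<Rightarrow> nat. mi_degree \<alpha> \<le> D \<and> R \<alpha>}" for R
    by (rule finite_subset[OF _ finite_mi_degree_le[of D]]) auto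
  define b where "b \<alpha> = a \<alpha> * complex_of_real (mi_power x \<alpha>)" for \<alpha>
  define q where "q = (\<Sum>\<alpha> | mi_degree \<alpha> \<le> D. monom (b \<alpha>) (mi_degree \<alpha>))"
  have "mi_power (t *\<^sub>R x) \<alpha> = t ^ mi_degree \<alpha> * mi_power x \<alpha>" for t \<alpha>
    by (simp add: mi_power_def mi_degree_def power_mult_distrib prod.distrib power_sum)
  then have q: "poly_eval D a (t *\<^sub>R x) = poly q (of_real t)" for t
    by (simp add: poly_eval_def q_def poly_sum poly_monom b_def mult_ac)
  \<comment> \<open>The two polynomials agree at infinitely many points, namely on the whole unit
    interval.\<close>
  have "q = p"
  proof (rule ccontr)
    assume "q \<noteq> p"
    then have "finite {z. poly (q - p) z = 0}" by (intro poly_roots_finite) auto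
    moreover have "complex_of_real ` {0..1} \<subseteq> {z. poly (q - p) z = 0}"
      using p(2) q by auto
    ultimately have "finite (complex_of_real ` {0..1})" by (rule rev_finite_subset)
    then have "finite {0..1::real}" by (rule finite_imageD) (auto simp: inj_on_def)
    with infinite_Icc[of 0 "1 :: real"] show False by (rule notE) simp
  qed
  have coeff: "coeff q k = (\<Sum>\<alpha> | mi_degree \<alpha> \<le> D \<and> mi_degree \<alpha> = k. b \<alpha>)" for k
  proof -
    have "coeff q k = (\<Sum>\<alpha> | mi_degree \<alpha> \<le> D. if mi_degree \<alpha> = k then b \<alpha> else 0)"
      by (simp add: q_def coeff_sum)
    also have "\<dots> = (\<Sum>\<alpha> | mi_degree \<alpha> \<le> D \<and> mi_degree \<alpha> = k. b \<alpha>)"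
      by (intro sum.mono_neutral_cong_right finite_mi_degree_le) auto
    finally show ?thesis .
  qed
  have "(\<Sum>\<alpha> | mi_degree \<alpha> \<le> D \<and> m \<le> mi_degree \<alpha>. b \<alpha>)
      = (\<Sum>k\<in>{m..D}. \<Sum>\<alpha> | \<alpha> \<in> {\<alpha>. mi_degree \<alpha> \<le> D \<and> m \<le> mi_degree \<alpha>} \<and> mi_degree \<alpha> = k. b \<alpha>)"
    by (rule sum.group [symmetric]) (auto intro: finS)
  also have "\<dots> = (\<Sum>k\<in>{m..D}. coeff q k)"
    unfolding coeff by (intro sum.cong refl) auto
  also have "\<dots> = 0"
    using p(1) \<open>q = p\<close> by (intro sum.neutral) (auto intro: coeff_eq_0)
  finally have zero: "(\<Sum>\<alpha> | mi_degree \<alpha> \<le> D \<and> m \<le> mi_degree \<alpha>. b \<alpha>) = 0" .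
  have "poly_eval D a x = (\<Sum>\<alpha> | mi_degree \<alpha> \<le> D. b \<alpha>)"
    by (simp add: poly_eval_def b_def)
  also have "{\<alpha>. mi_degree \<alpha> \<le> D} = {\<alpha>. mi_degree \<alpha> \<le> D \<and> mi_degree \<alpha> < m} \<union> {\<alpha> :: 'n \<Rightarrow> nat. mi_degree \<alpha> \<le> D \<and> m \<le> mi_degree \<alpha>}"
    by auto
  also have "sum b \<dots> = (\<Sum>\<alpha> | mi_degree \<alpha> \<le> D \<and> mi_degree \<alpha> < m. b \<alpha>)"
    by (subst sum.union_disjoint) (auto intro: finS simp: zero)
  also have "\<dots> = (\<Sum>\<alpha> | mi_degree \<alpha> \<le> m - 1. (if mi_degree \<alpha> \<le> D then a \<alpha> else 0) * complex_of_real (mi_power x \<alpha>))"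
    using p(1) by (intro sum.mono_neutral_cong_left finite_mi_degree_le) (auto simp: b_def)
  finally show ?thesis by (simp add: poly_eval_def)
qed

section \<open>Frechet's theorem on a ball\<close>

text \<open>Parametrized by the target \<open>b\<close> rather than by the step, so that
  \<open>x\<close> and \<open>b\<close> range independently over a convex set.\<close>

definition node :: "real \<Rightarrow> 'a::real_vector \<Rightarrow> 'a \<Rightarrow> nat \<Rightarrow> 'a" where
  "node \<tau> x b j = x + (real j * \<tau>) *\<^sub>R (b - x)"

definition upd :: "real ^ 'n \<Rightarrow> 'n \<Rightarrow> real \<Rightarrow> real ^ 'n" where
  "upd x i t = (\<chi> k. if k = i then t else x $ k)"

lemma upd_nth [simp]: "upd x i t $ k = (if k = i then t else x $ k)"
  by (simp add: upd_def)

lemma upd_triv [simp]: "upd x i (x $ i) = x"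
  by (simp add: vec_eq_iff)

lemma upd_commute: "i \<noteq> k \<Longrightarrow> upd (upd x i s) k t = upd (upd x k t) i s"
  by (simp add: vec_eq_iff)

lemma polynomial_of_degree_le_poly_coord:
  "\<exists>E. polynomial_of_degree_le E (\<lambda>x :: real ^ 'n. poly p (complex_of_real (x $ i)))"
proof (intro exI)
  have "polynomial_of_degree_le (degree p) (\<lambda>x :: real ^ 'n. coeff p k * complex_of_real (x $ i) ^ k)"
    if "k \<le> degree p" for k
  proof (rule polynomial_of_degree_le_mono)
    show "polynomial_of_degree_le (0 + k * 1) (\<lambda>x :: real ^ 'n. coeff p k * complex_of_real (x $ i) ^ k)"
      by (rule polynomial_of_degree_le_mult[OF polynomial_of_degree_le_const
          polynomial_of_degree_le_power[OF polynomial_of_degree_le_coord]])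
  qed (use that in simp)
  then show "polynomial_of_degree_le (degree p) (\<lambda>x :: real ^ 'n. poly p (complex_of_real (x $ i)))"
    unfolding poly_altdef by (intro polynomial_of_degree_le_sum) auto
qed

text \<open>The Lagrange basis depends on the nodes alone, so one family \<open>L\<close> reproduces
  all polynomials of degree less than \<open>m\<close>. This uniformity lets coordinates be
  separated one at a time.\<close>

lemma poly_lagrange:
  fixes t :: "nat \<Rightarrow> complex"
  assumes "inj_on t {..<m}" "0 < m"
  shows "\<exists>L. \<forall>p. degree p < m \<longrightarrow> (\<forall>z. poly p z = (\<Sum>j<m. poly p (t j) * poly (L j) z))"
proof -
  have "\<exists>L. degree L < m \<and> (\<forall>i<m. poly L (t i) = (if i = j then 1 else 0))" for j
    using exists_interpolating_poly[OF assms, of "\<lambda>i. if i = j then 1 else 0"] .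
  then obtain L where L: "\<And>j. degree (L j) < m"
      "\<And>i j. i < m \<Longrightarrow> poly (L j) (t i) = (if i = j then 1 else 0)"
    by metis
  have "poly p z = (\<Sum>j<m. poly p (t j) * poly (L j) z)" if "degree p < m" for p z
  proof -
    define q where "q = (\<Sum>j<m. smult (poly p (t j)) (L j))"
    have card: "card (t ` {..<m}) = m" using assms(1) by (simp add: card_image)
    have "degree (smult (poly p (t j)) (L j)) \<le> m - 1" for j
      using L(1)[of j] degree_smult_le[of "poly p (t j)" "L j"] by linarith
    then have "degree q \<le> m - 1"
      unfolding q_def by (intro degree_sum_le) auto
    then have "degree q < m" using assms(2) by linarith
    moreover have "poly p x = poly q x" if "x \<in> t ` {..<m}" for x
    proof -
      from that obtain k where k: "k < m" "x = t k" by auto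
      have "(\<Sum>j<m. poly p (t j) * poly (L j) (t k)) = (\<Sum>j<m. if j = k then poly p (t k) else 0)"
        using k L(2) by (intro sum.cong) auto
      then show ?thesis using k by (simp add: q_def poly_sum)
    qed
    ultimately have "p = q"
      using that card by (intro poly_eqI_degree[of "t ` {..<m}"]) auto
    then have "poly p z = poly q z" by simp
    also have "\<dots> = (\<Sum>j<m. poly p (t j) * poly (L j) z)" by (simp add: q_def poly_sum)
    finally show ?thesis .
  qed
  then show ?thesis by blast
qed

text \<open>Induction on the set \<open>I\<close> of coordinates on which \<open>h\<close> may
  depend. The reproducing formula in one coordinate expresses \<open>h\<close> through its
  restrictions with that coordinate frozen at the nodes, and these depend on fewer coordinates. The
  resulting degree \<open>E\<close> is not controlled; it has to be corrected along rays.\<close>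

lemma separately_polynomial:
  fixes h :: "real ^ 'n \<Rightarrow> complex" and L :: "nat \<Rightarrow> complex poly" and \<tau>s :: "nat \<Rightarrow> real" and \<sigma> :: real
  defines "Q \<equiv> {x :: real ^ 'n. \<forall>i. \<bar>x $ i\<bar> \<le> \<sigma>}"
  assumes "finite I" "0 \<le> \<sigma>" and nodes: "\<And>j. j < m \<Longrightarrow> \<bar>\<tau>s j\<bar> \<le> \<sigma>"
    and "\<And>x i t. x \<in> Q \<Longrightarrow> i \<in> I \<Longrightarrow> \<bar>t\<bar> \<le> \<sigma> \<Longrightarrow>
        h (upd x i t) = (\<Sum>j<m. h (upd x i (\<tau>s j)) * poly (L j) (of_real t))"
    and "\<And>x y. x \<in> Q \<Longrightarrow> y \<in> Q \<Longrightarrow> (\<And>i. i \<in> I \<Longrightarrow> x $ i = y $ i) \<Longrightarrow> h x = h y"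
  shows "\<exists>E R. polynomial_of_degree_le E R \<and> (\<forall>x\<in>Q. h x = R x)"
  using assms(2,5,6)
proof (induction I arbitrary: h)
  case empty
  have "0 \<in> Q" using \<open>0 \<le> \<sigma>\<close> by (simp add: Q_def)
  then have "\<forall>x\<in>Q. h x = h 0" using empty(2) by blast
  then show ?case using polynomial_of_degree_le_const by blast
next
  case (insert i I h)
  have updQ: "upd x i t \<in> Q" if "x \<in> Q" "\<bar>t\<bar> \<le> \<sigma>" for x i t
    using that by (auto simp: Q_def)
  have "\<exists>E R. polynomial_of_degree_le E R \<and> (\<forall>x\<in>Q. h (upd x i (\<tau>s j)) = R x)" if j: "j < m" for j
  proof (rule insert.IH)
    fix x k t assume x: "x \<in> Q" "k \<in> I" "\<bar>t\<bar> \<le> \<sigma>"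
    then have "k \<noteq> i" using insert.hyps by auto
    then show "h (upd (upd x k t) i (\<tau>s j)) = (\<Sum>l<m. h (upd (upd x k (\<tau>s l)) i (\<tau>s j)) * poly (L l) (of_real t))"
      using insert.prems(1)[of "upd x i (\<tau>s j)" k t] x updQ nodes[OF j]
      by (simp add: upd_commute[of k i])
  next
    fix x y assume "x \<in> Q" "y \<in> Q" "\<And>k. k \<in> I \<Longrightarrow> x $ k = y $ k"
    then show "h (upd x i (\<tau>s j)) = h (upd y i (\<tau>s j))"
      using updQ nodes[OF j] by (intro insert.prems(2)) auto
  qed
  then have "\<forall>j. \<exists>p. j < m \<longrightarrow> polynomial_of_degree_le (fst p) (snd p) \<and> (\<forall>x\<in>Q. h (upd x i (\<tau>s j)) = snd p x)"
    by simp
  from choice[OF this] obtain p where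
    p: "\<And>j. j < m \<Longrightarrow> polynomial_of_degree_le (fst (p j)) (snd (p j)) \<and> (\<forall>x\<in>Q. h (upd x i (\<tau>s j)) = snd (p j) x)"
    by blast
  define E R where "E j = fst (p j)" and "R j = snd (p j)" for j
  have ER: "\<And>j. j < m \<Longrightarrow> polynomial_of_degree_le (E j) (R j)"
      "\<And>j x. j < m \<Longrightarrow> x \<in> Q \<Longrightarrow> h (upd x i (\<tau>s j)) = R j x"
    using p unfolding E_def R_def by blast+
  have "\<forall>j. \<exists>F. polynomial_of_degree_le F (\<lambda>x :: real ^ 'n. poly (L j) (complex_of_real (x $ i)))"
    using polynomial_of_degree_le_poly_coord by blast
  from choice[OF this] obtain F where
    F: "\<And>j. polynomial_of_degree_le (F j) (\<lambda>x :: real ^ 'n. poly (L j) (complex_of_real (x $ i)))" by blast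
  have "polynomial_of_degree_le (\<Sum>j<m. E j + F j) (\<lambda>x. \<Sum>j<m. R j x * poly (L j) (complex_of_real (x $ i)))"
  proof (rule polynomial_of_degree_le_sum)
    fix j assume j: "j \<in> {..<m}"
    then have le: "E j + F j \<le> (\<Sum>j<m. E j + F j)" by (intro member_le_sum) auto
    from j have "j < m" by simp
    then show "polynomial_of_degree_le (\<Sum>j<m. E j + F j) (\<lambda>x. R j x * poly (L j) (complex_of_real (x $ i)))"
      by (rule polynomial_of_degree_le_mono[OF polynomial_of_degree_le_mult[OF ER(1) F] le])
  qed
  moreover have "h x = (\<Sum>j<m. R j x * poly (L j) (complex_of_real (x $ i)))" if "x \<in> Q" for x
    using insert.prems(1)[of x i "x $ i"] that ER(2) by (simp add: Q_def)
  ultimately show ?case by blast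
qed

lemma norm_node_le:
  fixes x b :: "'a :: real_normed_vector"
  assumes "0 \<le> \<tau>" "real j * \<tau> \<le> 1" "norm x < 1" "norm b < 1"
  shows "norm (node \<tau> x b j) < 1"
proof -
  have "node \<tau> x b j = (1 - real j * \<tau>) *\<^sub>R x + (real j * \<tau>) *\<^sub>R b"
    by (simp add: node_def algebra_simps)
  then show ?thesis
    using convexD_alt[OF convex_ball[of 0 1], of x b "real j * \<tau>"] assms by simp
qed

text \<open>The hypothesis fixes the ratio \<open>\<tau>\<close>, whereas the one-variable theorem
  asks for all steps. In a small cube at the origin this is no restriction, because the target
  \<open>b\<close> may lie far outside the cube. The identity found there is then carried outwards
  by the difference equation itself.\<close>

lemma frechet_polynomial:
  fixes g :: "real ^ 'n \<Rightarrow> complex"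
  assumes m: "0 < m" and \<tau>: "0 < \<tau>" "real m * \<tau> \<le> 1 / 2"
    and cont: "continuous_on (ball 0 1) g"
    and fd: "\<And>x b. x \<in> ball 0 1 \<Longrightarrow> b \<in> ball 0 1 \<Longrightarrow> fdiff m (\<lambda>j. g (node \<tau> x b j)) = 0"
  shows "\<exists>Q. polynomial_of_degree_le (m - 1) Q \<and> (\<forall>x\<in>ball 0 1. g x = Q x)"
proof -
  define N where "N = real CARD('n)"
  have N: "N \<ge> 1" unfolding N_def by (simp add: Suc_leI)
  \<comment> \<open>Places the cube in the ball of radius \<open>\<tau> / 4\<close>: a difference of
    two of its points, stretched by at most \<open>1 / \<tau>\<close>, has length at most 1/2, which
    leaves the target inside the unit ball.\<close>
  define \<sigma> where "\<sigma> = \<tau> / (4 * N)"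
  define C where "C = {x :: real ^ 'n. \<forall>i. \<bar>x $ i\<bar> \<le> \<sigma>}"
  have \<sigma>: "0 < \<sigma>" "N * \<sigma> = \<tau> / 4" using N \<tau> by (auto simp: \<sigma>_def)
  have "1 * \<tau> \<le> real m * \<tau>" using m \<tau>(1) by (intro mult_right_mono) auto
  then have \<tau>12: "\<tau> \<le> 1 / 2" using \<tau>(2) by linarith
  have normC: "norm x \<le> \<tau> / 4" if "x \<in> C" for x
  proof -
    have "norm x \<le> (\<Sum>i\<in>UNIV. \<bar>x $ i\<bar>)" by (rule norm_le_l1_cart)
    also have "\<dots> \<le> (\<Sum>i\<in>(UNIV :: 'n set). \<sigma>)" using that by (intro sum_mono) (auto simp: C_def)
    finally show ?thesis using \<sigma> by (simp add: N_def)
  qed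
  have convC: "x + t *\<^sub>R (y - x) \<in> C" if "x \<in> C" "y \<in> C" "0 \<le> t" "t \<le> 1" for x y t
  proof -
    have "\<bar>x $ i + t * (y $ i - x $ i)\<bar> \<le> \<sigma>" for i
    proof -
      have "\<bar>x $ i + t * (y $ i - x $ i)\<bar> = \<bar>(1 - t) * x $ i + t * y $ i\<bar>" by (simp add: algebra_simps)
      also have "\<dots> \<le> (1 - t) * \<bar>x $ i\<bar> + t * \<bar>y $ i\<bar>"
        using that by (intro order.trans[OF abs_triangle_ineq]) (auto simp: abs_mult)
      also have "\<dots> \<le> (1 - t) * \<sigma> + t * \<sigma>"
        using that by (intro add_mono mult_left_mono) (auto simp: C_def)
      finally show ?thesis by (simp add: algebra_simps)
    qed
    then show ?thesis by (simp add: C_def)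
  qed
  have line: "\<exists>p. degree p < m \<and> (\<forall>t\<in>{0..1}. g (x + t *\<^sub>R (y - x)) = poly p (of_real t))"
    if xy: "x \<in> C" "y \<in> C" for x y
  proof (rule continuous_imp_poly[OF m])
    have "(\<lambda>t. x + t *\<^sub>R (y - x)) ` {0..1} \<subseteq> ball 0 1"
      using convC[OF xy] normC \<tau>12 by fastforce
    then show "continuous_on {0..1} (\<lambda>t. g (x + t *\<^sub>R (y - x)))"
      by (intro continuous_on_compose2[OF cont] continuous_intros) auto
    fix t s :: real assume ts: "0 \<le> t" "0 \<le> s" "t + real m * s \<le> 1"
    have "1 * s \<le> real m * s" using m ts(2) by (intro mult_right_mono) auto
    with ts have s1: "t \<le> 1" "s \<le> 1" by linarith+
    define z where "z = x + t *\<^sub>R (y - x)"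
    \<comment> \<open>The target for which the fixed ratio \<open>\<tau>\<close> produces the
      desired step \<open>s *\<^sub>R (y - x)\<close>.\<close>
    define b where "b = z + (s / \<tau>) *\<^sub>R (y - x)"
    have z: "norm z \<le> \<tau> / 4" unfolding z_def by (intro normC convC xy ts s1)
    have "norm (y - x) \<le> \<tau> / 2" using normC[OF xy(1)] normC[OF xy(2)] norm_triangle_ineq4[of y x] by linarith
    then have "norm ((s / \<tau>) *\<^sub>R (y - x)) \<le> (1 / \<tau>) * (\<tau> / 2)"
      unfolding norm_scaleR using ts s1 \<tau>(1) by (intro mult_mono) (auto simp: divide_simps)
    also have "(1 / \<tau>) * (\<tau> / 2) = 1 / 2" using \<tau>(1) by simp
    finally have "norm b < 1"
      using z \<tau>12 norm_triangle_ineq[of z "(s / \<tau>) *\<^sub>R (y - x)"] unfolding b_def by linarith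
    moreover have "node \<tau> z b j = x + (t + real j * s) *\<^sub>R (y - x)" for j
      using \<tau>(1) by (simp add: node_def b_def z_def algebra_simps)
    ultimately show "fdiff m (\<lambda>j. g (x + (t + real j * s) *\<^sub>R (y - x))) = 0"
      using fd[of z b] z \<tau>12 by simp
  qed
  define ts where "ts j = \<sigma> * real j / real m" for j
  have ts: "\<bar>ts j\<bar> \<le> \<sigma>" if "j < m" for j
  proof -
    have "\<sigma> * real j \<le> \<sigma> * real m" using that \<sigma> by (intro mult_left_mono) auto
    then show ?thesis using \<sigma> m by (simp add: ts_def divide_simps)
  qed
  have "inj_on (\<lambda>j. complex_of_real (ts j)) {..<m}"
    using m \<sigma> by (auto simp: inj_on_def ts_def)
  from poly_lagrange[OF this m] obtain L where
    L: "\<And>p z. degree p < m \<Longrightarrow> poly p z = (\<Sum>j<m. poly p (complex_of_real (ts j)) * poly (L j) z)"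
    by blast
  have sep: "g (upd x i t) = (\<Sum>j<m. g (upd x i (ts j)) * poly (L j) (of_real t))"
    if x: "x \<in> C" and t: "\<bar>t\<bar> \<le> \<sigma>" for x i t
  proof -
    have C2: "upd x i (-\<sigma>) \<in> C" "upd x i \<sigma> \<in> C" using x \<sigma> by (auto simp: C_def)
    obtain p where p: "degree p < m"
      "\<And>t. t \<in> {0..1} \<Longrightarrow> g (upd x i (-\<sigma>) + t *\<^sub>R (upd x i \<sigma> - upd x i (-\<sigma>))) = poly p (of_real t)"
      using line[OF C2] by blast
    \<comment> \<open>Reparametrization from the unit interval to the coordinate value, which runs
      from \<open>-\<sigma>\<close> to \<open>\<sigma>\<close>.\<close>
    define q where "q = pcompose p [:1 / 2, of_real (1 / (2 * \<sigma>)):]"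
    have dq: "degree q < m" unfolding q_def using p(1) by (rule degree_pcompose_linear_less)
    have gq: "g (upd x i s) = poly q (of_real s)" if "\<bar>s\<bar> \<le> \<sigma>" for s
    proof -
      define u where "u = 1 / 2 + s * (1 / (2 * \<sigma>))"
      have u: "u = (\<sigma> + s) / (2 * \<sigma>)" using \<sigma> by (simp add: u_def field_simps)
      have u01: "u \<in> {0..1}" using that \<sigma> unfolding u by (auto simp: divide_simps)
      have "upd x i (-\<sigma>) + u *\<^sub>R (upd x i \<sigma> - upd x i (-\<sigma>)) = upd x i s"
        using \<sigma> by (auto simp: vec_eq_iff u field_simps)
      moreover have "poly p (of_real u) = poly q (of_real s)"
        by (simp add: q_def poly_pcompose u_def)
      ultimately show ?thesis using p(2)[OF u01] by simp
    qed
    have "g (upd x i t) = poly q (complex_of_real t)" by (rule gq[OF t])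
    also have "\<dots> = (\<Sum>j<m. poly q (complex_of_real (ts j)) * poly (L j) (complex_of_real t))"
      by (rule L[OF dq])
    also have "\<dots> = (\<Sum>j<m. g (upd x i (ts j)) * poly (L j) (complex_of_real t))"
      by (intro sum.cong refl) (simp add: gq ts)
    finally show ?thesis .
  qed
  have "\<exists>E R. polynomial_of_degree_le E R \<and> (\<forall>x\<in>{x :: real ^ 'n. \<forall>i. \<bar>x $ i\<bar> \<le> \<sigma>}. g x = R x)"
  proof (rule separately_polynomial[where I = UNIV and \<tau>s = ts and m = m and L = L])
    fix x y :: "real ^ 'n" assume "\<And>i. i \<in> UNIV \<Longrightarrow> x $ i = y $ i"
    then have "x = y" by (simp add: vec_eq_iff)
    then show "g x = g y" by simp
  next
    fix x :: "real ^ 'n" and i t assume "x \<in> {x. \<forall>i. \<bar>x $ i\<bar> \<le> \<sigma>}" "\<bar>t\<bar> \<le> \<sigma>"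
    then show "g (upd x i t) = (\<Sum>j<m. g (upd x i (ts j)) * poly (L j) (complex_of_real t))"
      by (intro sep) (auto simp: C_def)
  qed (use \<sigma> ts in auto)
  then have "\<exists>E R. polynomial_of_degree_le E R \<and> (\<forall>x\<in>C. g x = R x)" by (simp only: C_def)
  then obtain E R where "polynomial_of_degree_le E R" and gR: "\<And>x. x \<in> C \<Longrightarrow> g x = R x" by blast
  then obtain a where R: "\<And>x. R x = poly_eval E a x" by (auto simp: polynomial_of_degree_le_def)
  \<comment> \<open>Separate polynomiality gives too large a degree \<open>E\<close>. Since
    \<open>g\<close> has degree less than \<open>m\<close> on every ray inside the cube, the higher
    terms may be dropped there.\<close>
  define Q where "Q = poly_eval (m - 1) (\<lambda>\<alpha> :: 'n \<Rightarrow> nat. if mi_degree \<alpha> \<le> E then a \<alpha> else 0)"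
  have QC: "g x = Q x" if x: "x \<in> C" for x
  proof -
    have 0: "0 \<in> C" using \<sigma> by (simp add: C_def)
    obtain p where p: "degree p < m" "\<And>t. t \<in> {0..1} \<Longrightarrow> g (0 + t *\<^sub>R (x - 0)) = poly p (of_real t)"
      using line[OF 0 x] by blast
    have "poly_eval E a x = Q x"
      unfolding Q_def
    proof (rule poly_eval_truncate[OF p(1)])
      fix t :: real assume "t \<in> {0..1}"
      then show "poly_eval E a (t *\<^sub>R x) = poly p (of_real t)"
        using p(2)[of t] gR[of "t *\<^sub>R x"] convC[OF 0 x, of t] by (simp add: R)
    qed
    then show ?thesis using gR[OF x] by (simp add: R)
  qed
  define v where "v x = g x - Q x" for x
  \<comment> \<open>With target 0 the nodes after the first are contractions of \<open>x\<close> by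
    factors at most \<open>1 - \<tau>\<close>, so \<open>k\<close> applications of the difference
    equation lead into the cube, where \<open>v\<close> vanishes.\<close>
  have ext: "v x = 0" if "norm x < 1" "(1 - \<tau>) ^ k * norm x \<le> \<sigma>" for x k
    using that
  proof (induction k arbitrary: x)
    case 0
    then have "\<bar>x $ i\<bar> \<le> \<sigma>" for i using component_le_norm_cart[of x i] by simp
    then have "x \<in> C" by (simp add: C_def)
    then show ?case by (simp add: v_def QC)
  next
    case (Suc k)
    have eq: "node \<tau> x 0 j = (1 - real j * \<tau>) *\<^sub>R x" for j
      by (simp add: node_def algebra_simps)
    have "fdiff m (\<lambda>j. v (node \<tau> x 0 j)) = fdiff m (\<lambda>j. g (node \<tau> x 0 j)) - fdiff m (\<lambda>j. Q (node \<tau> x 0 j))"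
      by (simp add: v_def fdiff_diff)
    also have "fdiff m (\<lambda>j. Q (node \<tau> x 0 j)) = 0"
      using fdiff_poly_eval_line[of "m - 1" m _ x "- \<tau> *\<^sub>R x"] m by (simp add: Q_def node_def)
    finally have 0: "fdiff m (\<lambda>j. v (node \<tau> x 0 j)) = 0" using fd[of x 0] Suc.prems by simp
    have "v (node \<tau> x 0 j) = 0" if j: "1 \<le> j" "j \<le> m" for j
    proof (rule Suc.IH)
      have "1 * \<tau> \<le> real j * \<tau>" "real j * \<tau> \<le> real m * \<tau>" using j \<tau>(1) by (intro mult_right_mono; simp)+
      then have jt: "\<tau> \<le> real j * \<tau>" "real j * \<tau> \<le> 1/2" using \<tau>(2) by linarith+
      then have le: "norm (node \<tau> x 0 j) \<le> (1 - \<tau>) * norm x" unfolding eq norm_scaleR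
        by (intro mult_right_mono) auto
      also have "\<dots> \<le> norm x" using \<tau>(1) \<tau>12 by (intro mult_left_le_one_le) auto
      finally show "norm (node \<tau> x 0 j) < 1" using Suc.prems by simp
      have "(1 - \<tau>) ^ k * norm (node \<tau> x 0 j) \<le> (1 - \<tau>) ^ k * ((1 - \<tau>) * norm x)"
        using le \<tau>12 by (intro mult_left_mono) auto
      then show "(1 - \<tau>) ^ k * norm (node \<tau> x 0 j) \<le> \<sigma>" using Suc.prems by (simp add: mult_ac)
    qed
    then have "norm (v (node \<tau> x 0 0)) \<le> 0"
      using norm_0_le_fdiff[of m "\<lambda>j. v (node \<tau> x 0 j)" 0] 0 by simp
    then show ?case by (simp add: node_def)
  qed
  obtain k where k: "(1 - \<tau>) ^ k < \<sigma>" using real_arch_pow_inv[of \<sigma> "1 - \<tau>"] \<sigma> \<tau> by auto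
  have "g x = Q x" if "x \<in> ball 0 1" for x
  proof -
    have "(1 - \<tau>) ^ k * norm x \<le> (1 - \<tau>) ^ k" using that \<tau>12 by (intro mult_left_le) auto
    then show ?thesis using ext[of x k] that k by (simp add: v_def)
  qed
  moreover have "polynomial_of_degree_le (m - 1) Q" unfolding Q_def by (rule polynomial_of_degree_leI) (rule refl)
  ultimately show ?thesis by blast
qed

section \<open>Measure estimates and almost everywhere defined differences\<close>

lemma emeasure_lborel_affine_vimage:
  fixes t :: "'a::euclidean_space"
  assumes "S \<in> sets borel" "c \<noteq> 0"
  shows "emeasure lborel ((\<lambda>x. t + c *\<^sub>R x) -` S) = ennreal (1 / \<bar>c\<bar> ^ DIM('a)) * emeasure lborel S"
proof -
  have [measurable]: "S \<in> sets borel" by fact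
  have vim: "(\<lambda>x. t + c *\<^sub>R x) -` S \<in> sets borel"
    using measurable_sets[of "\<lambda>x. t + c *\<^sub>R x" borel borel S] by simp
  have "emeasure lborel S = emeasure (density (distr lborel borel (\<lambda>x. t + c *\<^sub>R x)) (\<lambda>_. ennreal (\<bar>c\<bar> ^ DIM('a)))) S"
    by (subst lborel_affine[OF assms(2), of t]) (simp flip: ennreal_power)
  also have "\<dots> = ennreal (\<bar>c\<bar> ^ DIM('a)) * emeasure lborel ((\<lambda>x. t + c *\<^sub>R x) -` S)"
    by (simp add: emeasure_density nn_integral_cmult emeasure_distr)
  finally have "ennreal (1 / \<bar>c\<bar> ^ DIM('a)) * emeasure lborel S =
    ennreal (1 / \<bar>c\<bar> ^ DIM('a)) * ennreal (\<bar>c\<bar> ^ DIM('a)) * emeasure lborel ((\<lambda>x. t + c *\<^sub>R x) -` S)"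
    by (simp add: mult_ac)
  also have "ennreal (1 / \<bar>c\<bar> ^ DIM('a)) * ennreal (\<bar>c\<bar> ^ DIM('a)) = 1"
    using assms(2) by (simp flip: ennreal_mult'')
  finally show ?thesis by simp
qed

lemma integral_lborel_affine:
  fixes f :: "'a::euclidean_space \<Rightarrow> 'b::{banach, second_countable_topology}"
  assumes [measurable]: "f \<in> borel_measurable borel" and c: "c \<noteq> 0"
  shows "(\<integral>x. f x \<partial>lborel) = \<bar>c\<bar> ^ DIM('a) *\<^sub>R (\<integral>x. f (t + c *\<^sub>R x) \<partial>lborel)"
  by (subst lborel_affine[OF c, of t])
     (simp add: integral_density integral_distr)

lemma norm_integral_lborel_le_set:
  fixes f :: "'a::euclidean_space \<Rightarrow> complex"
  assumes [measurable]: "f \<in> borel_measurable borel" "A \<in> sets borel"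
    and "emeasure lborel A < \<infinity>" "\<And>x. x \<in> A \<Longrightarrow> norm (f x) \<le> B" "\<And>x. x \<notin> A \<Longrightarrow> f x = 0"
  shows "integrable lborel f" "norm (\<integral>x. f x \<partial>lborel) \<le> B * measure lborel A"
proof -
  show int: "integrable lborel f"
    by (rule integrableI_bounded_set[of A _ _ B]) (use assms in auto)
  have "norm (\<integral>x. f x \<partial>lborel) \<le> (\<integral>x. norm (f x) \<partial>lborel)" by (rule integral_norm_bound)
  also have "\<dots> \<le> (\<integral>x. B * indicator A x \<partial>lborel)"
  proof (rule integral_mono)
    show "integrable lborel (\<lambda>x. B * indicator A x)"
      by (intro integrable_mult_right integrable_real_indicator) (use assms in auto)
  qed (use int assms in \<open>auto simp: indicator_def\<close>)
  also have "\<dots> = B * measure lborel A" by simp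
  finally show "norm (\<integral>x. f x \<partial>lborel) \<le> B * measure lborel A" .
qed

text \<open>The bound \<open>s * s\<close> is shared evenly between the size of a slice and the
  measure of the points with larger slices. This is the origin of the square root in the final
  \<epsilon>.\<close>

lemma slice_markov:
  fixes N :: "('a::euclidean_space \<times> 'a) set"
  assumes [measurable]: "N \<in> sets borel" and "0 < s" "emeasure lborel N \<le> ennreal (s * s)"
  shows "{x. emeasure lborel (Pair x -` N) \<le> ennreal s} \<in> sets borel"
    and "emeasure lborel {x. \<not> emeasure lborel (Pair x -` N) \<le> ennreal s} \<le> ennreal s"
proof -
  have N: "N \<in> sets (lborel \<Otimes>\<^sub>M lborel)" by (metis lborel_prod sets_lborel assms(1))
  have [measurable]: "(\<lambda>x. emeasure lborel (Pair x -` N)) \<in> borel_measurable borel"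
    using lborel.measurable_emeasure_Pair[OF N] by simp
  show "{x. emeasure lborel (Pair x -` N) \<le> ennreal s} \<in> sets borel" by measurable
  have "emeasure lborel {x. \<not> emeasure lborel (Pair x -` N) \<le> ennreal s}
     \<le> emeasure lborel {x\<in>UNIV. 1 \<le> ennreal (1 / s) * emeasure lborel (Pair x -` N)}"
  proof (rule emeasure_mono)
    show "{x. \<not> emeasure lborel (Pair x -` N) \<le> ennreal s} \<subseteq> {x\<in>UNIV. 1 \<le> ennreal (1 / s) * emeasure lborel (Pair x -` N)}"
    proof clarsimp
      fix x assume "\<not> emeasure lborel (Pair x -` N) \<le> ennreal s"
      then have "ennreal (1 / s) * ennreal s \<le> ennreal (1 / s) * emeasure lborel (Pair x -` N)"
        by (intro mult_left_mono) auto
      moreover have "ennreal (1 / s) * ennreal s = 1" using \<open>0 < s\<close> by (simp flip: ennreal_mult'')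
      ultimately show "1 \<le> ennreal (1 / s) * emeasure lborel (Pair x -` N)" by simp
    qed
  qed measurable
  also have "\<dots> \<le> ennreal (1 / s) * (\<integral>\<^sup>+x. emeasure lborel (Pair x -` N) * indicator UNIV x \<partial>lborel)"
    by (rule nn_integral_Markov_inequality) auto
  also have "(\<integral>\<^sup>+x. emeasure lborel (Pair x -` N) * indicator UNIV x \<partial>lborel) = emeasure lborel N"
    using lborel.emeasure_pair_measure_alt[OF N] by (simp add: lborel_prod)
  also have "ennreal (1 / s) * emeasure lborel N \<le> ennreal (1 / s) * ennreal (s * s)"
    by (intro mult_left_mono assms) auto
  also have "\<dots> = ennreal s" using \<open>0 < s\<close> by (simp flip: ennreal_mult'')
  finally show "emeasure lborel {x. \<not> emeasure lborel (Pair x -` N) \<le> ennreal s} \<le> ennreal s" .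
qed

text \<open>At most a set of measure \<open>\<kappa> \<epsilon>\<close> of directions \<open>b\<close> leads from \<open>x\<close> into a given set of measure
  \<open>\<epsilon>\<close>; the threshold \<open>e0\<close> is small enough that some direction in \<open>U\<close> always avoids it.\<close>

locale differences =
  fixes m :: nat and \<tau> \<kappa> e0 :: real and U :: "'a::euclidean_space set"
  assumes m: "0 < m" and \<tau>: "0 < \<tau>" "real m * \<tau> \<le> 1 / 2"
    and U: "U = ball 0 1"
    and \<kappa>: "\<kappa> = 1 + real m * (1 / \<tau> ^ DIM('a))"
    and e0: "e0 = measure lborel U / (2 * \<kappa>)"
begin

lemma step_bounds:
  assumes "j \<le> m" shows "0 \<le> real j * \<tau>" "real j * \<tau> \<le> 1 / 2"
proof -
  have "real j * \<tau> \<le> real m * \<tau>" using assms \<tau> by (intro mult_right_mono) auto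
  then show "real j * \<tau> \<le> 1 / 2" using \<tau>(2) by linarith
  show "0 \<le> real j * \<tau>" using \<tau>(1) by simp
qed

lemma step_ge: "1 \<le> j \<Longrightarrow> \<tau> \<le> real j * \<tau>"
  using \<tau>(1) by simp

lemma kappa_ge: "1 \<le> \<kappa>"
  using \<tau>(1) by (simp add: \<kappa>)

lemma U_measurable [measurable]: "U \<in> sets borel"
  by (simp add: U)

lemma emeasure_U: "emeasure lborel U = ennreal (measure lborel U)"
  unfolding U by (intro emeasure_eq_ennreal_measure) (use emeasure_lborel_ball_finite[of 0 1] in \<open>auto simp: less_top\<close>)

lemma measure_U_pos: "0 < measure lborel U"
  unfolding U by (simp add: content_ball_pos)

lemma e0_pos: "0 < e0" and e0_less: "\<kappa> * e0 < measure lborel U"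
  using kappa_ge measure_U_pos by (auto simp: e0)

lemma node_in_U: "x \<in> U \<Longrightarrow> b \<in> U \<Longrightarrow> j \<le> m \<Longrightarrow> node \<tau> x b j \<in> U"
  using norm_node_le[of \<tau> j x b] step_bounds[of j] \<tau>(1) by (auto simp: U)

lemma node_eq: "node \<tau> x b j = (1 - real j * \<tau>) *\<^sub>R x + (real j * \<tau>) *\<^sub>R b"
  by (simp add: node_def algebra_simps)

text \<open>For fixed \<open>x\<close> the map from \<open>b\<close> to the j-th node scales by
  \<open>j * \<tau> \<ge> \<tau>\<close>, so preimages grow by at most
  \<open>1 / \<tau> ^ DIM('a)\<close>. Adding up over \<open>j\<close> and including
  \<open>T\<close> gives the factor \<open>\<kappa>\<close>.\<close>

lemma bad_directions:
  fixes S T :: "'a set" and x :: 'a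
  assumes [measurable]: "S \<in> sets borel" "T \<in> sets borel"
    and "emeasure lborel S \<le> ennreal \<epsilon>" "emeasure lborel T \<le> ennreal \<epsilon>" "0 \<le> \<epsilon>"
  shows "{b. b \<in> T \<or> (\<exists>j\<in>{1..m}. node \<tau> x b j \<in> S)} \<in> sets borel" (is "?B \<in> _")
    and "emeasure lborel {b. b \<in> T \<or> (\<exists>j\<in>{1..m}. node \<tau> x b j \<in> S)} \<le> ennreal (\<kappa> * \<epsilon>)"
proof -
  define V where "V j = (\<lambda>b. (1 - real j * \<tau>) *\<^sub>R x + (real j * \<tau>) *\<^sub>R b) -` S" for j
  have V: "V j \<in> sets borel" for j
    unfolding V_def using measurable_sets[of "\<lambda>b. (1 - real j * \<tau>) *\<^sub>R x + (real j * \<tau>) *\<^sub>R b" borel borel S] by simp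
  have B: "?B = T \<union> (\<Union>j\<in>{1..m}. V j)" by (auto simp: V_def node_eq)
  show "?B \<in> sets borel" unfolding B using V by auto
  have "emeasure lborel ?B \<le> emeasure lborel T + emeasure lborel (\<Union>j\<in>{1..m}. V j)"
    unfolding B using V by (intro emeasure_subadditive) auto
  also have "emeasure lborel (\<Union>j\<in>{1..m}. V j) \<le> (\<Sum>j\<in>{1..m}. emeasure lborel (V j))"
    using V by (intro emeasure_subadditive_finite) auto
  also have "\<dots> \<le> (\<Sum>j\<in>{1..m}. ennreal (1 / \<tau> ^ DIM('a) * \<epsilon>))"
  proof (rule sum_mono)
    fix j assume "j \<in> {1..m}"
    then have j: "\<tau> \<le> real j * \<tau>" "real j * \<tau> \<noteq> 0" using step_ge[of j] \<tau>(1) by auto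
    have "emeasure lborel (V j) = ennreal (1 / \<bar>real j * \<tau>\<bar> ^ DIM('a)) * emeasure lborel S"
      unfolding V_def by (rule emeasure_lborel_affine_vimage[OF assms(1) j(2)])
    also have "\<dots> \<le> ennreal (1 / \<tau> ^ DIM('a)) * ennreal \<epsilon>"
    proof (intro mult_mono ennreal_leI assms)
      have "\<tau> ^ DIM('a) \<le> \<bar>real j * \<tau>\<bar> ^ DIM('a)" using j \<tau>(1) by (intro power_mono) auto
      then show "1 / \<bar>real j * \<tau>\<bar> ^ DIM('a) \<le> 1 / \<tau> ^ DIM('a)"
        using \<tau>(1) by (intro divide_left_mono) (auto intro: order.strict_trans2[of 0 "\<tau> ^ DIM('a)"])
    qed auto
    also have "\<dots> = ennreal (1 / \<tau> ^ DIM('a) * \<epsilon>)"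
      using \<tau>(1) assms(5) by (subst ennreal_mult) auto
    finally show "emeasure lborel (V j) \<le> ennreal (1 / \<tau> ^ DIM('a) * \<epsilon>)" .
  qed
  also have "\<dots> = ennreal (real m * (1 / \<tau> ^ DIM('a) * \<epsilon>))"
    unfolding sum_constant card_atLeastAtMost ennreal_of_nat_eq_real_of_nat
    using \<tau>(1) assms(5) by (subst ennreal_mult) auto
  also have "emeasure lborel T + ennreal (real m * (1 / \<tau> ^ DIM('a) * \<epsilon>)) \<le> ennreal \<epsilon> + ennreal (real m * (1 / \<tau> ^ DIM('a) * \<epsilon>))"
    by (intro add_right_mono assms)
  also have "\<dots> = ennreal (\<kappa> * \<epsilon>)"
    using \<tau>(1) assms(5) by (subst ennreal_plus [symmetric]) (auto simp: \<kappa> algebra_simps)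
  finally show "emeasure lborel ?B \<le> ennreal (\<kappa> * \<epsilon>)"
    by (simp add: add_left_mono)
qed

text \<open>\<open>Y\<close> is general because the limit argument must find its direction inside a
  prescribed open set; the bootstrap takes all of \<open>U\<close>.\<close>

lemma pick_direction:
  fixes S T Y :: "'a set" and x :: 'a
  assumes "S \<in> sets borel" "T \<in> sets borel" "Y \<in> sets borel"
    and "emeasure lborel S \<le> ennreal \<epsilon>" "emeasure lborel T \<le> ennreal \<epsilon>" "0 \<le> \<epsilon>"
    and "ennreal (\<kappa> * \<epsilon>) < emeasure lborel Y"
  obtains b where "b \<in> Y" "b \<notin> T" "\<And>j. 1 \<le> j \<Longrightarrow> j \<le> m \<Longrightarrow> node \<tau> x b j \<notin> S"
proof -
  let ?B = "{b. b \<in> T \<or> (\<exists>j\<in>{1..m}. node \<tau> x b j \<in> S)}"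
  have "\<not> Y \<subseteq> ?B"
  proof
    assume "Y \<subseteq> ?B"
    then have "emeasure lborel Y \<le> emeasure lborel ?B"
      using bad_directions(1)[OF assms(1,2,4-6)] by (intro emeasure_mono) auto
    also have "\<dots> \<le> ennreal (\<kappa> * \<epsilon>)" by (rule bad_directions(2)[OF assms(1,2,4-6)])
    finally show False using assms(7) by simp
  qed
  then obtain b where "b \<in> Y" "b \<notin> ?B" by blast
  then show ?thesis by (intro that[of b]) auto
qed

lemma pick_direction_U:
  fixes S T :: "'a set" and x :: 'a
  assumes "S \<in> sets borel" "T \<in> sets borel"
    and "emeasure lborel S \<le> ennreal e0" "emeasure lborel T \<le> ennreal e0"
  obtains b where "b \<in> U" "b \<notin> T" "\<And>j. 1 \<le> j \<Longrightarrow> j \<le> m \<Longrightarrow> node \<tau> x b j \<notin> S"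
proof -
  have "ennreal (\<kappa> * e0) < emeasure lborel U"
    unfolding emeasure_U using e0_less e0_pos kappa_ge measure_U_pos by (intro ennreal_lessI) auto
  from pick_direction[OF assms(1,2) U_measurable assms(3,4) less_imp_le[OF e0_pos] this] that
  show ?thesis by blast
qed

text \<open>A bound for \<open>u\<close> off a fixed small set improves to a bound at every \<open>x\<close> for which most
  directions are good, because one such direction meets the small set at none of its nodes.\<close>

lemma bootstrap:
  assumes "S \<in> sets borel" "T \<in> sets borel"
    and "emeasure lborel S \<le> ennreal e0" "emeasure lborel T \<le> ennreal e0"
    and "x \<in> U" "0 \<le> \<rho>"
    and "\<And>b. b \<in> U \<Longrightarrow> b \<notin> T \<Longrightarrow> norm (fdiff m (\<lambda>j. u (node \<tau> x b j))) \<le> A"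
    and "\<And>y. y \<in> U \<Longrightarrow> y \<notin> S \<Longrightarrow> norm (u y) \<le> \<rho>"
  shows "norm (u x) \<le> A + 2 ^ m * \<rho>"
proof -
  obtain b where b: "b \<in> U" "b \<notin> T" "\<And>j. 1 \<le> j \<Longrightarrow> j \<le> m \<Longrightarrow> node \<tau> x b j \<notin> S"
    using pick_direction_U[OF assms(1-4)] by blast
  have "norm (u (node \<tau> x b 0)) \<le> norm (fdiff m (\<lambda>j. u (node \<tau> x b j))) + 2 ^ m * \<rho>"
    using b assms by (intro norm_0_le_fdiff) (auto intro: node_in_U)
  moreover have "node \<tau> x b 0 = x" by (simp add: node_def)
  ultimately show ?thesis using assms(7)[OF b(1,2)] by simp
qed

section \<open>Distance to the solutions of the difference equation\<close>

definition null :: "('a \<Rightarrow> complex) \<Rightarrow> bool" where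
  "null g \<longleftrightarrow> continuous_on U g \<and> (\<forall>x\<in>U. \<forall>b\<in>U. fdiff m (\<lambda>j. g (node \<tau> x b j)) = 0)"

lemma null_0: "null (\<lambda>_. 0)"
  by (simp add: null_def fdiff_def)

lemma null_add: "null f \<Longrightarrow> null g \<Longrightarrow> null (\<lambda>x. f x + g x)"
  by (auto simp: null_def fdiff_add intro: continuous_on_add)

lemma null_cmult: "null g \<Longrightarrow> null (\<lambda>x. c * g x)"
  by (auto simp: null_def fdiff_cmult intro: continuous_intros)

text \<open>The exceptional measure is a fixed number rather than one tending to 0: at
  \<open>e0\<close> the bootstrap already recovers a bound at every point with few bad
  directions.\<close>

definition approximable :: "('a \<Rightarrow> complex) \<Rightarrow> real \<Rightarrow> bool" where
  "approximable u \<rho> \<longleftrightarrow> (\<exists>g. null g \<and> (\<exists>S\<in>sets borel. emeasure lborel S \<le> ennreal e0 \<and>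
     (\<forall>x\<in>U - S. norm (u x - g x) \<le> \<rho>)))"

lemma approximable_mono: "approximable u \<rho> \<Longrightarrow> \<rho> \<le> \<mu> \<Longrightarrow> approximable u \<mu>"
  unfolding approximable_def by (meson order.trans)

text \<open>A measurable function on a set of finite measure is bounded off a set of arbitrarily
  small measure, so even the zero function serves as approximant. Hence no a priori bound is needed
  before normalizing.\<close>

lemma ex_approximable:
  assumes [measurable]: "u \<in> borel_measurable borel"
  shows "\<exists>\<rho>. approximable u \<rho>"
proof -
  define S where "S n = {x \<in> U. real n < norm (u x)}" for n :: nat
  have S: "S n \<in> sets lborel" for n unfolding S_def by measurable
  have "(\<lambda>n. emeasure lborel (S n)) \<longlonglongrightarrow> emeasure lborel (\<Inter>n. S n)"
  proof (rule Lim_emeasure_decseq)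
    show "range S \<subseteq> sets lborel" using S by auto
    show "decseq S" by (auto simp: decseq_def S_def)
    fix n
    have "emeasure lborel (S n) \<le> emeasure lborel U" by (intro emeasure_mono) (auto simp: S_def)
    then show "emeasure lborel (S n) \<noteq> \<infinity>" unfolding emeasure_U by (auto simp: top_unique)
  qed
  moreover have "(\<Inter>n. S n) = {}"
  proof -
    have "\<exists>n. x \<notin> S n" for x
      using real_arch_simple[of "norm (u x)"] by (auto simp: S_def not_less)
    then show ?thesis by blast
  qed
  ultimately have "(\<lambda>n. emeasure lborel (S n)) \<longlonglongrightarrow> 0" by simp
  then have "\<forall>\<^sub>F n in sequentially. emeasure lborel (S n) < ennreal e0"
    by (rule order_tendstoD) (simp add: e0_pos)
  then obtain n where n: "emeasure lborel (S n) < ennreal e0"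
    by (auto simp: eventually_sequentially)
  have "approximable u (real n)"
    unfolding approximable_def
    by (intro exI[of _ "\<lambda>_. 0"] conjI null_0 bexI[of _ "S n"]) (use n S in \<open>auto simp: S_def\<close>)
  then show ?thesis ..
qed

text \<open>An optimal \<rho> need not exist, so \<rho> is taken approximable with \<rho>/2 not
  approximable. Subtracting an approximant leaves the differences unchanged, and dividing by \<rho>
  makes the size 1 and the differences at most \<open>A / \<rho> \<le> 1 / k\<close>.\<close>

lemma normalization_step:
  assumes [measurable]: "u \<in> borel_measurable borel" and "0 < A" "0 < k"
    and fd: "\<And>x b. x \<in> U \<Longrightarrow> b \<in> U \<Longrightarrow> (x, b) \<notin> N \<Longrightarrow> norm (fdiff m (\<lambda>j. u (node \<tau> x b j))) \<le> A"
    and na: "\<not> approximable u (k * A)"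
  shows "\<exists>v S. v \<in> borel_measurable borel \<and> S \<in> sets borel \<and> emeasure lborel S \<le> ennreal e0 \<and>
    (\<forall>x\<in>U - S. norm (v x) \<le> 1) \<and> (\<forall>x. x \<notin> U \<longrightarrow> v x = 0) \<and>
    (\<forall>x\<in>U. \<forall>b\<in>U. (x, b) \<notin> N \<longrightarrow> norm (fdiff m (\<lambda>j. v (node \<tau> x b j))) \<le> 1 / k) \<and>
    \<not> approximable v (1 / 2)"
proof -
  \<comment> \<open>If every admissible \<rho> could be halved, repeated halving would end below
    \<open>k * A\<close>.\<close>
  have "\<exists>\<rho>. approximable u \<rho> \<and> \<not> approximable u (\<rho> / 2)"
  proof (rule ccontr)
    assume *: "\<not> (\<exists>\<rho>. approximable u \<rho> \<and> \<not> approximable u (\<rho> / 2))"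
    obtain \<rho> where \<rho>: "approximable u \<rho>" using ex_approximable[OF assms(1)] ..
    have ap: "approximable u (\<rho> * (1 / 2) ^ n)" for n
    proof (induction n)
      case (Suc n)
      then have "approximable u (\<rho> * (1 / 2) ^ n / 2)" using * by blast
      then show ?case by (simp add: mult_ac)
    qed (use \<rho> in simp)
    have "(\<lambda>n. \<rho> * (1 / 2) ^ n) \<longlonglongrightarrow> \<rho> * 0"
      by (intro tendsto_intros LIMSEQ_power_zero) auto
    then have "\<forall>\<^sub>F n in sequentially. \<rho> * (1 / 2) ^ n < k * A"
      by (rule order_tendstoD) (use assms in simp)
    then obtain n where "\<rho> * (1 / 2) ^ n < k * A" by (auto simp: eventually_sequentially)
    then show False using ap[of n] na approximable_mono less_imp_le by blast
  qed
  then obtain \<rho> where \<rho>: "approximable u \<rho>" "\<not> approximable u (\<rho> / 2)" by blast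
  have "k * A < \<rho>" using \<rho>(1) na approximable_mono[of u \<rho> "k * A"] by force
  moreover have "0 < k * A" using assms by simp
  ultimately have "0 < \<rho>" "k * A \<le> \<rho>" by linarith+
  then have \<rho>0: "0 < \<rho>" "A / \<rho> \<le> 1 / k" using \<open>0 < k\<close> by (auto simp: field_simps)
  obtain g S where g: "null g" "S \<in> sets borel" "emeasure lborel S \<le> ennreal e0"
    "\<And>x. x \<in> U - S \<Longrightarrow> norm (u x - g x) \<le> \<rho>"
    using \<rho>(1) unfolding approximable_def by blast
  define v where "v x = (if x \<in> U then (u x - g x) / of_real \<rho> else 0)" for x
  \<comment> \<open>\<open>g\<close> is continuous on \<open>U\<close> only; cutting it off gives a
    Borel function on the whole space.\<close>
  have gm: "(\<lambda>x. if x \<in> U then g x else 0) \<in> borel_measurable borel"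
    using g(1) unfolding null_def by (intro borel_measurable_continuous_on_if) auto
  have "v = (\<lambda>x. if x \<in> U then (u x - (if x \<in> U then g x else 0)) / of_real \<rho> else 0)"
    by (auto simp: v_def)
  also have "\<dots> \<in> borel_measurable borel" using gm by measurable
  finally have 1: "v \<in> borel_measurable borel" .
  have 2: "norm (v x) \<le> 1" if "x \<in> U - S" for x
    using g(4)[OF that] \<rho>0 that by (simp add: v_def norm_divide)
  have 3: "norm (fdiff m (\<lambda>j. v (node \<tau> x b j))) \<le> 1 / k" if "x \<in> U" "b \<in> U" "(x, b) \<notin> N" for x b
  proof -
    have "fdiff m (\<lambda>j. v (node \<tau> x b j)) = fdiff m (\<lambda>j. (u (node \<tau> x b j) - g (node \<tau> x b j)) / of_real \<rho>)"
      using that by (intro fdiff_cong) (simp add: v_def node_in_U)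
    also have "\<dots> = fdiff m (\<lambda>j. u (node \<tau> x b j)) / of_real \<rho>"
      using g(1) that by (simp add: fdiff_divide fdiff_diff null_def)
    finally have "norm (fdiff m (\<lambda>j. v (node \<tau> x b j))) \<le> A / \<rho>"
      using fd[OF that] \<rho>0 by (simp add: norm_divide divide_right_mono)
    then show ?thesis using \<rho>0 by linarith
  qed
  have 4: "\<not> approximable v (1 / 2)"
  proof
    assume "approximable v (1 / 2)"
    then obtain g' S' where g': "null g'" "S' \<in> sets borel" "emeasure lborel S' \<le> ennreal e0"
      "\<And>x. x \<in> U - S' \<Longrightarrow> norm (v x - g' x) \<le> 1 / 2"
      unfolding approximable_def by blast
    have "norm (u x - (g x + of_real \<rho> * g' x)) \<le> \<rho> / 2" if "x \<in> U - S'" for x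
    proof -
      have "u x - (g x + of_real \<rho> * g' x) = of_real \<rho> * (v x - g' x)"
        using that \<rho>0 by (simp add: v_def field_simps)
      then show ?thesis using g'(4)[OF that] \<rho>0 by (simp add: norm_mult)
    qed
    then have "approximable u (\<rho> / 2)"
      unfolding approximable_def using g' null_add[OF g(1) null_cmult[OF g'(1), of "of_real \<rho>"]] by blast
    then show False using \<rho>(2) by simp
  qed
  show ?thesis using 1 2 3 4 g(2,3) by (intro exI[of _ v] exI[of _ S]) (auto simp: v_def)
qed

end

section \<open>Averaging over directions\<close>

text \<open>A Lipschitz weight supported in the unit ball. After a change of variables the averages
  depend on \<open>x\<close> through this weight alone, so its Lipschitz bound is the source of
  equicontinuity.\<close>

definition hat :: "'a::real_normed_vector \<Rightarrow> real" where
  "hat b = max 0 (1 - norm b)"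

lemma hat_bounds: "0 \<le> hat b" "hat b \<le> 1"
  by (auto simp: hat_def)

lemma hat_outside: "b \<notin> ball 0 1 \<Longrightarrow> hat b = 0"
  by (auto simp: hat_def)

lemma hat_lipschitz: "\<bar>hat a - hat b\<bar> \<le> norm (a - b)"
proof -
  have "\<bar>norm a - norm b\<bar> \<le> norm (a - b)" by (rule norm_triangle_ineq3)
  then show ?thesis unfolding hat_def by linarith
qed

lemma hat_measurable [measurable]: "hat \<in> borel_measurable (borel :: 'a::euclidean_space measure)"
  unfolding hat_def [abs_def] by measurable

lemma open_emeasure_lborel_pos:
  fixes A :: "'a::euclidean_space set"
  assumes "open A" "A \<noteq> {}"
  obtains a where "0 < a" "ennreal a \<le> emeasure lborel A"
proof -
  obtain x r where "0 < r" "ball x r \<subseteq> A"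
    using assms by (metis open_contains_ball ex_in_conv)
  show ?thesis
  proof (rule that[of "measure lborel (ball x r)"])
    show "0 < measure lborel (ball x r)" using \<open>0 < r\<close> by (simp add: content_ball_pos)
    have "emeasure lborel (ball x r) = ennreal (measure lborel (ball x r))"
      by (intro emeasure_eq_ennreal_measure) (use emeasure_lborel_ball_finite[of x r] in \<open>auto simp: less_top\<close>)
    moreover have "emeasure lborel (ball x r) \<le> emeasure lborel A"
      using \<open>ball x r \<subseteq> A\<close> assms(1) by (intro emeasure_mono) auto
    ultimately show "ennreal (measure lborel (ball x r)) \<le> emeasure lborel A" by simp
  qed
qed

context differences
begin

lemma emeasure_U_finite: "emeasure lborel U < \<infinity>"
  by (simp add: emeasure_U)

definition W :: real where
  "W = (\<integral>b. hat b \<partial>(lborel :: 'a measure))"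

lemma integrable_hat: "integrable (lborel :: 'a measure) hat"
  by (rule integrableI_bounded_set[of U _ _ 1])
    (use emeasure_U_finite hat_bounds hat_outside in \<open>auto simp: U abs_of_nonneg[OF hat_bounds(1)]\<close>)

lemma W_pos: "0 < W"
proof -
  let ?B = "ball 0 (1 / 2) :: 'a set"
  have fin: "emeasure lborel ?B < \<infinity>" using emeasure_lborel_ball_finite[of "0 :: 'a" "1 / 2"] by simp
  have "(\<integral>b. 1 / 2 * indicator ?B b \<partial>lborel) \<le> W"
    unfolding W_def
  proof (rule integral_mono)
    show "integrable lborel (\<lambda>b. 1 / 2 * indicator ?B b :: real)"
      by (intro integrable_mult_right integrable_real_indicator) (use fin in auto)
    show "1 / 2 * indicator ?B b \<le> hat b" for b by (auto simp: hat_def indicator_def)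
  qed (rule integrable_hat)
  moreover have "(\<integral>b. 1 / 2 * indicator ?B b \<partial>lborel) = 1 / 2 * measure lborel ?B" by simp
  moreover have "0 < measure lborel ?B" by (simp add: content_ball_pos)
  ultimately show ?thesis by linarith
qed

definition avg :: "nat \<Rightarrow> ('a \<Rightarrow> complex) \<Rightarrow> 'a \<Rightarrow> complex" where
  "avg j f x = (\<integral>b. of_real (hat b) * f (node \<tau> x b j) \<partial>lborel)"

text \<open>The difference equation weighted by \<open>hat b\<close>, integrated over
  \<open>b\<close> and solved for the term with \<open>j = 0\<close>. For a bounded measurable
  solution on \<open>U\<close> it returns the function itself.\<close>

definition smooth :: "('a \<Rightarrow> complex) \<Rightarrow> 'a \<Rightarrow> complex" where
  "smooth f x = - (\<Sum>j=1..m. (-1) ^ j * of_nat (m choose j) * avg j f x) / of_real W"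

lemma node_measurable [measurable]: "(\<lambda>b. node \<tau> x b j) \<in> borel_measurable (borel :: 'a measure)"
  unfolding node_def by measurable

lemma avg_bounds:
  assumes [measurable]: "f \<in> borel_measurable borel" and f: "\<And>x. norm (f x) \<le> M"
  shows "integrable lborel (\<lambda>b. of_real (hat b) * f (node \<tau> x b j))"
    and "norm (avg j f x) \<le> M * measure lborel U"
proof -
  have M: "0 \<le> M" using f[of x] norm_ge_zero order_trans by blast
  have 1: "norm (complex_of_real (hat b) * f (node \<tau> x b j)) \<le> M" for b
    using mult_mono[OF hat_bounds(2)[of b] f[of "node \<tau> x b j"]] hat_bounds(1)[of b] by (simp add: norm_mult)
  have 2: "complex_of_real (hat b) * f (node \<tau> x b j) = 0" if "b \<notin> U" for b
    using that hat_outside by (auto simp: U)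
  have [measurable]: "(\<lambda>b. complex_of_real (hat b) * f (node \<tau> x b j)) \<in> borel_measurable borel" by measurable
  from norm_integral_lborel_le_set[OF this U_measurable emeasure_U_finite 1 2]
  show "integrable lborel (\<lambda>b. of_real (hat b) * f (node \<tau> x b j))"
    and "norm (avg j f x) \<le> M * measure lborel U"
    by (auto simp: avg_def)
qed

text \<open>Taking the node as variable of integration moves \<open>x\<close> from the merely
  measurable \<open>f\<close> into the weight. The substitution needs \<open>j * \<tau> > 0\<close>,
  hence \<open>1 \<le> j\<close>.\<close>

lemma avg_lipschitz:
  assumes [measurable]: "f \<in> borel_measurable borel" and f: "\<And>x. norm (f x) \<le> M"
    and f0: "\<And>x. x \<notin> U \<Longrightarrow> f x = 0" and j: "1 \<le> j" "j \<le> m"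
  shows "norm (avg j f x - avg j f y) \<le> 1 / \<tau> ^ DIM('a) * (norm (x - y) / \<tau> * M * measure lborel U)"
proof -
  have M: "0 \<le> M" using f[of x] norm_ge_zero order_trans by blast
  define c where "c = real j * \<tau>"
  have c: "\<tau> \<le> c" "c \<le> 1 / 2" "0 < c" using step_ge[OF j(1)] step_bounds[OF j(2)] \<tau>(1) by (auto simp: c_def)
  define F where "F z y = complex_of_real (hat ((1 / c) *\<^sub>R (y - (1 - c) *\<^sub>R z))) * f y" for z y
  have F[measurable]: "F z \<in> borel_measurable borel" for z unfolding F_def by measurable
  have F0: "F z y = 0" if "y \<notin> U" for z y using that by (simp add: F_def f0)
  have F1: "norm (F z y) \<le> M" for z y
    using mult_mono[OF hat_bounds(2) f] hat_bounds(1)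
    by (simp add: F_def norm_mult abs_of_nonneg[OF hat_bounds(1)])
  have intF: "integrable lborel (F z)" for z
    using norm_integral_lborel_le_set(1)[OF F U_measurable emeasure_U_finite F1 F0] .
  have avg: "avg j f z = (1 / c ^ DIM('a)) *\<^sub>R (\<integral>y. F z y \<partial>lborel)" for z
  proof -
    have "(\<integral>y. F z y \<partial>lborel) = \<bar>c\<bar> ^ DIM('a) *\<^sub>R (\<integral>b. F z ((1 - c) *\<^sub>R z + c *\<^sub>R b) \<partial>lborel)"
      using c by (intro integral_lborel_affine) auto
    also have "(\<integral>b. F z ((1 - c) *\<^sub>R z + c *\<^sub>R b) \<partial>lborel) = avg j f z"
      using c unfolding avg_def by (intro Bochner_Integration.integral_cong) (auto simp: F_def node_eq c_def)
    finally show ?thesis using c by simp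
  qed
  have "norm ((\<integral>w. F x w \<partial>lborel) - (\<integral>w. F y w \<partial>lborel)) = norm (\<integral>w. F x w - F y w \<partial>lborel)"
    using intF by simp
  also have "\<dots> \<le> norm (x - y) / \<tau> * M * measure lborel U"
  proof (rule norm_integral_lborel_le_set(2)[OF _ U_measurable emeasure_U_finite])
    show "(\<lambda>w. F x w - F y w) \<in> borel_measurable borel" by measurable
    show "F x w - F y w = 0" if "w \<notin> U" for w using F0[OF that] by simp
    show "norm (F x w - F y w) \<le> norm (x - y) / \<tau> * M" if "w \<in> U" for w
    proof -
      let ?p = "\<lambda>z. (1 / c) *\<^sub>R (w - (1 - c) *\<^sub>R z)"
      have "F x w - F y w = complex_of_real (hat (?p x) - hat (?p y)) * f w"
        by (simp add: F_def algebra_simps)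
      then have "norm (F x w - F y w) = \<bar>hat (?p x) - hat (?p y)\<bar> * norm (f w)"
        by (simp only: norm_mult norm_of_real)
      also have "\<dots> \<le> (norm (x - y) / \<tau>) * M"
      proof (rule mult_mono)
        have "?p x - ?p y = (1 / c) *\<^sub>R ((w - (1 - c) *\<^sub>R x) - (w - (1 - c) *\<^sub>R y))"
          by (rule scaleR_diff_right [symmetric])
        also have "(w - (1 - c) *\<^sub>R x) - (w - (1 - c) *\<^sub>R y) = (1 - c) *\<^sub>R (y - x)"
          by (simp add: algebra_simps)
        finally have "norm (?p x - ?p y) = (1 - c) / c * norm (x - y)"
          using c by (simp add: norm_minus_commute)
        also have "\<dots> \<le> 1 / \<tau> * norm (x - y)"
          using c \<tau>(1) by (intro mult_right_mono frac_le) auto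
        finally show "\<bar>hat (?p x) - hat (?p y)\<bar> \<le> norm (x - y) / \<tau>"
          using hat_lipschitz[of "?p x" "?p y"] by simp
      qed (use f \<tau>(1) in auto)
      finally show ?thesis .
    qed
  qed
  finally have *: "norm ((\<integral>w. F x w \<partial>lborel) - (\<integral>w. F y w \<partial>lborel)) \<le> norm (x - y) / \<tau> * M * measure lborel U" .
  have "norm (avg j f x - avg j f y) = 1 / c ^ DIM('a) * norm ((\<integral>w. F x w \<partial>lborel) - (\<integral>w. F y w \<partial>lborel))"
    using c by (simp add: avg flip: scaleR_diff_right)
  also have "\<dots> \<le> 1 / \<tau> ^ DIM('a) * (norm (x - y) / \<tau> * M * measure lborel U)"
    using c \<tau>(1) * by (intro mult_mono frac_le power_mono) auto
  finally show ?thesis .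
qed

lemma norm_sum_choose_le:
  assumes "\<And>j. 1 \<le> j \<Longrightarrow> j \<le> m \<Longrightarrow> norm (a j) \<le> B" "0 \<le> B"
  shows "norm ((\<Sum>j=1..m. (-1) ^ j * of_nat (m choose j) * a j) / of_real W :: complex) \<le> 2 ^ m * B / W"
proof -
  have "norm (\<Sum>j=1..m. (-1) ^ j * of_nat (m choose j) * a j) \<le> (\<Sum>j=1..m. real (m choose j) * B)"
    using assms by (intro sum_norm_le) (auto simp: norm_mult norm_power intro!: mult_left_mono)
  also have "\<dots> = (\<Sum>j=1..m. real (m choose j)) * B" by (simp add: sum_distrib_right)
  also have "\<dots> \<le> 2 ^ m * B" using assms(2) sum_choose_Icc by (intro mult_right_mono) auto
  finally show ?thesis using W_pos by (simp add: norm_divide divide_right_mono)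
qed

lemma smooth_bound:
  assumes "f \<in> borel_measurable borel" "\<And>x. norm (f x) \<le> M"
  shows "norm (smooth f x) \<le> 2 ^ m * (M * measure lborel U) / W"
proof -
  have "0 \<le> M" using assms(2)[of x] norm_ge_zero order_trans by blast
  then have "norm ((\<Sum>j=1..m. (-1) ^ j * of_nat (m choose j) * avg j f x) / of_real W) \<le> 2 ^ m * (M * measure lborel U) / W"
    using avg_bounds(2)[OF assms] measure_U_pos by (intro norm_sum_choose_le) auto
  then show ?thesis by (simp add: smooth_def)
qed

lemma smooth_lipschitz:
  assumes "f \<in> borel_measurable borel" "\<And>x. norm (f x) \<le> M" "\<And>x. x \<notin> U \<Longrightarrow> f x = 0"
  shows "norm (smooth f x - smooth f y)
    \<le> 2 ^ m * (1 / \<tau> ^ DIM('a) * (norm (x - y) / \<tau> * M * measure lborel U)) / W"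
proof -
  have M: "0 \<le> M" using assms(2)[of x] norm_ge_zero order_trans by blast
  have "smooth f x - smooth f y = - ((\<Sum>j=1..m. (-1) ^ j * of_nat (m choose j) * (avg j f x - avg j f y)) / of_real W)"
    by (simp add: smooth_def right_diff_distrib sum_subtractf diff_divide_distrib)
  moreover have "norm ((\<Sum>j=1..m. (-1) ^ j * of_nat (m choose j) * (avg j f x - avg j f y)) / of_real W)
      \<le> 2 ^ m * (1 / \<tau> ^ DIM('a) * (norm (x - y) / \<tau> * M * measure lborel U)) / W"
    using avg_lipschitz[OF assms] M \<tau>(1) measure_U_pos by (intro norm_sum_choose_le) auto
  ultimately show ?thesis by simp
qed

text \<open>A bound on \<open>v\<close> is available only on \<open>G\<close>, so \<open>v\<close>
  is cut off before averaging. The differences of the cut-off agree with those of \<open>v\<close>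
  in the directions whose nodes all stay in \<open>G\<close>; the other directions fill measure at
  most \<open>\<kappa> * s\<close>, and there the integrand is at most
  \<open>2 ^ m * M\<close>.\<close>

lemma smooth_close:
  assumes [measurable]: "v \<in> borel_measurable borel" "G \<in> sets borel" "T \<in> sets borel"
    and G: "G \<subseteq> U" "x \<in> G" and s: "emeasure lborel (U - G) \<le> ennreal s" "emeasure lborel T \<le> ennreal s" "0 \<le> s"
    and M: "\<And>y. y \<in> G \<Longrightarrow> norm (v y) \<le> M" "0 \<le> A"
    and fd: "\<And>b. b \<in> U \<Longrightarrow> b \<notin> T \<Longrightarrow> norm (fdiff m (\<lambda>j. v (node \<tau> x b j))) \<le> A"
  defines "f \<equiv> \<lambda>y. if y \<in> G then v y else 0"
  shows "norm (v x - smooth f x) \<le> (2 ^ m * M * (\<kappa> * s) + A * measure lborel U) / W"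
proof -
  have M0: "0 \<le> M" using M(1)[OF G(2)] norm_ge_zero order_trans by blast
  have fm[measurable]: "f \<in> borel_measurable borel" unfolding f_def by measurable
  have fM: "norm (f y) \<le> M" for y using M M0 by (simp add: f_def)
  define H where "H b = complex_of_real (hat b) * fdiff m (\<lambda>j. f (node \<tau> x b j))" for b
  define Bad where "Bad = {b. b \<in> T \<or> (\<exists>j\<in>{1..m}. node \<tau> x b j \<in> U - G)}"
  have UG: "U - G \<in> sets borel" by measurable
  have Bad[measurable]: "Bad \<in> sets borel" and BadM: "emeasure lborel Bad \<le> ennreal (\<kappa> * s)"
    unfolding Bad_def using bad_directions[OF UG assms(3) s] by auto
  have Hm[measurable]: "H \<in> borel_measurable borel" unfolding H_def fdiff_def by measurable
  \<comment> \<open>The term with \<open>j = 0\<close> does not depend on \<open>b\<close>, so the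
    weighted mean of the differences is exactly \<open>W\<close> times the deviation from
    \<open>smooth\<close>.\<close>
  have int0: "of_real W * (v x - smooth f x) = (\<integral>b. H b \<partial>lborel)"
  proof -
    have "H b = of_real (hat b) * f x + (\<Sum>j=1..m. (-1) ^ j * of_nat (m choose j) * (of_real (hat b) * f (node \<tau> x b j)))" for b
      unfolding H_def fdiff_shift by (simp add: node_def distrib_left sum_distrib_left mult_ac)
    then have "(\<integral>b. H b \<partial>lborel) = (\<integral>b. of_real (hat b) * f x \<partial>(lborel :: 'a measure)) + (\<Sum>j=1..m. (-1) ^ j * of_nat (m choose j) * avg j f x)"
      using avg_bounds(1)[OF fm fM] integrable_hat unfolding avg_def
      by (simp add: Bochner_Integration.integral_add Bochner_Integration.integral_sum)
    also have "(\<integral>b. of_real (hat b) * f x \<partial>(lborel :: 'a measure)) = of_real W * f x"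
      using integrable_hat by (simp add: W_def)
    also have "(\<Sum>j=1..m. (-1) ^ j * of_nat (m choose j) * avg j f x) = - of_real W * smooth f x"
      using W_pos by (simp add: smooth_def)
    finally show ?thesis using G(2) by (simp add: f_def algebra_simps)
  qed
  have 1: "norm (\<integral>b. H b * indicator (U \<inter> Bad) b \<partial>lborel) \<le> 2 ^ m * M * measure lborel (U \<inter> Bad)"
    and i1: "integrable lborel (\<lambda>b. H b * indicator (U \<inter> Bad) b)"
  proof -
    have m: "(\<lambda>b. H b * indicator (U \<inter> Bad) b) \<in> borel_measurable borel" "U \<inter> Bad \<in> sets borel" by measurable
    have fin: "emeasure lborel (U \<inter> Bad) < \<infinity>"
      using emeasure_U_finite by (rule le_less_trans[OF emeasure_mono, rotated 2]) auto
    have b: "norm (H b * indicator (U \<inter> Bad) b) \<le> 2 ^ m * M" for b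
    proof -
      have "norm (H b) \<le> 1 * (2 ^ m * M)"
        unfolding H_def norm_mult using hat_bounds[of b] fM by (intro mult_mono norm_fdiff_le) auto
      then show ?thesis using M0 by (auto simp: indicator_def)
    qed
    have z: "H b * indicator (U \<inter> Bad) b = 0" if "b \<notin> U \<inter> Bad" for b using that by simp
    from norm_integral_lborel_le_set[OF m fin b z]
    show "norm (\<integral>b. H b * indicator (U \<inter> Bad) b \<partial>lborel) \<le> 2 ^ m * M * measure lborel (U \<inter> Bad)"
      and "integrable lborel (\<lambda>b. H b * indicator (U \<inter> Bad) b)" by auto
  qed
  have 2: "norm (\<integral>b. H b * indicator (U - Bad) b \<partial>lborel) \<le> A * measure lborel U"
    and i2: "integrable lborel (\<lambda>b. H b * indicator (U - Bad) b)"
  proof -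
    have m: "(\<lambda>b. H b * indicator (U - Bad) b) \<in> borel_measurable borel" by measurable
    have b: "norm (H b * indicator (U - Bad) b) \<le> A" if "b \<in> U" for b
    proof (cases "b \<in> Bad")
      case False
      have "node \<tau> x b j \<in> G" if "j \<le> m" for j
        using False that \<open>b \<in> U\<close> G node_in_U[of x b j] by (cases "j = 0") (auto simp: Bad_def node_def)
      then have "fdiff m (\<lambda>j. f (node \<tau> x b j)) = fdiff m (\<lambda>j. v (node \<tau> x b j))"
        by (intro fdiff_cong) (simp add: f_def)
      moreover have "norm (fdiff m (\<lambda>j. v (node \<tau> x b j))) \<le> A"
        using False \<open>b \<in> U\<close> by (intro fd) (auto simp: Bad_def)
      ultimately have "norm (H b) \<le> 1 * A"
        unfolding H_def norm_mult using hat_bounds[of b] by (intro mult_mono) auto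
      then show ?thesis using False \<open>b \<in> U\<close> by simp
    qed (use M in auto)
    have z: "H b * indicator (U - Bad) b = 0" if "b \<notin> U" for b using that by simp
    from norm_integral_lborel_le_set[OF m U_measurable emeasure_U_finite b z]
    show "norm (\<integral>b. H b * indicator (U - Bad) b \<partial>lborel) \<le> A * measure lborel U"
      and "integrable lborel (\<lambda>b. H b * indicator (U - Bad) b)" by auto
  qed
  have "H b = H b * indicator (U \<inter> Bad) b + H b * indicator (U - Bad) b" for b
    using hat_outside[of b] by (auto simp: H_def indicator_def U)
  then have "(\<integral>b. H b \<partial>lborel) = (\<integral>b. H b * indicator (U \<inter> Bad) b + H b * indicator (U - Bad) b \<partial>lborel)"
    by (rule Bochner_Integration.integral_cong[OF refl])
  also have "\<dots> = (\<integral>b. H b * indicator (U \<inter> Bad) b \<partial>lborel) + (\<integral>b. H b * indicator (U - Bad) b \<partial>lborel)"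
    by (rule Bochner_Integration.integral_add[OF i1 i2])
  finally have "norm (\<integral>b. H b \<partial>lborel) \<le> 2 ^ m * M * measure lborel (U \<inter> Bad) + A * measure lborel U"
    using 1 2 norm_triangle_mono by metis
  also have "measure lborel (U \<inter> Bad) \<le> \<kappa> * s"
  proof -
    have "emeasure lborel (U \<inter> Bad) \<le> ennreal (\<kappa> * s)"
      by (rule order.trans[OF emeasure_mono BadM]) auto
    then show ?thesis unfolding measure_def using kappa_ge s(3) by (intro enn2real_leI) auto
  qed
  finally have "norm (\<integral>b. H b \<partial>lborel) \<le> 2 ^ m * M * (\<kappa> * s) + A * measure lborel U"
    using M0 by (simp add: mult_left_mono)
  then have "W * norm (v x - smooth f x) \<le> 2 ^ m * M * (\<kappa> * s) + A * measure lborel U"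
    using W_pos unfolding int0[symmetric] norm_mult by simp
  then show ?thesis using W_pos by (simp add: field_simps)
qed

end

section \<open>Compactness\<close>

context differences
begin

definition good :: "('a \<times> 'a) set \<Rightarrow> real \<Rightarrow> 'a set" where
  "good N s = {x \<in> U. emeasure lborel (Pair x -` N) \<le> ennreal s}"

lemma good_subset: "good N s \<subseteq> U"
  by (auto simp: good_def)

lemma good_measurable:
  assumes "N \<in> sets borel" "0 < s" "emeasure lborel N \<le> ennreal (s * s)"
  shows "good N s \<in> sets borel" "emeasure lborel (U - good N s) \<le> ennreal s"
proof -
  note sm = slice_markov[OF assms]
  have "good N s = U \<inter> {x. emeasure lborel (Pair x -` N) \<le> ennreal s}" by (auto simp: good_def)
  then show "good N s \<in> sets borel" using sm(1) by auto
  have "emeasure lborel (U - good N s) \<le> emeasure lborel (- {x. emeasure lborel (Pair x -` N) \<le> ennreal s})"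
    using sm(1) by (intro emeasure_mono) (auto simp: good_def)
  also have "- {x. emeasure lborel (Pair x -` N) \<le> ennreal s} = {x. \<not> emeasure lborel (Pair x -` N) \<le> ennreal s}"
    by auto
  finally show "emeasure lborel (U - good N s) \<le> ennreal s" using sm(2) by simp
qed

lemma slice_measurable:
  fixes N :: "('a \<times> 'a) set"
  assumes "N \<in> sets borel" shows "Pair x -` N \<in> sets borel"
proof -
  have "N \<in> sets (lborel \<Otimes>\<^sub>M lborel)" using assms by (metis lborel_prod sets_lborel)
  from sets_Pair1[OF this] show ?thesis by simp
qed

lemma bootstrap_good:
  assumes "N \<in> sets borel" "0 < s" "s \<le> e0" "x \<in> good N s"
    and "S \<in> sets borel" "emeasure lborel S \<le> ennreal e0" "0 \<le> \<rho>"
    and "\<And>x b. x \<in> U \<Longrightarrow> b \<in> U \<Longrightarrow> (x, b) \<notin> N \<Longrightarrow> norm (fdiff m (\<lambda>j. u (node \<tau> x b j))) \<le> A"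
    and "\<And>y. y \<in> U \<Longrightarrow> y \<notin> S \<Longrightarrow> norm (u y) \<le> \<rho>"
  shows "norm (u x) \<le> A + 2 ^ m * \<rho>"
proof (rule bootstrap[OF assms(5) slice_measurable[OF assms(1), of x] assms(6)])
  have "emeasure lborel (Pair x -` N) \<le> ennreal s" using assms(4) by (simp add: good_def)
  also have "\<dots> \<le> ennreal e0" using assms(3) by (rule ennreal_leI)
  finally show "emeasure lborel (Pair x -` N) \<le> ennreal e0" .
  show "x \<in> U" using assms(4) by (simp add: good_def)
  then show "norm (fdiff m (\<lambda>j. u (node \<tau> x b j))) \<le> A" if "b \<in> U" "b \<notin> Pair x -` N" for b
    using that by (intro assms(8)) auto
qed (use assms in auto)

text \<open>No convergence of the \<open>f n\<close> is asked for: boundedness alone makes the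
  averages equibounded and uniformly Lipschitz, as Arzela-Ascoli requires.\<close>

lemma smooth_family_compact:
  fixes f :: "nat \<Rightarrow> 'a \<Rightarrow> complex"
  assumes "\<And>n. f n \<in> borel_measurable borel" "\<And>n x. norm (f n x) \<le> M" "\<And>n x. x \<notin> U \<Longrightarrow> f n x = 0"
  obtains g r where "continuous_on (cball 0 1) g" "strict_mono (r :: nat \<Rightarrow> nat)"
    "\<And>e. 0 < e \<Longrightarrow> \<exists>K. \<forall>n x. n \<ge> K \<and> x \<in> cball 0 1 \<longrightarrow> norm (smooth (f (r n)) x - g x) < e"
proof -
  have M: "0 \<le> M" using assms(2)[of 0 0] norm_ge_zero order_trans by blast
  define L where "L = 2 ^ m * (1 / \<tau> ^ DIM('a) * (1 / \<tau> * M * measure lborel U)) / W"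
  have L: "0 \<le> L" using M \<tau>(1) W_pos measure_U_pos by (auto simp: L_def)
  have lip: "norm (smooth (f n) x - smooth (f n) y) \<le> L * norm (x - y)" for n x y
    using smooth_lipschitz[OF assms(1,2,3), of n x y] by (simp add: L_def mult_ac)
  show ?thesis
  proof (rule Arzela_Ascoli[of "cball 0 1" "\<lambda>n. smooth (f n)" "2 ^ m * (M * measure lborel U) / W"])
    show "compact (cball 0 1 :: 'a set)" by simp
    show "norm (smooth (f n) x) \<le> 2 ^ m * (M * measure lborel U) / W" for n x
      by (rule smooth_bound[OF assms(1,2)])
    fix x :: 'a and e :: real assume "0 < e"
    show "\<exists>d. 0 < d \<and> (\<forall>n y. y \<in> cball 0 1 \<and> norm (x - y) < d \<longrightarrow> norm (smooth (f n) x - smooth (f n) y) < e)"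
    proof (intro exI[of _ "e / (L + 1)"] conjI allI impI)
      fix n and y :: 'a assume y: "y \<in> cball 0 1 \<and> norm (x - y) < e / (L + 1)"
      have "norm (smooth (f n) x - smooth (f n) y) \<le> L * norm (x - y)" by (rule lip)
      also have "\<dots> \<le> L * (e / (L + 1))" using L y by (intro mult_left_mono) auto
      also have "\<dots> < e" using L \<open>0 < e\<close> by (simp add: field_simps)
      finally show "norm (smooth (f n) x - smooth (f n) y) < e" .
    qed (use L \<open>0 < e\<close> in auto)
  qed (use that in blast)
qed

text \<open>Only the nodes that lie in the good sets see the approximants, so the limit equation is first
  obtained at some pair in each open set of pairs and then everywhere by continuity.\<close>

lemma null_if_limit:
  fixes v :: "nat \<Rightarrow> 'a \<Rightarrow> complex" and N :: "nat \<Rightarrow> ('a \<times> 'a) set" and s A :: "nat \<Rightarrow> real"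
  assumes N: "\<And>n. N n \<in> sets borel" "\<And>n. 0 < s n" "\<And>n. emeasure lborel (N n) \<le> ennreal (s n * s n)"
    and s0: "s \<longlonglongrightarrow> 0" and A0: "A \<longlonglongrightarrow> 0"
    and fd: "\<And>n x b. x \<in> U \<Longrightarrow> b \<in> U \<Longrightarrow> (x, b) \<notin> N n \<Longrightarrow> norm (fdiff m (\<lambda>j. v n (node \<tau> x b j))) \<le> A n"
    and cont: "continuous_on U g"
    and conv: "\<And>e. 0 < e \<Longrightarrow> \<forall>\<^sub>F n in sequentially. \<forall>x\<in>good (N n) (s n). norm (v n x - g x) \<le> e"
  shows "null g"
proof -
  define \<Phi> where "\<Phi> p = fdiff m (\<lambda>j. g (node \<tau> (fst p) (snd p) j))" for p
  have openU: "open U" by (simp add: U)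
  have cont\<Phi>: "continuous_on (U \<times> U) \<Phi>"
  proof -
    have "continuous_on (U \<times> U) (\<lambda>p. g (node \<tau> (fst p) (snd p) j))" if "j \<le> m" for j
    proof (rule continuous_on_compose2[OF cont])
      show "continuous_on (U \<times> U) (\<lambda>p. node \<tau> (fst p) (snd p) j)"
        unfolding node_def by (intro continuous_intros)
    qed (use that node_in_U in auto)
    then show ?thesis unfolding \<Phi>_def fdiff_def by (intro continuous_intros) auto
  qed
  have "\<Phi> (x, b) = 0" if xb: "x \<in> U" "b \<in> U" for x b
  proof (rule ccontr)
    assume nz: "\<Phi> (x, b) \<noteq> 0"
    define z where "z = norm (\<Phi> (x, b))"
    have z: "0 < z" using nz by (simp add: z_def)
    \<comment> \<open>A neighbourhood on which the limit difference stays away from 0. It contains a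
      rectangle whose sides have positive measure, which for large \<open>n\<close> exceeds the
      measure of the bad base points and of the bad directions.\<close>
    define O' where "O' = (U \<times> U) \<inter> (\<lambda>p. norm (\<Phi> p)) -` {z / 2<..}"
    have "open O'"
      unfolding O'_def
      by (intro continuous_open_preimage continuous_on_norm cont\<Phi> open_Times openU open_greaterThan)
    moreover have "(x, b) \<in> O'" using xb z by (simp add: O'_def z_def)
    ultimately obtain V1 V2 where V: "open V1" "open V2" "(x, b) \<in> V1 \<times> V2" "V1 \<times> V2 \<subseteq> O'"
      by (rule open_prod_elim)
    have VU: "V1 \<subseteq> U" "V2 \<subseteq> U" using V by (auto simp: O'_def)
    obtain a1 where a1: "0 < a1" "ennreal a1 \<le> emeasure lborel V1"
      using open_emeasure_lborel_pos[OF V(1)] V(3) by auto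
    obtain a2 where a2: "0 < a2" "ennreal a2 \<le> emeasure lborel V2"
      using open_emeasure_lborel_pos[OF V(2)] V(3) by auto
    \<comment> \<open>The difference of \<open>v n\<close> and that of the error then contribute at
      most \<open>z / 8\<close> each, less than the \<open>z / 2\<close> that holds on the
      neighbourhood.\<close>
    define e where "e = z / (8 * 2 ^ m)"
    have e: "0 < e" using z by (simp add: e_def)
    have "(\<lambda>n. \<kappa> * s n) \<longlonglongrightarrow> \<kappa> * 0" by (intro tendsto_intros s0)
    then have "\<forall>\<^sub>F n in sequentially. \<kappa> * s n < a2" by (rule order_tendstoD) (use a2 in simp)
    moreover have "\<forall>\<^sub>F n in sequentially. s n < a1" using s0 by (rule order_tendstoD) (use a1 in simp)
    moreover have "\<forall>\<^sub>F n in sequentially. A n < z / 8" using A0 by (rule order_tendstoD) (use z in simp)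
    ultimately have "\<forall>\<^sub>F n in sequentially. \<kappa> * s n < a2 \<and> s n < a1 \<and> A n < z / 8 \<and>
        (\<forall>x\<in>good (N n) (s n). norm (v n x - g x) \<le> e)"
      using conv[OF e] by eventually_elim auto
    then obtain n where n: "\<kappa> * s n < a2" "s n < a1" "A n < z / 8"
        "\<And>x. x \<in> good (N n) (s n) \<Longrightarrow> norm (v n x - g x) \<le> e"
      using eventually_happens'[OF sequentially_bot] by blast
    define G where "G = good (N n) (s n)"
    have G: "G \<in> sets borel" "emeasure lborel (U - G) \<le> ennreal (s n)"
      using good_measurable[OF N] by (auto simp: G_def)
    have "\<not> V1 \<subseteq> U - G"
    proof
      assume "V1 \<subseteq> U - G"
      then have "emeasure lborel V1 \<le> emeasure lborel (U - G)" using G by (intro emeasure_mono) auto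
      also have "\<dots> \<le> ennreal (s n)" by (rule G)
      also have "\<dots> < ennreal a1" using n(2) a1 N(2)[of n] by (intro ennreal_lessI) auto
      finally show False using a1(2) by simp
    qed
    then obtain x' where x': "x' \<in> V1" "x' \<in> G" "x' \<in> U" using VU by auto
    have "ennreal (\<kappa> * s n) < ennreal a2" using n(1) a2 kappa_ge N(2)[of n] by (intro ennreal_lessI) auto
    then have "ennreal (\<kappa> * s n) < emeasure lborel V2" using a2(2) by (rule order.strict_trans2)
    moreover have "emeasure lborel (Pair x' -` N n) \<le> ennreal (s n)" using x'(2) by (simp add: G_def good_def)
    moreover have "U - G \<in> sets borel" "V2 \<in> sets borel" using G V(2) by auto
    ultimately obtain b' where b': "b' \<in> V2" "b' \<notin> Pair x' -` N n"
        "\<And>j. 1 \<le> j \<Longrightarrow> j \<le> m \<Longrightarrow> node \<tau> x' b' j \<notin> U - G"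
      using pick_direction[of "U - G" "Pair x' -` N n" V2 "s n" x'] slice_measurable[OF N(1)] G N(2)[of n]
      by (metis less_imp_le)
    have b'U: "b' \<in> U" using b' VU by auto
    have inG: "node \<tau> x' b' j \<in> G" if "j \<le> m" for j
      using that b'(3)[of j] node_in_U[OF x'(3) b'U that] x'(2) by (cases "j = 0") (auto simp: node_def)
    have "\<Phi> (x', b') = fdiff m (\<lambda>j. v n (node \<tau> x' b' j)) - fdiff m (\<lambda>j. v n (node \<tau> x' b' j) - g (node \<tau> x' b' j))"
      by (simp add: \<Phi>_def fdiff_diff)
    also have "norm \<dots> \<le> A n + 2 ^ m * e"
    proof (intro norm_triangle_le_diff add_mono)
      show "norm (fdiff m (\<lambda>j. v n (node \<tau> x' b' j))) \<le> A n" using x' b' b'U by (intro fd) auto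
      show "norm (fdiff m (\<lambda>j. v n (node \<tau> x' b' j) - g (node \<tau> x' b' j))) \<le> 2 ^ m * e"
        using inG n(4) by (intro norm_fdiff_le) (auto simp: G_def)
    qed
    also have "\<dots> < z / 2" using n(3) z by (simp add: e_def)
    finally have "norm (\<Phi> (x', b')) < z / 2" .
    moreover have "(x', b') \<in> O'" using V(4) x' b' by auto
    ultimately show False by (simp add: O'_def)
  qed
  then show ?thesis using cont by (auto simp: null_def \<Phi>_def)
qed

text \<open>The exceptional sets \<open>S n\<close> need not shrink, so the bound on
  \<open>v n\<close> is not directly usable. The bootstrap moves it to good sets, whose complements
  do shrink; there \<open>v n\<close> is close to the average of its cut-off, and the averages have
  a uniformly convergent subsequence.\<close>

lemma sequence_approximable:
  fixes v :: "nat \<Rightarrow> 'a \<Rightarrow> complex" and N :: "nat \<Rightarrow> ('a \<times> 'a) set" and s A :: "nat \<Rightarrow> real"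
  assumes v: "\<And>n. v n \<in> borel_measurable borel"
    and S: "\<And>n. S n \<in> sets borel" "\<And>n. emeasure lborel (S n) \<le> ennreal e0" "\<And>n x. x \<in> U - S n \<Longrightarrow> norm (v n x) \<le> 1"
    and N: "\<And>n. N n \<in> sets borel" "\<And>n. 0 < s n" "\<And>n. emeasure lborel (N n) \<le> ennreal (s n * s n)"
    and se: "\<And>n. s n \<le> e0" and s0: "s \<longlonglongrightarrow> 0" and A0: "A \<longlonglongrightarrow> 0" and A1: "\<And>n. 0 \<le> A n" "\<And>n. A n \<le> 1"
    and fd: "\<And>n x b. x \<in> U \<Longrightarrow> b \<in> U \<Longrightarrow> (x, b) \<notin> N n \<Longrightarrow> norm (fdiff m (\<lambda>j. v n (node \<tau> x b j))) \<le> A n"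
  shows "\<exists>n. approximable (v n) (1 / 2)"
proof -
  define G where "G n = good (N n) (s n)" for n
  have G: "G n \<in> sets borel" "emeasure lborel (U - G n) \<le> ennreal (s n)" "G n \<subseteq> U" for n
    using good_measurable[OF N] good_subset by (auto simp: G_def)
  define M where "M = 1 + 2 ^ m * (1 :: real)"
  have vM: "norm (v n x) \<le> M" if "x \<in> G n" for n x
  proof -
    have "norm (v n x) \<le> A n + 2 ^ m * 1"
      using that S(3)[of _ n] unfolding G_def
      by (intro bootstrap_good[OF N(1,2) se _ S(1,2), of _ n "n"] fd) auto
    then show ?thesis using A1(2)[of n] by (simp add: M_def)
  qed
  have M0: "0 \<le> M" by (simp add: M_def)
  define f where "f n y = (if y \<in> G n then v n y else 0)" for n y
  have fm: "f n \<in> borel_measurable borel" for n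
    unfolding f_def using v[of n] G(1)[of n] by measurable
  have fM: "norm (f n x) \<le> M" for n x using vM M0 by (simp add: f_def)
  have f0: "f n x = 0" if "x \<notin> U" for n x using that G(3) by (auto simp: f_def)
  obtain g r where g: "continuous_on (cball 0 1) g" and r: "strict_mono (r :: nat \<Rightarrow> nat)" and
    gconv: "\<And>e. 0 < e \<Longrightarrow> \<exists>K. \<forall>n x. n \<ge> K \<and> x \<in> cball 0 1 \<longrightarrow> norm (smooth (f (r n)) x - g x) < e"
    by (rule smooth_family_compact[of f M, OF fm fM]) (erule f0, rule that)
  define err where "err n = (2 ^ m * M * (\<kappa> * s n) + A n * measure lborel U) / W" for n
  have close: "norm (v n x - smooth (f n) x) \<le> err n" if "x \<in> G n" for n x
    unfolding err_def f_def
  proof (rule smooth_close[OF v G(1) slice_measurable[OF N(1)] G(3) that G(2)])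
    show "emeasure lborel (Pair x -` N n) \<le> ennreal (s n)" using that by (simp add: G_def good_def)
    show "norm (fdiff m (\<lambda>j. v n (node \<tau> x b j))) \<le> A n" if "b \<in> U" "b \<notin> Pair x -` N n" for b
      using that \<open>x \<in> G n\<close> G(3) by (intro fd) auto
  qed (use N(2)[of n] A1(1)[of n] vM in auto)
  have "err \<longlonglongrightarrow> (2 ^ m * M * (\<kappa> * 0) + 0 * measure lborel U) / W"
    unfolding err_def using W_pos by (intro tendsto_intros s0 A0) auto
  then have err0: "(\<lambda>n. err (r n)) \<longlonglongrightarrow> 0" using LIMSEQ_subseq_LIMSEQ[OF _ r] by (simp add: o_def)
  have conv: "\<forall>\<^sub>F n in sequentially. \<forall>x\<in>G (r n). norm (v (r n) x - g x) \<le> e" if "0 < e" for e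
  proof -
    have "0 < e / 2" using that by simp
    from gconv[OF this] obtain K where
      K: "\<And>n x. n \<ge> K \<Longrightarrow> x \<in> cball 0 1 \<Longrightarrow> norm (smooth (f (r n)) x - g x) < e / 2"
      by blast
    have "\<forall>\<^sub>F n in sequentially. err (r n) < e / 2" using err0 by (rule order_tendstoD) (use that in simp)
    moreover have "\<forall>\<^sub>F n in sequentially. n \<ge> K" by (rule eventually_ge_at_top)
    ultimately show ?thesis
    proof eventually_elim
      case (elim n)
      show ?case
      proof
        fix x assume x: "x \<in> G (r n)"
        then have "x \<in> cball 0 1" using G(3)[of "r n"] by (auto simp: U)
        from K[OF elim(2) this] close[OF x] elim(1)
        show "norm (v (r n) x - g x) \<le> e"
          using norm_triangle_ineq[of "v (r n) x - smooth (f (r n)) x" "smooth (f (r n)) x - g x"] by simp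
      qed
    qed
  qed
  have sub: "(\<lambda>n. s (r n)) \<longlonglongrightarrow> 0" "(\<lambda>n. A (r n)) \<longlonglongrightarrow> 0"
    using LIMSEQ_subseq_LIMSEQ[OF s0 r] LIMSEQ_subseq_LIMSEQ[OF A0 r] by (auto simp: o_def)
  have "null g"
  proof (rule null_if_limit[of "\<lambda>n. N (r n)" "\<lambda>n. s (r n)" "\<lambda>n. A (r n)" "\<lambda>n. v (r n)"])
    show "continuous_on U g" using g by (rule continuous_on_subset) (auto simp: U)
  qed (use N sub fd conv in \<open>auto simp: G_def\<close>)
  moreover obtain n where "\<forall>x\<in>G (r n). norm (v (r n) x - g x) \<le> 1 / 2"
    using eventually_happens'[OF sequentially_bot conv[of "1 / 2"]] by auto
  moreover have "emeasure lborel (U - G (r n)) \<le> ennreal e0"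
    using G(2)[of "r n"] ennreal_leI[OF se[of "r n"]] by (rule order.trans)
  ultimately have "approximable (v (r n)) (1 / 2)"
    unfolding approximable_def using G(1)[of "r n"] by (intro exI[of _ g] conjI bexI[of _ "U - G (r n)"]) auto
  then show ?thesis ..
qed

end

section \<open>Stability of the difference equation\<close>

context differences
begin

text \<open>One index drives both quantities: a counterexample to the constant \<open>Suc n\<close>
  at smallness \<open>s n\<close> is normalized to a function with differences at most
  \<open>1 / Suc n\<close>. Such a sequence cannot stay away from the solutions.\<close>

lemma uniformly_approximable:
  "\<exists>K :: nat. \<exists>s > 0. s \<le> e0 \<and> (\<forall>u A N. u \<in> borel_measurable borel \<longrightarrow> N \<in> sets borel \<longrightarrow> 0 < A \<longrightarrow>
     emeasure lborel N \<le> ennreal (s * s) \<longrightarrow>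
     (\<forall>x\<in>U. \<forall>b\<in>U. (x, b) \<notin> N \<longrightarrow> norm (fdiff m (\<lambda>j. u (node \<tau> x b j))) \<le> A) \<longrightarrow>
     approximable u (real (Suc K) * A))"
proof (rule ccontr)
  assume neg: "\<not> ?thesis"
  define s where "s n = min e0 (1 / real (Suc n))" for n
  have s: "0 < s n" "s n \<le> e0" for n using e0_pos by (auto simp: s_def)
  have "\<exists>v S N. v \<in> borel_measurable borel \<and> S \<in> sets borel \<and> emeasure lborel S \<le> ennreal e0 \<and>
    (\<forall>x\<in>U - S. norm (v x) \<le> 1) \<and>
    (\<forall>x\<in>U. \<forall>b\<in>U. (x, b) \<notin> N \<longrightarrow> norm (fdiff m (\<lambda>j. v (node \<tau> x b j))) \<le> 1 / real (Suc n)) \<and>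
    \<not> approximable v (1 / 2) \<and> N \<in> sets borel \<and> emeasure lborel N \<le> ennreal (s n * s n)" for n
  proof -
    obtain u A N where u: "u \<in> borel_measurable borel" "N \<in> sets borel" "0 < A"
     "emeasure lborel N \<le> ennreal (s n * s n)"
     "\<forall>x\<in>U. \<forall>b\<in>U. (x, b) \<notin> N \<longrightarrow> norm (fdiff m (\<lambda>j. u (node \<tau> x b j))) \<le> A"
     "\<not> approximable u (real (Suc n) * A)"
      using neg s[of n] by blast
    have "0 < real (Suc n)" by simp
    with normalization_step[OF u(1,3) this _ u(6), of N] u(2,4,5) show ?thesis by metis
  qed
  then obtain v S N where v: "\<And>n. v n \<in> borel_measurable borel" "\<And>n. S n \<in> sets borel"
    "\<And>n. emeasure lborel (S n) \<le> ennreal e0" "\<And>n x. x \<in> U - S n \<Longrightarrow> norm (v n x) \<le> 1"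
    "\<And>n x b. x \<in> U \<Longrightarrow> b \<in> U \<Longrightarrow> (x, b) \<notin> N n \<Longrightarrow> norm (fdiff m (\<lambda>j. v n (node \<tau> x b j))) \<le> 1 / real (Suc n)"
    "\<And>n. \<not> approximable (v n) (1 / 2)" "\<And>n. N n \<in> sets borel" "\<And>n. emeasure lborel (N n) \<le> ennreal (s n * s n)"
    by metis
  have lim: "(\<lambda>n. 1 / real (Suc n)) \<longlonglongrightarrow> 0"
    using LIMSEQ_inverse_real_of_nat by (simp add: inverse_eq_divide)
  have "s \<longlonglongrightarrow> 0"
    by (rule tendsto_sandwich[OF _ _ tendsto_const lim])
      (use s in \<open>auto intro!: always_eventually less_imp_le simp: s_def\<close>)
  have "\<exists>n. approximable (v n) (1 / 2)"
  proof (rule sequence_approximable[of v S N s "\<lambda>n. 1 / real (Suc n)"])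
    show "norm (v n x) \<le> 1" if "x \<in> U - S n" for n x by (rule v(4)[OF that])
    show "norm (fdiff m (\<lambda>j. v n (node \<tau> x b j))) \<le> 1 / real (Suc n)"
      if "x \<in> U" "b \<in> U" "(x, b) \<notin> N n" for n x b by (rule v(5)[OF that])
  qed ((rule v(1) v(2) v(3) v(7) v(8) s lim \<open>s \<longlonglongrightarrow> 0\<close>)+, simp_all)
  then show False using v(6) by blast
qed

text \<open>Compactness leaves an exceptional set of measure up to \<open>e0\<close>. Since
  \<open>u - g\<close> has the same differences as \<open>u\<close>, the bootstrap replaces that set
  by the points with large slices of \<open>N\<close>, with one constant for all \<open>s\<close>
  below the threshold.\<close>

lemma near_null_pos:
  "\<exists>C > 0. \<exists>s0 > 0. s0 \<le> e0 \<and> (\<forall>u A N s. u \<in> borel_measurable borel \<longrightarrow> N \<in> sets borel \<longrightarrow> 0 < A \<longrightarrow>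
     0 < s \<longrightarrow> s \<le> s0 \<longrightarrow> emeasure lborel N \<le> ennreal (s * s) \<longrightarrow>
     (\<forall>x\<in>U. \<forall>b\<in>U. (x, b) \<notin> N \<longrightarrow> norm (fdiff m (\<lambda>j. u (node \<tau> x b j))) \<le> A) \<longrightarrow>
     (\<exists>g. null g \<and> (\<forall>x\<in>good N s. norm (u x - g x) \<le> C * A)))"
proof -
  obtain K s0 where s0: "0 < s0" "s0 \<le> e0" and
    ap: "\<And>u A N. u \<in> borel_measurable borel \<Longrightarrow> N \<in> sets borel \<Longrightarrow> 0 < A \<Longrightarrow>
     emeasure lborel N \<le> ennreal (s0 * s0) \<Longrightarrow>
     \<forall>x\<in>U. \<forall>b\<in>U. (x, b) \<notin> N \<longrightarrow> norm (fdiff m (\<lambda>j. u (node \<tau> x b j))) \<le> A \<Longrightarrow>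
     approximable u (real (Suc K) * A)"
    using uniformly_approximable by blast
  define C where "C = 1 + 2 ^ m * real (Suc K)"
  have "\<exists>g. null g \<and> (\<forall>x\<in>good N s. norm (u x - g x) \<le> C * A)"
    if u: "u \<in> borel_measurable borel" "N \<in> sets borel" "0 < A" "0 < s" "s \<le> s0"
      "emeasure lborel N \<le> ennreal (s * s)"
      and fd: "\<forall>x\<in>U. \<forall>b\<in>U. (x, b) \<notin> N \<longrightarrow> norm (fdiff m (\<lambda>j. u (node \<tau> x b j))) \<le> A"
    for u A N s
  proof -
    have "ennreal (s * s) \<le> ennreal (s0 * s0)" using u by (intro ennreal_leI mult_mono) auto
    then have "approximable u (real (Suc K) * A)" by (intro ap[OF u(1,2,3) _ fd] order.trans[OF u(6)])
    then obtain g S where g: "null g" "S \<in> sets borel" "emeasure lborel S \<le> ennreal e0"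
      "\<And>x. x \<in> U - S \<Longrightarrow> norm (u x - g x) \<le> real (Suc K) * A"
      unfolding approximable_def by blast
    have "norm (u x - g x) \<le> A + 2 ^ m * (real (Suc K) * A)" if x: "x \<in> good N s" for x
    proof (rule bootstrap_good[OF u(2,4) _ x g(2,3), of _ "\<lambda>x. u x - g x"])
      show "s \<le> e0" using u(5) s0(2) by linarith
      show "norm (fdiff m (\<lambda>j. u (node \<tau> x b j) - g (node \<tau> x b j))) \<le> A"
        if "x \<in> U" "b \<in> U" "(x, b) \<notin> N" for x b
        using fd g(1) that by (simp add: fdiff_diff null_def)
      show "norm (u y - g y) \<le> real (Suc K) * A" if "y \<in> U" "y \<notin> S" for y using g(4) that by blast
      show "0 \<le> real (Suc K) * A" using u(3) by simp
    qed
    then have "\<forall>x\<in>good N s. norm (u x - g x) \<le> C * A" by (simp add: C_def algebra_simps)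
    with g(1) show ?thesis by blast
  qed
  moreover have "0 < C" by (auto simp: C_def intro: add_pos_nonneg)
  ultimately show ?thesis using s0 by blast
qed

lemma null_limit:
  assumes g: "\<And>n. null (gs n)" and D: "\<And>n l x. x \<in> U \<Longrightarrow> n \<le> l \<Longrightarrow> norm (gs n x - gs l x) \<le> D / real (Suc n)"
  obtains g where "null g" "\<And>n x. x \<in> U \<Longrightarrow> norm (gs n x - g x) \<le> D / real (Suc n)"
proof -
  have lim0: "(\<lambda>n. D / real (Suc n)) \<longlonglongrightarrow> 0"
    using tendsto_mult_right_zero[OF LIMSEQ_inverse_real_of_nat, of D] by (simp add: field_simps)
  have small: "\<exists>M. \<forall>n\<ge>M. D / real (Suc n) < e" if "0 < e" for e
    using order_tendstoD(2)[OF lim0 that] by (simp add: eventually_sequentially)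
  have "convergent (\<lambda>n. gs n x)" if x: "x \<in> U" for x
    unfolding Cauchy_convergent_iff[symmetric]
  proof (rule CauchyI')
    fix e :: real assume "0 < e"
    then obtain M where "\<And>n. n \<ge> M \<Longrightarrow> D / real (Suc n) < e" using small by blast
    then have "\<forall>m\<ge>M. \<forall>n>m. dist (gs m x) (gs n x) < e"
      using D[OF x less_imp_le] unfolding dist_norm by (meson le_less_trans)
    then show "\<exists>M. \<forall>m\<ge>M. \<forall>n>m. dist (gs m x) (gs n x) < e" by blast
  qed
  then have "\<forall>x. \<exists>l. x \<in> U \<longrightarrow> (\<lambda>n. gs n x) \<longlonglongrightarrow> l" by (auto simp: convergent_def)
  then obtain g where lim: "\<And>x. x \<in> U \<Longrightarrow> (\<lambda>n. gs n x) \<longlonglongrightarrow> g x" by metis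
  have le: "norm (gs n x - g x) \<le> D / real (Suc n)" if x: "x \<in> U" for n x
  proof (rule tendsto_upperbound)
    show "(\<lambda>l. norm (gs n x - gs l x)) \<longlonglongrightarrow> norm (gs n x - g x)"
      by (intro tendsto_intros lim x)
    show "\<forall>\<^sub>F l in sequentially. norm (gs n x - gs l x) \<le> D / real (Suc n)"
      using eventually_ge_at_top[of n] by eventually_elim (rule D[OF x])
  qed simp
  have "uniform_limit U gs g sequentially"
  proof (rule uniform_limitI)
    fix e :: real assume "0 < e"
    from order_tendstoD(2)[OF lim0 this]
    show "\<forall>\<^sub>F n in sequentially. \<forall>x\<in>U. dist (gs n x) (g x) < e"
      by eventually_elim (use le in \<open>auto simp: dist_norm intro: le_less_trans\<close>)
  qed
  then have "continuous_on U g"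
    by (rule uniform_limit_theorem[rotated]) (use g in \<open>auto simp: null_def\<close>)
  moreover have "fdiff m (\<lambda>j. g (node \<tau> x b j)) = 0" if xb: "x \<in> U" "b \<in> U" for x b
  proof (rule LIMSEQ_unique)
    show "(\<lambda>n. fdiff m (\<lambda>j. gs n (node \<tau> x b j))) \<longlonglongrightarrow> fdiff m (\<lambda>j. g (node \<tau> x b j))"
      unfolding fdiff_def by (intro tendsto_intros lim node_in_U[OF xb]) auto
    show "(\<lambda>n. fdiff m (\<lambda>j. gs n (node \<tau> x b j))) \<longlonglongrightarrow> 0"
      using g xb by (simp add: null_def)
  qed
  ultimately have "null g" by (simp add: null_def)
  then show ?thesis using le that by blast
qed

text \<open>The normalization in the compactness argument needs \<open>A > 0\<close>. For \<open>A = 0\<close> the approximants for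
  \<open>A = 1 / n\<close> form a uniform Cauchy sequence: their differences are small on the good set, hence on
  all of \<open>U\<close> by the bootstrap.\<close>

lemma near_null:
  "\<exists>C > 0. \<exists>s0 > 0. \<forall>u A N s. u \<in> borel_measurable borel \<longrightarrow> N \<in> sets borel \<longrightarrow> 0 \<le> A \<longrightarrow>
     0 < s \<longrightarrow> s \<le> s0 \<longrightarrow> emeasure lborel N \<le> ennreal (s * s) \<longrightarrow>
     (\<forall>x\<in>U. \<forall>b\<in>U. (x, b) \<notin> N \<longrightarrow> norm (fdiff m (\<lambda>j. u (node \<tau> x b j))) \<le> A) \<longrightarrow>
     (\<exists>g. null g \<and> (\<forall>x\<in>good N s. norm (u x - g x) \<le> C * A))"
proof -
  obtain C s0 where C: "0 < C" and s0: "0 < s0" "s0 \<le> e0" and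
    pos: "\<And>u A N s. u \<in> borel_measurable borel \<Longrightarrow> N \<in> sets borel \<Longrightarrow> 0 < A \<Longrightarrow>
     0 < s \<Longrightarrow> s \<le> s0 \<Longrightarrow> emeasure lborel N \<le> ennreal (s * s) \<Longrightarrow>
     \<forall>x\<in>U. \<forall>b\<in>U. (x, b) \<notin> N \<longrightarrow> norm (fdiff m (\<lambda>j. u (node \<tau> x b j))) \<le> A \<Longrightarrow>
     \<exists>g. null g \<and> (\<forall>x\<in>good N s. norm (u x - g x) \<le> C * A)"
    using near_null_pos by blast
  have "\<exists>g. null g \<and> (\<forall>x\<in>good N s. norm (u x - g x) \<le> C * A)"
    if u: "u \<in> borel_measurable borel" "N \<in> sets borel" "0 \<le> A" "0 < s" "s \<le> s0"
      "emeasure lborel N \<le> ennreal (s * s)"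
      and fd: "\<forall>x\<in>U. \<forall>b\<in>U. (x, b) \<notin> N \<longrightarrow> norm (fdiff m (\<lambda>j. u (node \<tau> x b j))) \<le> A"
    for u A N s
  proof (cases "A = 0")
    case False
    then show ?thesis using u fd by (intro pos) auto
  next
    case True
    have "\<exists>g. null g \<and> (\<forall>x\<in>good N s. norm (u x - g x) \<le> C * (1 / real (Suc n)))" for n
    proof (rule pos[OF u(1,2) _ u(4-6)])
      show "\<forall>x\<in>U. \<forall>b\<in>U. (x, b) \<notin> N \<longrightarrow> norm (fdiff m (\<lambda>j. u (node \<tau> x b j))) \<le> 1 / real (Suc n)"
        using fd True by (auto intro: order.trans)
    qed simp
    then obtain gs where gs: "\<And>n. null (gs n)"
      "\<And>n x. x \<in> good N s \<Longrightarrow> norm (u x - gs n x) \<le> C * (1 / real (Suc n))"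
      by metis
    have G: "good N s \<in> sets borel" "emeasure lborel (U - good N s) \<le> ennreal s"
      by (rule good_measurable[OF u(2,4,6)])+
    have ee: "ennreal s \<le> ennreal e0" using u(5) s0(2) by (intro ennreal_leI) auto
    define D where "D = 2 ^ m * (2 * C)"
    have dist: "norm (gs n x - gs l x) \<le> D / real (Suc n)" if x: "x \<in> U" and nl: "n \<le> l" for n l x
    proof -
      have "norm (gs n x - gs l x) \<le> 0 + 2 ^ m * (2 * C / real (Suc n))"
      proof (rule bootstrap[where S = "U - good N s" and T = "{}" and u = "\<lambda>x. gs n x - gs l x"])
        show "norm (fdiff m (\<lambda>j. gs n (node \<tau> x b j) - gs l (node \<tau> x b j))) \<le> 0" if "b \<in> U" for b
          using gs(1) x that by (simp add: fdiff_diff null_def)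
        show "norm (gs n y - gs l y) \<le> 2 * C / real (Suc n)" if "y \<in> U" "y \<notin> U - good N s" for y
        proof -
          have y: "y \<in> good N s" using that by blast
          have "C * (1 / real (Suc l)) \<le> C * (1 / real (Suc n))"
            using nl C by (intro mult_left_mono) (auto simp: frac_le)
          then have "norm (u y - gs l y) + norm (u y - gs n y) \<le> 2 * (C * (1 / real (Suc n)))"
            using gs(2)[OF y, of l] gs(2)[OF y, of n] by linarith
          then show ?thesis using norm_triangle_ineq4[of "u y - gs l y" "u y - gs n y"] by simp
        qed
      qed (use G ee x C in auto)
      then show ?thesis by (simp add: D_def)
    qed
    obtain g where g: "null g" "\<And>n x. x \<in> U \<Longrightarrow> norm (gs n x - g x) \<le> D / real (Suc n)"
      using null_limit[OF gs(1) dist] by blast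
    have "norm (u x - g x) \<le> C * A" if x: "x \<in> good N s" for x
    proof -
      have xU: "x \<in> U" using x good_subset by blast
      have "norm (u x - g x) \<le> (C + D) / real (Suc n)" for n
        using norm_triangle_ineq[of "u x - gs n x" "gs n x - g x"] gs(2)[OF x, of n] g(2)[OF xU, of n]
        by (simp add: add_divide_distrib)
      moreover have "(\<lambda>n. (C + D) / real (Suc n)) \<longlonglongrightarrow> 0"
        using tendsto_mult_right_zero[OF LIMSEQ_inverse_real_of_nat, of "C + D"] by (simp add: field_simps)
      ultimately have "norm (u x - g x) \<le> 0" by (intro LIMSEQ_le_const) auto
      then show ?thesis using True by simp
    qed
    with g(1) show ?thesis by blast
  qed
  then show ?thesis using C s0(1) by blast
qed

section \<open>Averaging the exceptional set over shifts\<close>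

lemma nn_integral_lborel_affine:
  fixes f :: "'a \<Rightarrow> ennreal" and t :: 'a
  assumes [measurable]: "f \<in> borel_measurable borel" and "c \<noteq> 0"
  shows "(\<integral>\<^sup>+x. f x \<partial>lborel) = ennreal (\<bar>c\<bar> ^ DIM('a)) * (\<integral>\<^sup>+x. f (t + c *\<^sub>R x) \<partial>lborel)"
  by (subst lborel_affine[OF assms(2), of t])
     (simp add: nn_integral_density nn_integral_distr nn_integral_cmult)

text \<open>Integration over \<open>h\<close> removes the shift by translation invariance, whatever
  \<theta> is. Passing from \<open>x\<close> to the node scales by
  \<open>1 - j * \<tau> \<ge> 1 / 2\<close>, which costs at most \<open>2 ^ DIM('a)\<close>, and
  \<open>b\<close> contributes the measure of \<open>U\<close>. The values
  \<open>\<theta> = \<tau>\<close> and \<open>\<theta> = 0\<close> cover the two comparisons made at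
  each step.\<close>

lemma average_bad:
  fixes E :: "('a \<times> 'a) set"
  assumes [measurable]: "E \<in> sets borel" and j: "j \<le> m"
  shows "(\<integral>\<^sup>+h. \<integral>\<^sup>+b. \<integral>\<^sup>+x. indicator U b * indicator E (node \<tau> x b j, h + \<theta> *\<^sub>R (b - x)) \<partial>lborel \<partial>lborel \<partial>lborel)
     \<le> emeasure lborel U * (ennreal (2 ^ DIM('a)) * emeasure lborel E)"
proof -
  have E: "E \<in> sets (lborel \<Otimes>\<^sub>M lborel)" using assms(1) by (metis lborel_prod sets_lborel)
  define e where "e y = emeasure lborel (Pair y -` E)" for y
  have e[measurable]: "e \<in> borel_measurable borel"
    unfolding e_def using lborel.measurable_emeasure_Pair[OF E] by simp
  have e_int: "(\<integral>\<^sup>+y. e y \<partial>lborel) = emeasure lborel E"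
    using lborel.emeasure_pair_measure_alt[OF E] by (simp add: lborel_prod e_def)
  have e_eq: "(\<integral>\<^sup>+h. indicator E (y, h + z) \<partial>lborel) = e y" for y z
  proof -
    have [measurable]: "(\<lambda>h. indicator E (y, h)) \<in> borel_measurable borel" by measurable
    have "(\<integral>\<^sup>+h. indicator E (y, h) \<partial>lborel) = (\<integral>\<^sup>+h. indicator E (y, z + 1 *\<^sub>R h) \<partial>lborel)"
      by (subst nn_integral_lborel_affine[of _ 1 z]) auto
    also have "(\<integral>\<^sup>+h. indicator E (y, h) \<partial>lborel) = (\<integral>\<^sup>+h. indicator (Pair y -` E) h \<partial>lborel)"
      by (intro nn_integral_cong) (auto simp: indicator_def)
    also have "\<dots> = e y" unfolding e_def using slice_measurable[OF assms(1)] by simp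
    finally show ?thesis by (simp add: add.commute)
  qed
  define c where "c = 1 - real j * \<tau>"
  have c: "1 / 2 \<le> c" using step_bounds[OF j] by (simp add: c_def)
  have x_int: "(\<integral>\<^sup>+x. e (node \<tau> x b j) \<partial>lborel) \<le> ennreal (2 ^ DIM('a)) * emeasure lborel E" for b
  proof -
    have "(\<integral>\<^sup>+y. e y \<partial>lborel) = ennreal (\<bar>c\<bar> ^ DIM('a)) * (\<integral>\<^sup>+x. e ((real j * \<tau>) *\<^sub>R b + c *\<^sub>R x) \<partial>lborel)"
      using c by (intro nn_integral_lborel_affine) auto
    also have "(\<integral>\<^sup>+x. e ((real j * \<tau>) *\<^sub>R b + c *\<^sub>R x) \<partial>lborel) = (\<integral>\<^sup>+x. e (node \<tau> x b j) \<partial>lborel)"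
      by (simp add: node_eq c_def add.commute)
    finally have "ennreal (2 ^ DIM('a)) * emeasure lborel E =
        ennreal (2 ^ DIM('a)) * ennreal (\<bar>c\<bar> ^ DIM('a)) * (\<integral>\<^sup>+x. e (node \<tau> x b j) \<partial>lborel)"
      by (simp add: e_int mult.assoc)
    also have "ennreal (2 ^ DIM('a)) * ennreal (\<bar>c\<bar> ^ DIM('a)) = ennreal ((2 * c) ^ DIM('a))"
      using c by (simp add: power_mult_distrib ennreal_mult)
    finally have eq: "ennreal (2 ^ DIM('a)) * emeasure lborel E = ennreal ((2 * c) ^ DIM('a)) * (\<integral>\<^sup>+x. e (node \<tau> x b j) \<partial>lborel)" .
    have "1 * (\<integral>\<^sup>+x. e (node \<tau> x b j) \<partial>lborel) \<le> ennreal ((2 * c) ^ DIM('a)) * (\<integral>\<^sup>+x. e (node \<tau> x b j) \<partial>lborel)"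
    proof (rule mult_right_mono)
      have "1 \<le> (2 * c) ^ DIM('a)" using c by (intro one_le_power) simp
      then show "1 \<le> ennreal ((2 * c) ^ DIM('a))" by (simp only: ennreal_leI flip: ennreal_1)
    qed simp
    then show ?thesis by (simp add: eq)
  qed
  have M[measurable]: "(\<lambda>(h, b, x). indicator U b * indicator E (node \<tau> x b j, h + \<theta> *\<^sub>R (b - x)) :: ennreal) \<in> borel_measurable (borel \<Otimes>\<^sub>M borel \<Otimes>\<^sub>M borel)"
    unfolding node_def by measurable
  have "(\<integral>\<^sup>+h. \<integral>\<^sup>+b. \<integral>\<^sup>+x. indicator U b * indicator E (node \<tau> x b j, h + \<theta> *\<^sub>R (b - x)) \<partial>lborel \<partial>lborel \<partial>lborel)
      = (\<integral>\<^sup>+b. \<integral>\<^sup>+h. \<integral>\<^sup>+x. indicator U b * indicator E (node \<tau> x b j, h + \<theta> *\<^sub>R (b - x)) \<partial>lborel \<partial>lborel \<partial>lborel)"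
    unfolding node_def by (rule lborel_pair.Fubini') measurable
  also have "\<dots> = (\<integral>\<^sup>+b. \<integral>\<^sup>+x. \<integral>\<^sup>+h. indicator U b * indicator E (node \<tau> x b j, h + \<theta> *\<^sub>R (b - x)) \<partial>lborel \<partial>lborel \<partial>lborel)"
    unfolding node_def by (intro nn_integral_cong lborel_pair.Fubini') measurable
  also have "\<dots> = (\<integral>\<^sup>+b. indicator U b * (\<integral>\<^sup>+x. e (node \<tau> x b j) \<partial>lborel) \<partial>lborel)"
  proof -
    have "(\<integral>\<^sup>+x. \<integral>\<^sup>+h. indicator U b * indicator E (node \<tau> x b j, h + \<theta> *\<^sub>R (b - x)) \<partial>lborel \<partial>lborel)
      = indicator U b * (\<integral>\<^sup>+x. e (node \<tau> x b j) \<partial>lborel)" for b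
    proof -
      have [measurable]: "(\<lambda>x. node \<tau> x b j) \<in> borel_measurable borel" unfolding node_def by measurable
      have "(\<integral>\<^sup>+h. indicator U b * indicator E (node \<tau> x b j, h + \<theta> *\<^sub>R (b - x)) \<partial>lborel) = indicator U b * e (node \<tau> x b j)" for x
        by (subst nn_integral_cmult) (auto simp: e_eq)
      then show ?thesis by (simp add: nn_integral_cmult)
    qed
    then show ?thesis by simp
  qed
  also have "\<dots> \<le> (\<integral>\<^sup>+b. (ennreal (2 ^ DIM('a)) * emeasure lborel E) * indicator U b \<partial>lborel)"
    using x_int by (intro nn_integral_mono) (auto simp: indicator_def)
  also have "\<dots> = (ennreal (2 ^ DIM('a)) * emeasure lborel E) * emeasure lborel U"
    by (subst nn_integral_cmult_indicator) auto
  finally show ?thesis by (simp add: mult.commute)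
qed

end

section \<open>Eliminating the polynomials\<close>

context differences
begin

text \<open>The shift \<open>h\<close> is chosen by averaging over the half ball, so that \<open>h\<close> and \<open>h + k\<close> both stay in
  the ball of radius \<open>\<sigma>\<close>. Small shifts alone would not do: for large \<open>\<sigma>\<close> they may all be exceptional.\<close>

lemma good_shift:
  fixes E :: "('a \<times> 'a) set" and \<Phi> :: "'a \<Rightarrow> complex" and R :: "'a \<Rightarrow> 'a \<Rightarrow> complex" and \<sigma> \<epsilon> A :: real
  assumes E[measurable]: "E \<in> sets borel" and \<epsilon>: "emeasure lborel E \<le> ennreal \<epsilon>" "0 < \<epsilon>" and \<sigma>: "4 * \<tau> \<le> \<sigma>"
    and close: "\<And>y l. y \<in> U \<Longrightarrow> l \<in> ball 0 \<sigma> \<Longrightarrow> (y, l) \<notin> E \<Longrightarrow> norm (\<Phi> (y + l) - \<Phi> y - R l y) \<le> A"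
    and poly: "\<And>l x b k. l \<in> ball 0 \<sigma> \<Longrightarrow> x \<in> U \<Longrightarrow> b \<in> U \<Longrightarrow> k \<le> 1 \<Longrightarrow>
       fdiff (m - 1) (\<lambda>i. R l (node \<tau> x b (i + k))) = 0"
  shows "\<exists>N\<in>sets borel. emeasure lborel N \<le>
      ennreal (4 * real m * (2 ^ DIM('a) * measure lborel U * \<epsilon>) / measure lborel (ball 0 (\<sigma> / 2) :: 'a set)) \<and>
      (\<forall>x\<in>U. \<forall>b\<in>U. (x, b) \<notin> N \<longrightarrow> norm (fdiff m (\<lambda>j. \<Phi> (node \<tau> x b j))) \<le> 2 ^ m * A)"
proof -
  define V where "V = (ball 0 (\<sigma> / 2) :: 'a set)"
  have \<sigma>0: "0 < \<sigma>" using \<sigma> \<tau>(1) by linarith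
  define Y where "Y = 2 ^ DIM('a) * measure lborel U * \<epsilon>"
  have Y: "0 < Y" using measure_U_pos \<epsilon>(2) by (simp add: Y_def)
  \<comment> \<open>Twice the bound for the mean over \<open>V\<close> of \<open>2 * m\<close> terms
    with integral at most \<open>Y\<close>; the extra factor 2 turns the averaging into a strict
    contradiction.\<close>
  define X where "X = 4 * real m * Y / measure lborel V"
  have V: "V \<in> sets borel" "0 < measure lborel V"
    using \<sigma>0 by (auto simp: V_def content_ball_pos)
  have emV: "emeasure lborel V = ennreal (measure lborel V)"
    unfolding V_def by (intro emeasure_eq_ennreal_measure)
      (use emeasure_lborel_ball_finite[of 0 "\<sigma> / 2"] in \<open>auto simp: less_top\<close>)
  define T where "T \<theta> j h = (\<integral>\<^sup>+b. \<integral>\<^sup>+x. indicator U b * indicator E (node \<tau> x b j, h + \<theta> *\<^sub>R (b - x)) \<partial>lborel \<partial>lborel)"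
    for \<theta> :: real and j and h :: 'a
  have Tm[measurable]: "T \<theta> j \<in> borel_measurable borel" for \<theta> j
    unfolding T_def node_def by measurable
  have Tint: "(\<integral>\<^sup>+h. T \<theta> j h \<partial>lborel) \<le> ennreal Y" if "j \<le> m" for \<theta> j
  proof -
    have "(\<integral>\<^sup>+h. T \<theta> j h \<partial>lborel) \<le> emeasure lborel U * (ennreal (2 ^ DIM('a)) * emeasure lborel E)"
      unfolding T_def by (rule average_bad[OF E that])
    also have "\<dots> \<le> ennreal (measure lborel U) * (ennreal (2 ^ DIM('a)) * ennreal \<epsilon>)"
      unfolding emeasure_U by (intro mult_left_mono \<epsilon>) auto
    also have "\<dots> = ennreal Y"
      using \<epsilon>(2) by (simp add: Y_def ennreal_mult mult_ac)
    finally show ?thesis .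
  qed
  \<comment> \<open>The pairs for which, at shift \<open>h\<close>, one of the \<open>2 * m\<close>
    comparisons falls into the exceptional set.\<close>
  define N where "N h = {p. fst p \<in> U \<and> snd p \<in> U \<and>
      (\<exists>i<m. (node \<tau> (fst p) (snd p) i, h + \<tau> *\<^sub>R (snd p - fst p)) \<in> E \<or> (node \<tau> (fst p) (snd p) (Suc i), h) \<in> E)}" for h
  have Nm: "N h \<in> sets borel" for h
  proof -
    have "N h = {p \<in> space (borel \<Otimes>\<^sub>M borel). fst p \<in> U \<and> snd p \<in> U \<and>
      (\<exists>i<m. (node \<tau> (fst p) (snd p) i, h + \<tau> *\<^sub>R (snd p - fst p)) \<in> E \<or> (node \<tau> (fst p) (snd p) (Suc i), h) \<in> E)}"
      by (simp add: N_def space_pair_measure)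
    also have "\<dots> \<in> sets (borel \<Otimes>\<^sub>M borel)" unfolding node_def by measurable
    finally show ?thesis by (simp only: borel_prod)
  qed
  have NT: "emeasure lborel (N h) \<le> (\<Sum>i<m. T \<tau> i h + T 0 (Suc i) h)" for h
  proof -
    have [measurable]: "N h \<in> sets borel" by (rule Nm)
    have "emeasure lborel (N h) = (\<integral>\<^sup>+p. indicator (N h) p \<partial>(lborel \<Otimes>\<^sub>M lborel))"
      by (simp add: lborel_prod)
    also have "\<dots> = (\<integral>\<^sup>+b. \<integral>\<^sup>+x. indicator (N h) (x, b) \<partial>lborel \<partial>lborel)"
      by (rule lborel_pair.nn_integral_snd [symmetric]) (simp add: lborel_prod)
    also have "\<dots> \<le> (\<integral>\<^sup>+b. \<integral>\<^sup>+x. (\<Sum>i<m. indicator U b * indicator E (node \<tau> x b i, h + \<tau> *\<^sub>R (b - x))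
        + indicator U b * indicator E (node \<tau> x b (Suc i), h + 0 *\<^sub>R (b - x))) \<partial>lborel \<partial>lborel)"
    proof (intro nn_integral_mono)
      fix b x
      let ?t = "\<lambda>i. indicator U b * indicator E (node \<tau> x b i, h + \<tau> *\<^sub>R (b - x))
        + indicator U b * indicator E (node \<tau> x b (Suc i), h + 0 *\<^sub>R (b - x)) :: ennreal"
      show "indicator (N h) (x, b) \<le> (\<Sum>i<m. ?t i)"
      proof (cases "(x, b) \<in> N h")
        case True
        then obtain i where i: "i < m" "b \<in> U"
          "(node \<tau> x b i, h + \<tau> *\<^sub>R (b - x)) \<in> E \<or> (node \<tau> x b (Suc i), h) \<in> E"
          by (auto simp: N_def)
        then have "1 \<le> ?t i" by (auto simp: indicator_def)
        also have "?t i \<le> (\<Sum>i<m. ?t i)" using i(1) by (intro member_le_sum) auto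
        finally show ?thesis using True by simp
      qed simp
    qed
    also have "\<dots> = (\<Sum>i<m. T \<tau> i h + T 0 (Suc i) h)"
      unfolding T_def node_def by (simp add: nn_integral_sum nn_integral_add)
    finally show ?thesis .
  qed
  have "\<exists>h\<in>V. emeasure lborel (N h) \<le> ennreal X"
  proof (rule ccontr)
    assume "\<not> ?thesis"
    then have big: "ennreal X \<le> emeasure lborel (N h)" if "h \<in> V" for h using that by force
    have "ennreal X * emeasure lborel V = (\<integral>\<^sup>+h. ennreal X * indicator V h \<partial>lborel)"
      using V by (simp add: nn_integral_cmult_indicator)
    also have "\<dots> \<le> (\<integral>\<^sup>+h. (\<Sum>i<m. T \<tau> i h + T 0 (Suc i) h) \<partial>lborel)"
    proof (rule nn_integral_mono)
      fix h
      show "ennreal X * indicator V h \<le> (\<Sum>i<m. T \<tau> i h + T 0 (Suc i) h)"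
        using order.trans[OF big NT, of h] by (cases "h \<in> V") auto
    qed
    also have "\<dots> = (\<Sum>i<m. (\<integral>\<^sup>+h. T \<tau> i h \<partial>lborel) + (\<integral>\<^sup>+h. T 0 (Suc i) h \<partial>lborel))"
      by (simp add: nn_integral_sum nn_integral_add)
    also have "\<dots> \<le> (\<Sum>i<m. ennreal Y + ennreal Y)"
      by (intro sum_mono add_mono Tint) auto
    also have "\<dots> = ennreal (real m * (Y + Y))"
      using Y by (simp add: ennreal_of_nat_eq_real_of_nat ennreal_mult flip: ennreal_plus)
    finally have "ennreal (X * measure lborel V) \<le> ennreal (real m * (Y + Y))"
      using Y V unfolding emV by (simp add: X_def flip: ennreal_mult)
    then have "X * measure lborel V \<le> real m * (Y + Y)"
      using Y by (simp add: ennreal_le_iff)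
    then have "4 * (real m * Y) \<le> 2 * (real m * Y)" using V by (simp add: X_def algebra_simps)
    moreover have "0 < real m * Y" using m Y by simp
    ultimately show False by linarith
  qed
  then obtain h where h: "h \<in> V" "emeasure lborel (N h) \<le> ennreal X" by blast
  have "norm (fdiff m (\<lambda>j. \<Phi> (node \<tau> x b j))) \<le> 2 ^ m * A"
    if xb: "x \<in> U" "b \<in> U" "(x, b) \<notin> N h" for x b
  proof -
    define k where "k = \<tau> *\<^sub>R (b - x)"
    define p where "p j = node \<tau> x b j" for j
    have pSuc: "p (Suc i) = p i + k" for i by (simp add: p_def k_def node_def algebra_simps)
    have "norm (b - x) < 2" using xb norm_triangle_ineq4[of b x] by (simp add: U)
    then have "norm k < 2 * \<tau>" using \<tau>(1) by (simp add: k_def)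
    moreover have "norm (h + k) \<le> norm h + norm k" by (rule norm_triangle_ineq)
    moreover have "norm h < \<sigma> / 2" using h(1) by (simp add: V_def)
    ultimately have hb: "h \<in> ball 0 \<sigma>" "h + k \<in> ball 0 \<sigma>" using \<sigma> \<sigma>0 by simp_all
    have mm: "m = Suc (m - 1)" using m by simp
    have pU: "p i \<in> U" if "i \<le> m" for i using node_in_U[OF xb(1,2) that] by (simp add: p_def)
    \<comment> \<open>Both comparisons evaluate \<Phi> at \<open>p (Suc i) + h\<close>. As
      \<open>k\<close> is the same for all \<open>i\<close>, only the two polynomials
      \<open>R (h + k)\<close> and \<open>R h\<close> occur along the whole segment, and
      \<open>m - 1\<close> further differences remove both.\<close>
    have bound: "norm ((\<Phi> (p (Suc i)) - \<Phi> (p i)) - (R (h + k) (p i) - R h (p (Suc i)))) \<le> 2 * A" if "i < m" for i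
    proof -
      have nE: "(p i, h + k) \<notin> E" "(p (Suc i), h) \<notin> E"
        using xb that by (auto simp: N_def p_def k_def)
      have "norm (\<Phi> (p i + (h + k)) - \<Phi> (p i) - R (h + k) (p i)) \<le> A"
        using that by (intro close pU hb nE) auto
      moreover have "norm (\<Phi> (p (Suc i) + h) - \<Phi> (p (Suc i)) - R h (p (Suc i))) \<le> A"
        using that by (intro close pU hb nE) auto
      moreover have "p (Suc i) + h = p i + (h + k)" by (simp add: pSuc)
      ultimately show ?thesis
        using norm_triangle_ineq4[of "\<Phi> (p i + (h + k)) - \<Phi> (p i) - R (h + k) (p i)"
            "\<Phi> (p (Suc i) + h) - \<Phi> (p (Suc i)) - R h (p (Suc i))"] by (simp add: algebra_simps)
    qed
    have R0: "fdiff (m - 1) (\<lambda>i. R (h + k) (p i)) = 0" "fdiff (m - 1) (\<lambda>i. R h (p (Suc i))) = 0"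
      using poly[OF hb(2) xb(1,2), of 0] poly[OF hb(1) xb(1,2), of 1] by (simp_all add: p_def)
    have "fdiff m (\<lambda>j. \<Phi> (p j)) = - fdiff (m - 1) (\<lambda>i. \<Phi> (p (Suc i)) - \<Phi> (p i))"
      by (subst mm) (simp add: fdiff_Suc fdiff_diff)
    also have "\<dots> = - fdiff (m - 1) (\<lambda>i. (\<Phi> (p (Suc i)) - \<Phi> (p i)) - (R (h + k) (p i) - R h (p (Suc i))))"
      by (simp only: fdiff_diff R0 diff_zero)
    finally have "norm (fdiff m (\<lambda>j. \<Phi> (p j))) =
      norm (fdiff (m - 1) (\<lambda>i. (\<Phi> (p (Suc i)) - \<Phi> (p i)) - (R (h + k) (p i) - R h (p (Suc i)))))"
      by simp
    also have "\<dots> \<le> 2 ^ (m - 1) * (2 * A)"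
      using m by (intro norm_fdiff_le bound) auto
    also have "\<dots> = 2 ^ m * A" by (subst (2) mm) simp
    finally show ?thesis by (simp add: p_def)
  qed
  with h(2) Nm show ?thesis unfolding X_def Y_def V_def by blast
qed

section \<open>Null sets and Borel representatives\<close>

lemma node_vimage_null:
  assumes Z: "Z \<in> sets borel" "emeasure lborel Z = 0" and j: "j \<le> m"
  shows "{p. node \<tau> (fst p) (snd p) j \<in> Z} \<in> null_sets (lborel :: ('a \<times> 'a) measure)"
proof
  have [measurable]: "Z \<in> sets borel" by fact
  let ?P = "{p. node \<tau> (fst p) (snd p) j \<in> Z}"
  have "?P = {p \<in> space (borel \<Otimes>\<^sub>M borel). node \<tau> (fst p) (snd p) j \<in> Z}"
    by (simp add: space_pair_measure)
  also have "\<dots> \<in> sets (borel \<Otimes>\<^sub>M borel)" unfolding node_def by measurable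
  finally show P: "?P \<in> sets lborel" by (simp only: borel_prod sets_lborel)
  then have P': "?P \<in> sets (lborel \<Otimes>\<^sub>M lborel)" by (simp only: lborel_prod)
  \<comment> \<open>Slices at fixed \<open>b\<close>, because the coefficient
    \<open>1 - j * \<tau>\<close> of \<open>x\<close> never vanishes, while the coefficient of
    \<open>b\<close> does for \<open>j = 0\<close>.\<close>
  have "emeasure lborel ?P = (\<integral>\<^sup>+b. emeasure lborel ((\<lambda>x. (x, b)) -` ?P) \<partial>lborel)"
    using lborel_pair.emeasure_pair_measure_alt2[OF P'] by (simp only: lborel_prod)
  also have "\<dots> = (\<integral>\<^sup>+b. 0 \<partial>(lborel :: 'a measure))"
  proof (rule nn_integral_cong)
    fix b :: 'a
    have "(\<lambda>x. (x, b)) -` ?P = (\<lambda>x. (real j * \<tau>) *\<^sub>R b + (1 - real j * \<tau>) *\<^sub>R x) -` Z"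
      by (auto simp: node_eq add.commute)
    then show "emeasure lborel ((\<lambda>x. (x, b)) -` ?P) = 0"
      using emeasure_lborel_affine_vimage[OF Z(1), of "1 - real j * \<tau>"] step_bounds[OF j] Z(2) by simp
  qed
  finally show "emeasure lborel ?P = 0" by simp
qed

text \<open>\<Phi> agrees with a Borel function only off the null set \<open>Z\<close>. The pairs
  with some node in \<open>Z\<close> form a null set, which is absorbed into \<open>N\<close>
  without changing \<open>s\<close>.\<close>

lemma near_null_ae:
  "\<exists>C > 0. \<exists>s0 > 0. \<forall>\<Phi> u Z N A s. u \<in> borel_measurable borel \<longrightarrow> Z \<in> sets borel \<longrightarrow> emeasure lborel Z = 0 \<longrightarrow>
     (\<forall>x\<in>U - Z. \<Phi> x = u x) \<longrightarrow> N \<in> sets borel \<longrightarrow> 0 \<le> A \<longrightarrow>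
     0 < s \<longrightarrow> s \<le> s0 \<longrightarrow> emeasure lborel N \<le> ennreal (s * s) \<longrightarrow>
     (\<forall>x\<in>U. \<forall>b\<in>U. (x, b) \<notin> N \<longrightarrow> norm (fdiff m (\<lambda>j. \<Phi> (node \<tau> x b j))) \<le> A) \<longrightarrow>
     (\<exists>g. null g \<and> (\<exists>F\<in>sets borel. emeasure lborel F \<le> ennreal s \<and> (\<forall>x\<in>U - F. norm (\<Phi> x - g x) \<le> C * A)))"
proof -
  obtain C s0 where C: "0 < C" and s0: "0 < s0" and
    near: "\<And>u A N s. u \<in> borel_measurable borel \<Longrightarrow> N \<in> sets borel \<Longrightarrow> 0 \<le> A \<Longrightarrow>
     0 < s \<Longrightarrow> s \<le> s0 \<Longrightarrow> emeasure lborel N \<le> ennreal (s * s) \<Longrightarrow>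
     \<forall>x\<in>U. \<forall>b\<in>U. (x, b) \<notin> N \<longrightarrow> norm (fdiff m (\<lambda>j. u (node \<tau> x b j))) \<le> A \<Longrightarrow>
     \<exists>g. null g \<and> (\<forall>x\<in>good N s. norm (u x - g x) \<le> C * A)"
    using near_null by blast
  have "\<exists>g. null g \<and> (\<exists>F\<in>sets borel. emeasure lborel F \<le> ennreal s \<and> (\<forall>x\<in>U - F. norm (\<Phi> x - g x) \<le> C * A))"
    if u: "u \<in> borel_measurable borel" and Z: "Z \<in> sets borel" "emeasure lborel Z = 0"
     and \<Phi>u: "\<forall>x\<in>U - Z. \<Phi> x = u x" and N: "N \<in> sets borel" and A: "0 \<le> A"
     and s: "0 < s" "s \<le> s0" and Ns: "emeasure lborel N \<le> ennreal (s * s)"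
     and fd: "\<forall>x\<in>U. \<forall>b\<in>U. (x, b) \<notin> N \<longrightarrow> norm (fdiff m (\<lambda>j. \<Phi> (node \<tau> x b j))) \<le> A"
    for \<Phi> u Z N A s
  proof -
    define N' where "N' = N \<union> (\<Union>j\<in>{..m}. {p. node \<tau> (fst p) (snd p) j \<in> Z})"
    have nz: "(\<Union>j\<in>{..m}. {p. node \<tau> (fst p) (snd p) j \<in> Z}) \<in> null_sets (lborel :: ('a \<times> 'a) measure)"
      by (intro null_sets_UN' node_vimage_null[OF Z]) auto
    have N': "N' \<in> sets borel" "emeasure lborel N' \<le> ennreal (s * s)"
      using N nz Ns by (auto simp: N'_def emeasure_Un_null_set)
    have "\<forall>x\<in>U. \<forall>b\<in>U. (x, b) \<notin> N' \<longrightarrow> norm (fdiff m (\<lambda>j. u (node \<tau> x b j))) \<le> A"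
    proof (intro ballI impI)
      fix x b assume xb: "x \<in> U" "b \<in> U" "(x, b) \<notin> N'"
      have "fdiff m (\<lambda>j. u (node \<tau> x b j)) = fdiff m (\<lambda>j. \<Phi> (node \<tau> x b j))"
        using xb \<Phi>u node_in_U by (intro fdiff_cong) (auto simp: N'_def)
      then show "norm (fdiff m (\<lambda>j. u (node \<tau> x b j))) \<le> A" using fd xb by (auto simp: N'_def)
    qed
    from near[OF u N'(1) A s N'(2) this] obtain g where
      g: "null g" "\<And>x. x \<in> good N' s \<Longrightarrow> norm (u x - g x) \<le> C * A" by blast
    have G: "good N' s \<in> sets borel" "emeasure lborel (U - good N' s) \<le> ennreal s"
      by (rule good_measurable[OF N'(1) s(1) N'(2)])+
    have "Z \<in> null_sets lborel" using Z by auto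
    then have "emeasure lborel ((U - good N' s) \<union> Z) \<le> ennreal s"
      using G by (subst emeasure_Un_null_set) auto
    moreover have "norm (\<Phi> x - g x) \<le> C * A" if "x \<in> U - ((U - good N' s) \<union> Z)" for x
      using that \<Phi>u g(2)[of x] by auto
    moreover have "(U - good N' s) \<union> Z \<in> sets borel" using G Z by auto
    ultimately show ?thesis using g(1) by blast
  qed
  then show ?thesis
    by (intro exI[of _ C] exI[of _ s0] conjI C s0 allI impI)
qed

end

lemma borel_version:
  fixes f :: "'a::euclidean_space \<Rightarrow> complex"
  assumes "f \<in> borel_measurable (lebesgue_on U)" "U \<in> sets lebesgue"
  obtains g Z where "g \<in> borel_measurable borel" "Z \<in> sets borel" "emeasure lborel Z = 0"
    "\<And>x. x \<in> U - Z \<Longrightarrow> f x = g x"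
proof -
  define F where "F x = (if x \<in> U then f x else 0)" for x
  have F: "F \<in> borel_measurable lebesgue" unfolding F_def by (rule borel_measurable_if_I[OF assms])
  have "(\<lambda>x. Re (F x)) \<in> borel_measurable lebesgue" "(\<lambda>x. Im (F x)) \<in> borel_measurable lebesgue"
    using F by auto
  then obtain g1 g2 where g1: "g1 \<in> borel_measurable lborel" "AE x in lborel. Re (F x) = g1 x"
    and g2: "g2 \<in> borel_measurable lborel" "AE x in lborel. Im (F x) = g2 x"
    using completion_ex_borel_measurable_real by metis
  have "AE x in lborel. F x = Complex (g1 x) (g2 x)"
    using g1(2) g2(2) by eventually_elim (simp add: complex_eq_iff)
  then obtain Z where Z: "{x \<in> space lborel. F x \<noteq> Complex (g1 x) (g2 x)} \<subseteq> Z" "emeasure lborel Z = 0" "Z \<in> sets lborel"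
    by (rule AE_E)
  show ?thesis
  proof (rule that[of "\<lambda>x. Complex (g1 x) (g2 x)" Z])
    show "(\<lambda>x. Complex (g1 x) (g2 x)) \<in> borel_measurable borel"
      using g1(1) g2(1) by (simp add: Complex_eq)
    show "f x = Complex (g1 x) (g2 x)" if "x \<in> U - Z" for x
    proof -
      have "F x = Complex (g1 x) (g2 x)" using that Z(1) by auto
      then show ?thesis using that by (simp add: F_def)
    qed
  qed (use Z in auto)
qed

section \<open>Rescaling to the unit ball\<close>

lemma measure_ball_lebesgue:
  fixes c :: "real ^ 'n"
  assumes "0 \<le> r"
  shows "measure lebesgue (ball c r) = r ^ CARD('n) * measure lborel (ball 0 1 :: (real ^ 'n) set)"
    and "measure lebesgue (cball c r) = r ^ CARD('n) * measure lborel (ball 0 1 :: (real ^ 'n) set)"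
  using content_ball_conv_unit_ball[OF assms, of c] assms
  by (simp_all add: content_cball_conv_ball)

lemma is_ballE:
  fixes c :: "real ^ 'n"
  assumes "is_ball c B"
  obtains r where "0 < r" "ball c r \<subseteq> B" "B \<subseteq> cball c r" "B \<in> lmeasurable"
    "measure lebesgue B = r ^ CARD('n) * measure lborel (ball 0 1 :: (real ^ 'n) set)"
  using assms measure_ball_lebesgue[of _ c] unfolding is_ball_def
  by (metis ball_subset_cball less_imp_le lmeasurable_ball lmeasurable_cball order_refl)

text \<open>The constants must be fixed before the balls. \<eta> enters only through the step ratio
  \<open>\<tau>\<close>, and the ratio of the two radii, which has no upper bound, cancels from the
  measure estimate.\<close>

lemma small_defect:
  fixes \<eta> :: real
  assumes \<eta>: "0 < \<eta>"
  defines "\<omega> \<equiv> measure lborel (ball 0 1 :: (real ^ 'n) set)"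
  shows "\<exists>C s0 K. 0 < s0 \<and> 0 < K \<and> (\<forall>(B :: (real ^ 'n) set) (B' :: (real ^ 'n) set) \<delta> A \<phi> P a.
    (\<exists>c. is_ball c B) \<longrightarrow> is_ball 0 B' \<longrightarrow> \<eta> * measure lebesgue B \<le> measure lebesgue B' \<longrightarrow>
    0 < \<delta> \<longrightarrow> sqrt (K * \<delta>) \<le> s0 \<longrightarrow> 0 \<le> A \<longrightarrow> \<phi> \<in> borel_measurable (lebesgue_on (B + B')) \<longrightarrow>
    (\<exists>E\<in>lmeasurable. measure lebesgue E \<le> \<delta> * measure lebesgue B * measure lebesgue B' \<and>
       (\<forall>x\<in>B. \<forall>h\<in>B'. (x, h) \<notin> E \<longrightarrow> norm (\<phi> (x + h) - \<phi> x - P h x) \<le> A)) \<longrightarrow>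
    (\<forall>h\<in>B'. \<forall>x\<in>B. P h x = poly_eval D (\<lambda>\<alpha>. a \<alpha> h) x) \<longrightarrow>
    (\<exists>Q. polynomial_of_degree_le (D + 1) Q \<and> (\<exists>F\<in>lmeasurable.
       measure lebesgue F \<le> sqrt (K * \<delta>) / \<omega> * measure lebesgue B \<and>
       (\<forall>x\<in>B. x \<notin> F \<longrightarrow> norm (\<phi> x - Q x) \<le> C * A))))"
proof -
  let ?d = "CARD('n)"
  define m where "m = D + 2"
  \<comment> \<open>In terms of radii the hypothesis on the measures says that their ratio is at
    least \<nu>.\<close>
  define \<nu> where "\<nu> = root ?d \<eta>"
  have \<nu>: "0 < \<nu>" "\<nu> ^ ?d = \<eta>" using \<eta> by (auto simp: \<nu>_def)
  \<comment> \<open>Ensures \<open>4 * \<tau> \<le> \<nu>\<close>, so that the steps fit into every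
    admissible \<open>B'\<close>, together with \<open>m * \<tau> \<le> 1 / 2\<close>.\<close>
  define \<tau> where "\<tau> = min \<nu> 1 / (4 * real m)"
  have m2: "2 \<le> m" by (simp add: m_def)
  have \<tau>0: "0 < \<tau>" "4 * real m * \<tau> = min \<nu> 1" using \<nu> m2 by (auto simp: \<tau>_def)
  have "4 * 1 * \<tau> \<le> 4 * real m * \<tau>" using m2 \<tau>0 by (intro mult_mono) auto
  then have \<tau>b: "0 < \<tau>" "real m * \<tau> \<le> 1 / 2" "4 * \<tau> \<le> \<nu>" using \<tau>0 by linarith+
  define U where "U = (ball 0 1 :: (real ^ 'n) set)"
  define \<kappa> where "\<kappa> = 1 + real m * (1 / \<tau> ^ DIM(real ^ 'n))"
  define e0 where "e0 = measure lborel U / (2 * \<kappa>)"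
  interpret differences m \<tau> \<kappa> e0 U
    by unfold_locales (use m2 \<tau>b in \<open>auto simp: U_def \<kappa>_def e0_def\<close>)
  have \<omega>: "0 < \<omega>" "measure lborel U = \<omega>" using measure_U_pos by (auto simp: \<omega>_def U_def)
  obtain C s0 where C: "0 < C" and s0: "0 < s0" and
    near: "\<forall>\<Phi> u Z N A s. u \<in> borel_measurable borel \<longrightarrow> Z \<in> sets borel \<longrightarrow> emeasure lborel Z = 0 \<longrightarrow>
     (\<forall>x\<in>U - Z. \<Phi> x = u x) \<longrightarrow> N \<in> sets borel \<longrightarrow> 0 \<le> A \<longrightarrow>
     0 < s \<longrightarrow> s \<le> s0 \<longrightarrow> emeasure lborel N \<le> ennreal (s * s) \<longrightarrow>
     (\<forall>x\<in>U. \<forall>b\<in>U. (x, b) \<notin> N \<longrightarrow> norm (fdiff m (\<lambda>j. \<Phi> (node \<tau> x b j))) \<le> A) \<longrightarrow>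
     (\<exists>g. null g \<and> (\<exists>F\<in>sets borel. emeasure lborel F \<le> ennreal s \<and> (\<forall>x\<in>U - F. norm (\<Phi> x - g x) \<le> C * A)))"
    using near_null_ae by (elim exE conjE) (rule that)
  \<comment> \<open>The \<open>4 * m\<close> comes from averaging over shifts; the power of 4
    combines the scaling to the nodes with the passage to the half ball, each costing a power of
    2.\<close>
  define K where "K = 4 * real m * (4 ^ ?d * \<omega>\<^sup>2)"
  have K: "0 < K" using m2 \<omega> by (simp add: K_def)
  have "\<exists>Q. polynomial_of_degree_le (D + 1) Q \<and> (\<exists>F\<in>lmeasurable.
       measure lebesgue F \<le> sqrt (K * \<delta>) / \<omega> * measure lebesgue B \<and>
       (\<forall>x\<in>B. x \<notin> F \<longrightarrow> norm (\<phi> x - Q x) \<le> (C * 2 ^ m) * A))"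
    if B: "\<exists>c. is_ball c B" and B': "is_ball 0 B'" and BB': "\<eta> * measure lebesgue B \<le> measure lebesgue B'"
      and \<delta>: "0 < \<delta>" "sqrt (K * \<delta>) \<le> s0" and A: "0 \<le> A" and \<phi>: "\<phi> \<in> borel_measurable (lebesgue_on (B + B'))"
      and E: "\<exists>E\<in>lmeasurable. measure lebesgue E \<le> \<delta> * measure lebesgue B * measure lebesgue B' \<and>
         (\<forall>x\<in>B. \<forall>h\<in>B'. (x, h) \<notin> E \<longrightarrow> norm (\<phi> (x + h) - \<phi> x - P h x) \<le> A)"
      and P: "\<forall>h\<in>B'. \<forall>x\<in>B. P h x = poly_eval D (\<lambda>\<alpha>. a \<alpha> h) x"
    for B B' :: "(real ^ 'n) set" and \<delta> A \<phi> P a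
  proof -
    obtain c r where r: "0 < r" "ball c r \<subseteq> B" "B \<subseteq> cball c r" "B \<in> lmeasurable"
      "measure lebesgue B = r ^ ?d * \<omega>"
      using B is_ballE unfolding \<omega>_def by metis
    obtain t where t: "0 < t" "ball 0 t \<subseteq> B'" "measure lebesgue B' = t ^ ?d * \<omega>"
      using B' is_ballE unfolding \<omega>_def by metis
    define \<sigma> where "\<sigma> = t / r"
    have \<sigma>: "0 < \<sigma>" "t = \<sigma> * r" using r t by (auto simp: \<sigma>_def)
    have "\<nu> ^ ?d * r ^ ?d * \<omega> \<le> \<sigma> ^ ?d * r ^ ?d * \<omega>"
      using BB' unfolding r(5) t(3) \<nu>(2) \<sigma>(2) power_mult_distrib by (simp only: mult.assoc)
    then have "\<nu> ^ ?d \<le> \<sigma> ^ ?d" using r(1) \<omega>(1) by simp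
    then have "\<nu> \<le> \<sigma>" using \<sigma>(1) by (simp add: power_mono_iff \<nu>(1) less_imp_le)
    then have \<tau>\<sigma>: "4 * \<tau> \<le> \<sigma>" using \<tau>b(3) by linarith
    have inB: "c + r *\<^sub>R y \<in> ball c r" if "y \<in> U" for y
      using that r(1) by (simp add: U_def dist_norm)
    have inB': "r *\<^sub>R l \<in> ball 0 t" if "l \<in> ball 0 \<sigma>" for l :: "real ^ 'n"
      using that r(1) by (simp add: \<sigma>(2) mult.commute)
    obtain E where EM: "E \<in> lmeasurable" "measure lebesgue E \<le> \<delta> * measure lebesgue B * measure lebesgue B'"
      and close: "\<And>x h. x \<in> B \<Longrightarrow> h \<in> B' \<Longrightarrow> (x, h) \<notin> E \<Longrightarrow> norm (\<phi> (x + h) - \<phi> x - P h x) \<le> A"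
      using E by blast
    \<comment> \<open>A Borel hull of the exceptional set with the same measure.\<close>
    obtain E1 where E1: "E1 \<in> sets lborel" "E \<subseteq> E1" "emeasure lebesgue E = emeasure lborel E1"
      using completion_upper[of E lborel] EM(1) by (auto simp: fmeasurable_def)
    define E0 where "E0 = (\<lambda>p. (c, 0) + r *\<^sub>R p) -` E1"
    \<comment> \<open>The bound on the measure of \<open>E\<close> after scaling both variables by
      \<open>r\<close>.\<close>
    define \<epsilon> where "\<epsilon> = \<delta> * \<omega>\<^sup>2 * \<sigma> ^ ?d"
    have E1s: "E1 \<in> sets borel" using E1(1) by simp
    have E0s: "E0 \<in> sets borel"
      unfolding E0_def using measurable_sets[of "\<lambda>p. (c, 0) + r *\<^sub>R p" borel borel E1] E1s by simp
    have \<epsilon>: "0 < \<epsilon>" using \<delta> \<omega> \<sigma> by (simp add: \<epsilon>_def)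
    have E0\<epsilon>: "emeasure lborel E0 \<le> ennreal \<epsilon>"
    proof -
      have "emeasure lborel E0 = ennreal (1 / \<bar>r\<bar> ^ DIM((real ^ 'n) \<times> (real ^ 'n))) * emeasure lborel E1"
        unfolding E0_def using r(1) by (intro emeasure_lborel_affine_vimage E1s) simp
      also have "emeasure lborel E1 = ennreal (measure lebesgue E)"
        using E1(3) EM(1) by (simp add: emeasure_eq_measure2)
      also have "ennreal (1 / \<bar>r\<bar> ^ DIM((real ^ 'n) \<times> (real ^ 'n))) * ennreal (measure lebesgue E)
          = ennreal (1 / r ^ (?d + ?d) * measure lebesgue E)"
        using r(1) by (subst ennreal_mult) auto
      also have "\<dots> \<le> ennreal (1 / r ^ (?d + ?d) * (\<delta> * (r ^ ?d * \<omega>) * ((\<sigma> * r) ^ ?d * \<omega>)))"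
        using r(1) EM(2) unfolding r(5) t(3) \<sigma>(2) by (intro ennreal_leI mult_left_mono) auto
      also have "1 / r ^ (?d + ?d) * (\<delta> * (r ^ ?d * \<omega>) * ((\<sigma> * r) ^ ?d * \<omega>)) = \<epsilon>"
        using r(1) by (simp add: \<epsilon>_def power_add power_mult_distrib power2_eq_square)
      finally show ?thesis .
    qed
    define \<Phi> where "\<Phi> y = \<phi> (c + r *\<^sub>R y)" for y
    define R where "R l y = P (r *\<^sub>R l) (c + r *\<^sub>R y)" for l y
    have shift: "\<exists>N\<in>sets borel. emeasure lborel N \<le>
        ennreal (4 * real m * (2 ^ DIM(real ^ 'n) * measure lborel U * \<epsilon>) / measure lborel (ball 0 (\<sigma> / 2) :: (real ^ 'n) set)) \<and>
        (\<forall>x\<in>U. \<forall>b\<in>U. (x, b) \<notin> N \<longrightarrow> norm (fdiff m (\<lambda>j. \<Phi> (node \<tau> x b j))) \<le> 2 ^ m * A)"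
    proof (rule good_shift[OF E0s E0\<epsilon> \<epsilon> \<tau>\<sigma>])
      fix y l :: "real ^ 'n" assume y: "y \<in> U" and l: "l \<in> ball 0 \<sigma>" and nE: "(y, l) \<notin> E0"
      have "(c + r *\<^sub>R y, r *\<^sub>R l) \<notin> E" using nE E1(2) by (auto simp: E0_def)
      then have "norm (\<phi> ((c + r *\<^sub>R y) + r *\<^sub>R l) - \<phi> (c + r *\<^sub>R y) - P (r *\<^sub>R l) (c + r *\<^sub>R y)) \<le> A"
        using inB[OF y] inB'[OF l] r(2) t(2) by (intro close) auto
      then show "norm (\<Phi> (y + l) - \<Phi> y - R l y) \<le> A"
        by (simp add: \<Phi>_def R_def algebra_simps)
    next
      fix l x b :: "real ^ 'n" and k :: nat assume l: "l \<in> ball 0 \<sigma>" and xb: "x \<in> U" "b \<in> U" and k: "k \<le> 1"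
      have "fdiff (m - 1) (\<lambda>i. R l (node \<tau> x b (i + k)))
        = fdiff (m - 1) (\<lambda>i. poly_eval D (\<lambda>\<alpha>. a \<alpha> (r *\<^sub>R l)) ((c + r *\<^sub>R node \<tau> x b k) + real i *\<^sub>R ((r * \<tau>) *\<^sub>R (b - x))))"
      proof (rule fdiff_cong)
        fix i assume "i \<le> m - 1"
        then have "i + k \<le> m" using k m2 by linarith
        then have "c + r *\<^sub>R node \<tau> x b (i + k) \<in> B" using inB[OF node_in_U[OF xb]] r(2) by blast
        moreover have "r *\<^sub>R l \<in> B'" using inB'[OF l] t(2) by blast
        ultimately have "R l (node \<tau> x b (i + k)) = poly_eval D (\<lambda>\<alpha>. a \<alpha> (r *\<^sub>R l)) (c + r *\<^sub>R node \<tau> x b (i + k))"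
          using P unfolding R_def by blast
        also have "c + r *\<^sub>R node \<tau> x b (i + k) = (c + r *\<^sub>R node \<tau> x b k) + real i *\<^sub>R ((r * \<tau>) *\<^sub>R (b - x))"
          by (simp add: node_def algebra_simps)
        finally show "R l (node \<tau> x b (i + k)) = poly_eval D (\<lambda>\<alpha>. a \<alpha> (r *\<^sub>R l))
            ((c + r *\<^sub>R node \<tau> x b k) + real i *\<^sub>R ((r * \<tau>) *\<^sub>R (b - x)))" .
      qed
      also have "\<dots> = 0" by (rule fdiff_poly_eval_line) (simp add: m_def)
      finally show "fdiff (m - 1) (\<lambda>i. R l (node \<tau> x b (i + k))) = 0" .
    qed
    define s where "s = sqrt (K * \<delta>)"
    have s: "0 < s" "s \<le> s0" "s * s = K * \<delta>" using \<delta> K by (auto simp: s_def)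
    \<comment> \<open>The power of \<sigma> in \<epsilon> cancels against the measure of the half
      ball, so \<open>s\<close> depends on \<delta> but not on the balls.\<close>
    have "4 * real m * (2 ^ DIM(real ^ 'n) * measure lborel U * \<epsilon>) / measure lborel (ball 0 (\<sigma> / 2) :: (real ^ 'n) set) = s * s"
    proof -
      have "measure lborel (ball 0 (\<sigma> / 2) :: (real ^ 'n) set) = (\<sigma> / 2) ^ ?d * \<omega>"
        using content_ball_conv_unit_ball[of "\<sigma> / 2" "0 :: real ^ 'n"] \<sigma>(1) by (simp add: \<omega>_def)
      moreover have "(4 :: real) ^ ?d = 2 ^ ?d * 2 ^ ?d" by (simp flip: power_mult_distrib)
      ultimately show ?thesis using \<sigma>(1) \<omega>
        by (simp add: s(3) K_def \<epsilon>_def power_divide power2_eq_square)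
    qed
    with shift obtain N where N: "N \<in> sets borel" "emeasure lborel N \<le> ennreal (s * s)"
      "\<forall>x\<in>U. \<forall>b\<in>U. (x, b) \<notin> N \<longrightarrow> norm (fdiff m (\<lambda>j. \<Phi> (node \<tau> x b j))) \<le> 2 ^ m * A"
      by auto
    have "0 \<in> B'" using t by auto
    then have "ball c r \<subseteq> B + B'" using r(2) set_zero_plus2[of B' B] by (auto simp: add.commute)
    then have "\<phi> \<in> borel_measurable (lebesgue_on (ball c r))"
      using \<phi> by (rule measurable_restrict_mono[rotated])
    then obtain w Z where w: "w \<in> borel_measurable borel" "Z \<in> sets borel" "emeasure lborel Z = 0"
      "\<And>x. x \<in> ball c r - Z \<Longrightarrow> \<phi> x = w x"
      by (rule borel_version) auto
    define Z' where "Z' = (\<lambda>y. c + r *\<^sub>R y) -` Z"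
    have Z': "Z' \<in> sets borel" "emeasure lborel Z' = 0"
      unfolding Z'_def using measurable_sets[of "\<lambda>y. c + r *\<^sub>R y" borel borel Z] w(2,3) r(1)
      by (simp_all add: emeasure_lborel_affine_vimage)
    have wm: "(\<lambda>y. w (c + r *\<^sub>R y)) \<in> borel_measurable borel" using w(1) by measurable
    have \<Phi>w: "\<forall>y\<in>U - Z'. \<Phi> y = w (c + r *\<^sub>R y)" using inB w(4) by (auto simp: \<Phi>_def Z'_def)
    have A2: "0 \<le> 2 ^ m * A" using A by simp
    obtain g F0 where g: "null g" and F0: "F0 \<in> sets borel" "emeasure lborel F0 \<le> ennreal s"
      "\<And>y. y \<in> U - F0 \<Longrightarrow> norm (\<Phi> y - g y) \<le> C * (2 ^ m * A)"
      using near[THEN spec, THEN spec, THEN spec, THEN spec, THEN spec, THEN spec, THEN mp, THEN mp, THEN mp, THEN mp, THEN mp, THEN mp, THEN mp, THEN mp, THEN mp, THEN mp, OF wm Z' \<Phi>w N(1) A2 s(1,2) N(2,3)] by blast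
    have g_cont: "continuous_on U g"
      and g_fd: "\<And>x b. x \<in> U \<Longrightarrow> b \<in> U \<Longrightarrow> fdiff m (\<lambda>j. g (node \<tau> x b j)) = 0"
      using g by (auto simp: null_def)
    have "\<exists>Q. polynomial_of_degree_le (m - 1) Q \<and> (\<forall>x\<in>ball 0 1. g x = Q x)"
    proof (rule frechet_polynomial[OF m \<tau> g_cont[unfolded U_def]])
      show "fdiff m (\<lambda>j. g (node \<tau> x b j)) = 0" if "x \<in> ball 0 1" "b \<in> ball 0 1" for x b
        using that by (intro g_fd) (simp_all add: U_def)
    qed
    then obtain Q0 where Q0: "polynomial_of_degree_le (D + 1) Q0" "\<And>y. y \<in> U \<Longrightarrow> g y = Q0 y"
      by (auto simp: m_def U_def)
    define Q where "Q x = Q0 ((1 / r) *\<^sub>R (x - c))" for x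
    have Qpoly: "polynomial_of_degree_le (D + 1) Q"
      unfolding Q_def by (rule polynomial_of_degree_le_affine[OF Q0(1)])
    \<comment> \<open>The image of \<open>F0\<close> under the map from \<open>y\<close> to
      \<open>c + r *\<^sub>R y\<close>, written as a preimage so that the scaling formula
      applies.\<close>
    define F1 where "F1 = (\<lambda>x. - (1 / r) *\<^sub>R c + (1 / r) *\<^sub>R x) -` F0"
    have F1s: "F1 \<in> sets borel"
      unfolding F1_def using measurable_sets[of "\<lambda>x. - (1 / r) *\<^sub>R c + (1 / r) *\<^sub>R x" borel borel F0] F0(1) by simp
    have F1e: "emeasure lborel F1 \<le> ennreal (r ^ ?d * s)"
    proof -
      have "emeasure lborel F1 = ennreal (1 / \<bar>1 / r\<bar> ^ DIM(real ^ 'n)) * emeasure lborel F0"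
        unfolding F1_def using r(1) by (intro emeasure_lborel_affine_vimage F0) simp
      also have "\<dots> \<le> ennreal (r ^ ?d) * ennreal s"
        using r(1) F0(2) by (intro mult_mono) (auto simp: power_one_over)
      also have "\<dots> = ennreal (r ^ ?d * s)" using r(1) s(1) by (simp add: ennreal_mult)
      finally show ?thesis .
    qed
    have F1l: "F1 \<in> lmeasurable"
    proof (rule fmeasurableI)
      show "F1 \<in> sets lebesgue" using F1s by simp
      have "emeasure lebesgue F1 = emeasure lborel F1" using F1s by simp
      also have "\<dots> < \<infinity>" using F1e by (rule le_less_trans) simp
      finally show "emeasure lebesgue F1 < \<infinity>" .
    qed
    have F1m: "measure lebesgue F1 \<le> r ^ ?d * s"
    proof -
      have "measure lebesgue F1 = measure lborel F1" using F1s by (simp add: measure_completion)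
      also have "\<dots> \<le> r ^ ?d * s"
        unfolding measure_def using F1e r(1) s(1) by (intro enn2real_leI) auto
      finally show ?thesis .
    qed
    \<comment> \<open>\<open>B\<close> may be closed whereas \<open>U\<close> is open; the boundary
      sphere joins the exceptional set at no cost in measure.\<close>
    have sph: "sphere c r \<in> lmeasurable" "measure lebesgue (sphere c r) = 0"
      using negligible_sphere[of c r] negligible_imp_measure0 negligible_imp_measurable by blast+
    have "measure lebesgue (F1 \<union> sphere c r) \<le> measure lebesgue F1 + measure lebesgue (sphere c r)"
      using F1l sph(1) by (intro measure_Un_le) auto
    also have "\<dots> \<le> r ^ ?d * s" using F1m sph(2) by simp
    also have "\<dots> = sqrt (K * \<delta>) / \<omega> * measure lebesgue B"
      using \<omega>(1) unfolding r(5) s_def by simp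
    finally have meas: "measure lebesgue (F1 \<union> sphere c r) \<le> sqrt (K * \<delta>) / \<omega> * measure lebesgue B" .
    have "norm (\<phi> x - Q x) \<le> (C * 2 ^ m) * A" if x: "x \<in> B" "x \<notin> F1 \<union> sphere c r" for x
    proof -
      define y where "y = (1 / r) *\<^sub>R (x - c)"
      have xy: "x = c + r *\<^sub>R y" using r(1) by (simp add: y_def)
      have "x \<in> ball c r" using x r(3) by (auto simp: sphere_def cball_def ball_def)
      then have yU: "y \<in> U" using r(1) by (simp add: xy U_def dist_norm)
      have "y \<notin> F0" using x(2) by (auto simp: F1_def y_def algebra_simps)
      then have "norm (\<Phi> y - g y) \<le> C * (2 ^ m * A)" using yU F0(3) by blast
      moreover have "\<Phi> y = \<phi> x" by (simp add: \<Phi>_def xy)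
      moreover have "g y = Q x" using Q0(2)[OF yU] by (simp add: Q_def y_def)
      ultimately show ?thesis by (simp add: mult.assoc)
    qed
    with Qpoly meas fmeasurable.Un[OF F1l sph(1)] show ?thesis by blast
  qed
  then show ?thesis
    by (intro exI[of _ "C * 2 ^ m"] exI[of _ s0] exI[of _ K] conjI s0 K allI impI)
qed

theorem theorem3p1:
  fixes D :: nat and \<eta> :: real
  assumes "\<eta> > 0"
  shows "\<exists>(C :: real) (\<epsilon> :: real \<Rightarrow> real).
    (\<epsilon> \<longlongrightarrow> 0) (at_right 0) \<and>
    (\<forall>(B :: (real ^ 'n) set) (B' :: (real ^ 'n) set) (\<delta> :: real) (A :: real)
       (\<phi> :: real ^ 'n \<Rightarrow> complex) (P :: real ^ 'n \<Rightarrow> real ^ 'n \<Rightarrow> complex)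
       (a :: ('n \<Rightarrow> nat) \<Rightarrow> real ^ 'n \<Rightarrow> complex).
       (\<exists>c. is_ball c B) \<longrightarrow>
       is_ball 0 B' \<longrightarrow>
       measure lebesgue B' \<ge> \<eta> * measure lebesgue B \<longrightarrow>
       0 < \<delta> \<longrightarrow> \<delta> \<le> 1 \<longrightarrow> 0 \<le> A \<longrightarrow>
       \<phi> \<in> borel_measurable (lebesgue_on (B + B')) \<longrightarrow>
       (\<exists>E \<in> lmeasurable.
          measure lebesgue E \<le> \<delta> * measure lebesgue B * measure lebesgue B' \<and>
          (\<forall>x\<in>B. \<forall>h\<in>B'. (x, h) \<notin> E \<longrightarrow> norm (\<phi> (x + h) - \<phi> x - P h x) \<le> A)) \<longrightarrow>
       (\<forall>\<alpha>. mi_degree \<alpha> \<le> D \<longrightarrow> a \<alpha> \<in> borel_measurable (lebesgue_on B')) \<longrightarrow>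
       (\<forall>h\<in>B'. \<forall>x\<in>B. P h x = poly_eval D (\<lambda>\<alpha>. a \<alpha> h) x) \<longrightarrow>
       (\<exists>Q. polynomial_of_degree_le (D + 1) Q \<and>
          (\<exists>F \<in> lmeasurable.
             measure lebesgue F \<le> \<epsilon> \<delta> * measure lebesgue B \<and>
             (\<forall>x\<in>B. x \<notin> F \<longrightarrow> norm (\<phi> x - Q x) \<le> C * A))))"
proof -
  define \<omega> where "\<omega> = measure lborel (ball 0 1 :: (real ^ 'n) set)"
  obtain C s0 K where s0: "0 < s0" and K: "0 < K" and
    main: "\<forall>(B :: (real ^ 'n) set) (B' :: (real ^ 'n) set) \<delta> A \<phi> P a.
    (\<exists>c. is_ball c B) \<longrightarrow> is_ball 0 B' \<longrightarrow> \<eta> * measure lebesgue B \<le> measure lebesgue B' \<longrightarrow>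
    0 < \<delta> \<longrightarrow> sqrt (K * \<delta>) \<le> s0 \<longrightarrow> 0 \<le> A \<longrightarrow> \<phi> \<in> borel_measurable (lebesgue_on (B + B')) \<longrightarrow>
    (\<exists>E\<in>lmeasurable. measure lebesgue E \<le> \<delta> * measure lebesgue B * measure lebesgue B' \<and>
       (\<forall>x\<in>B. \<forall>h\<in>B'. (x, h) \<notin> E \<longrightarrow> norm (\<phi> (x + h) - \<phi> x - P h x) \<le> A)) \<longrightarrow>
    (\<forall>h\<in>B'. \<forall>x\<in>B. P h x = poly_eval D (\<lambda>\<alpha>. a \<alpha> h) x) \<longrightarrow>
    (\<exists>Q. polynomial_of_degree_le (D + 1) Q \<and> (\<exists>F\<in>lmeasurable.
       measure lebesgue F \<le> sqrt (K * \<delta>) / \<omega> * measure lebesgue B \<and>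
       (\<forall>x\<in>B. x \<notin> F \<longrightarrow> norm (\<phi> x - Q x) \<le> C * A)))"
    using small_defect[OF assms, of D, where ?'n = 'n, folded \<omega>_def] by (elim exE conjE) (rule that)
  \<comment> \<open>For large \<open>\<delta>\<close> the value 1 allows \<open>F = B\<close>.\<close>
  define \<epsilon> where "\<epsilon> \<delta> = (if sqrt (K * \<delta>) \<le> s0 then sqrt (K * \<delta>) / \<omega> else 1)" for \<delta>
  have lim: "((\<lambda>\<delta>. sqrt (K * \<delta>)) \<longlongrightarrow> 0) (at_right 0)"
    by (rule tendsto_eq_intros refl | simp)+
  show ?thesis
  proof (intro exI[of _ C] exI[of _ \<epsilon>] conjI allI impI)
    have "((\<lambda>\<delta>. sqrt (K * \<delta>) / \<omega>) \<longlongrightarrow> 0) (at_right 0)"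
      using tendsto_mult_left_zero[OF lim, of "1 / \<omega>"] by simp
    moreover have "\<forall>\<^sub>F \<delta> in at_right 0. sqrt (K * \<delta>) / \<omega> = \<epsilon> \<delta>"
      using order_tendstoD(2)[OF lim s0] by eventually_elim (simp add: \<epsilon>_def)
    ultimately show "(\<epsilon> \<longlongrightarrow> 0) (at_right 0)" by (rule Lim_transform_eventually)
  next
    fix B B' :: "(real ^ 'n) set" and \<delta> A :: real and \<phi> :: "real ^ 'n \<Rightarrow> complex"
      and P :: "real ^ 'n \<Rightarrow> real ^ 'n \<Rightarrow> complex" and a :: "('n \<Rightarrow> nat) \<Rightarrow> real ^ 'n \<Rightarrow> complex"
    assume B: "\<exists>c. is_ball c B" and B': "is_ball 0 B'" "\<eta> * measure lebesgue B \<le> measure lebesgue B'"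
      and \<delta>: "0 < \<delta>" "\<delta> \<le> 1" and A: "0 \<le> A" and \<phi>: "\<phi> \<in> borel_measurable (lebesgue_on (B + B'))"
      and E: "\<exists>E\<in>lmeasurable. measure lebesgue E \<le> \<delta> * measure lebesgue B * measure lebesgue B' \<and>
         (\<forall>x\<in>B. \<forall>h\<in>B'. (x, h) \<notin> E \<longrightarrow> norm (\<phi> (x + h) - \<phi> x - P h x) \<le> A)"
      and P: "\<forall>h\<in>B'. \<forall>x\<in>B. P h x = poly_eval D (\<lambda>\<alpha>. a \<alpha> h) x"
    show "\<exists>Q. polynomial_of_degree_le (D + 1) Q \<and> (\<exists>F\<in>lmeasurable.
       measure lebesgue F \<le> \<epsilon> \<delta> * measure lebesgue B \<and> (\<forall>x\<in>B. x \<notin> F \<longrightarrow> norm (\<phi> x - Q x) \<le> C * A))"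
    proof (cases "sqrt (K * \<delta>) \<le> s0")
      case True
      from main[THEN spec, THEN spec, THEN spec, THEN spec, THEN spec, THEN spec, THEN spec, THEN mp, THEN mp, THEN mp, THEN mp, THEN mp, THEN mp, THEN mp, THEN mp, THEN mp, OF B B' \<delta>(1) True A \<phi> E P] True show ?thesis by (simp add: \<epsilon>_def)
    next
      case False
      obtain c where "is_ball c B" using B ..
      then have "B \<in> lmeasurable" by (rule is_ballE)
      then have "\<exists>F\<in>lmeasurable. measure lebesgue F \<le> \<epsilon> \<delta> * measure lebesgue B \<and> (\<forall>x\<in>B. x \<notin> F \<longrightarrow> norm (\<phi> x - 0) \<le> C * A)"
        using False by (intro bexI[of _ B]) (auto simp: \<epsilon>_def)
      then show ?thesis using polynomial_of_degree_le_0 by blast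
    qed
  qed
qed

end
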